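(* Let $(\boldsymbol{u}^{n+1}, p^{n+1}, \boldsymbol{\eta}^{n+1}, \boldsymbol{\xi}^{n+1})$ be a sufficiently regular solution of the reformulated (continuous-in-time, decoupled) fluid and structure Robin systems (F) and (S) described in the context on $[t_n,t_{n+1}]$, for $n=0,1,\dots,N-1$. Then, for every $1\le M\le N$, $$\mathbb{E}^M+\sum_{n=1}^M\mathbb{H}^n+\mathbb{I}^M\le \mathbb{E}^0+\mathbb{I}^0,$$ where $\mathbb{E}^n$, $\mathbb{H}^n$, $\mathbb{I}^n$ are the energy, dissipation and interface quantities defined in the context.
   Context: Setting. $\Omega_f,\Omega_s\subset\mathbb{R}^d$, $d\in\{2,3\}$, are fixed regular bounded domains (fluid and structure) sharing an interface $\Gamma$; $\boldsymbol{n}_f$ and $\boldsymbol{n}_s$ are their outward unit normals, with $\boldsymbol{n}_f=-\boldsymbol{n}_s$ on $\Gamma$. The constants $\rho_f,\mu_f,\rho_s,\mu_s,\lambda_s$ are positive, and $L>0$ is a constant (the Robin parameter). On the parts of $\partial\Omega_f$ and $\partial\Omega_s$ other than $\Gamma$, either homogeneous Dirichlet conditions ($\boldsymbol{u}=\boldsymbol{0}$, resp. $\boldsymbol{\eta}=\boldsymbol{\xi}=\boldsymbol{0}$) or homogeneous natural (zero-traction) conditions are imposed. Put $\mathbb{D}(\boldsymbol{v})=\frac12(\nabla\boldsymbol{v}+(\nabla\boldsymbol{v})^T)$, $\boldsymbol{\sigma}_f(\boldsymbol{u},p)=-p\boldsymbol{I}+2\mu_f\mathbb{D}(\boldsymbol{u})$,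 $\boldsymbol{\sigma}_s(\boldsymbol{\eta})=2\mu_s\mathbb{D}(\boldsymbol{\eta})+\lambda_s(\nabla\cdot\boldsymbol{\eta})\boldsymbol{I}$. Time partition: $T>0$, $N\ge1$, $\Delta t=T/N$, $t_n=n\Delta t$. The functions with superscript $n+1$ are functions of space and of $t\in[t_n,t_{n+1}]$; $\boldsymbol{\sigma}_f^{n+1}=\boldsymbol{\sigma}_f(\boldsymbol{u}^{n+1},p^{n+1})$ and $\boldsymbol{\sigma}_s^{n+1}=\boldsymbol{\sigma}_s(\boldsymbol{\eta}^{n+1})$. Superscript $0$ denotes the given initial data at $t_0=0$ (including the initial stresses). Time shift: for $n\ge1$ and any quantity $v^n$ defined on $[t_{n-1},t_n]$, $\tilde v^n(t)=v^n(t-\Delta t)$ for $t\in[t_n,t_{n+1}]$; for $n=0$, $\tilde v^0(t)=v^0(t_0)$. (F) Fluid subproblem on $[t_n,t_{n+1}]$: find $\boldsymbol{u}^{n+1},p^{n+1}$ with $$\rho_f\partial_t\boldsymbol{u}^{n+1}-\nabla\cdot\boldsymbol{\sigma}_f^{n+1}=0,\quad \nabla\cdot\boldsymbol{u}^{n+1}=0\ \text{ in }\Omega_f\times[t_n,t_{n+1}],\qquad \boldsymbol{u}^{n+1}(\cdot,t_n)=\boldsymbol{u}^n(\cdot,t_n)\ \text{ in }\Omega_f,$$ $$L\boldsymbol{u}^{n+1}+\boldsymbol{\sigma}_f^{n+1}\boldsymbol{n}_f=\tfrac L2\tilde{\boldsymbol{u}}^n+\tfrac L2\tilde{\boldsymbol{\xi}}^n+\tfrac12\tilde{\boldsymbol{\sigma}}_f^n\boldsymbol{n}_f+\tfrac12\tilde{\boldsymbol{\sigma}}_s^n\boldsymbol{n}_f\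 \text{ on }\Gamma\times[t_n,t_{n+1}].$$ (S) Structure subproblem on $[t_n,t_{n+1}]$: find $\boldsymbol{\eta}^{n+1},\boldsymbol{\xi}^{n+1}$ with $$\partial_t\boldsymbol{\eta}^{n+1}=\boldsymbol{\xi}^{n+1},\quad \rho_s\partial_t\boldsymbol{\xi}^{n+1}-\nabla\cdot\boldsymbol{\sigma}_s^{n+1}=0\ \text{ in }\Omega_s\times[t_n,t_{n+1}],$$ $$\boldsymbol{\xi}^{n+1}(\cdot,t_n)=\boldsymbol{\xi}^n(\cdot,t_n),\quad \boldsymbol{\eta}^{n+1}(\cdot,t_n)=\boldsymbol{\eta}^n(\cdot,t_n)\ \text{ in }\Omega_s,$$ $$L\boldsymbol{\xi}^{n+1}+\boldsymbol{\sigma}_s^{n+1}\boldsymbol{n}_s=\tfrac L2\tilde{\boldsymbol{u}}^n+\tfrac L2\tilde{\boldsymbol{\xi}}^n+\tfrac12\tilde{\boldsymbol{\sigma}}_f^n\boldsymbol{n}_s+\tfrac12\tilde{\boldsymbol{\sigma}}_s^n\boldsymbol{n}_s\ \text{ on }\Gamma\times[t_n,t_{n+1}].$$ Standing regularity: the subproblems are assumed well-posed with sufficiently regular solutions; in particular $\boldsymbol{u}^{n+1},\ \boldsymbol{\sigma}_f^{n+1}\boldsymbol{n},\ \boldsymbol{\xi}^{n+1},\ \boldsymbol{\sigma}_s^{n+1}\boldsymbol{n}$ are in $L^2(t_n,t_{n+1};L^2(\Gamma))$. Norms: $\|\cdot\|_f,\|\cdot\|_s,\|\cdot\|_\Gamma$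 are the $L^2$ norms on $\Omega_f,\Omega_s,\Gamma$, and $\|\boldsymbol{\eta}\|_E^2=2\mu_s\|\mathbb{D}(\boldsymbol{\eta})\|_s^2+\lambda_s\|\nabla\cdot\boldsymbol{\eta}\|_s^2$. Quantities. For $0\le n\le N$, $$\mathbb{E}^n=\tfrac{\rho_s}{2}\|\boldsymbol{\xi}^n(t_n)\|_s^2+\tfrac12\|\boldsymbol{\eta}^n(t_n)\|_E^2+\tfrac{\rho_f}{2}\|\boldsymbol{u}^n(t_n)\|_f^2,$$ and for $1\le n\le N$, $$\mathbb{H}^n=2\mu_f\int_{t_{n-1}}^{t_n}\|\mathbb{D}(\boldsymbol{u}^n)\|_f^2\,dt,$$ $$\mathbb{I}^n=\tfrac L2\int_{t_{n-1}}^{t_n}\big(\|\boldsymbol{u}^n\|_\Gamma^2+\|\boldsymbol{\xi}^n\|_\Gamma^2\big)dt+\tfrac1{2L}\int_{t_{n-1}}^{t_n}\big(\|\boldsymbol{\sigma}_f^n\boldsymbol{n}_f\|_\Gamma^2+\|\boldsymbol{\sigma}_s^n\boldsymbol{n}_s\|_\Gamma^2\big)dt,$$ while $$\mathbb{I}^0=\tfrac{L\Delta t}{2}\big(\|\boldsymbol{u}^0(t_0)\|_\Gamma^2+\|\boldsymbol{\xi}^0(t_0)\|_\Gamma^2\big)+\tfrac{\Delta t}{2L}\big(\|\boldsymbol{\sigma}_f^0(t_0)\boldsymbol{n}_f\|_\Gamma^2+\|\boldsymbol{\sigma}_s^0(t_0)\boldsymbol{n}_s\|_\Gamma^2\big).$$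 *)

theory Defs
  imports "HOL-Analysis.Analysis"
begin

text \<open>
  Inside the ball, the set is the region below the graph of a Lipschitz function, seen in the
  direction of the unit vector \<open>e\<close>. The function \<open>g\<close> is given on the whole space and is constant
  along \<open>e\<close>, so it is a function on the hyperplane orthogonal to \<open>e\<close>; this avoids a separate type
  for that hyperplane. By Rademacher's theorem the last clause is implied by the Lipschitz
  condition (which loses nothing by being global, since Lipschitz functions extend).
\<close>

definition lipschitz_chart ::
    "'a::euclidean_space set \<Rightarrow> 'a \<Rightarrow> real \<Rightarrow> 'a \<Rightarrow> ('a \<Rightarrow> real) \<Rightarrow> bool" where
  "lipschitz_chart \<Omega> x r e g \<longleftrightarrow>
     r > 0 \<and> norm e = 1 \<and>
     \<Omega> \<inter> ball x r = {y \<in> ball x r. y \<bullet> e < g y} \<and>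
     (\<forall>y s. g (y + s *\<^sub>R e) = g y) \<and>
     (\<exists>C. C-lipschitz_on UNIV g) \<and>
     (AE y in lborel. g differentiable (at y))"

definition lipschitz_domain :: "'a::euclidean_space set \<Rightarrow> bool" where
  "lipschitz_domain \<Omega> \<longleftrightarrow>
     open \<Omega> \<and> connected \<Omega> \<and> \<Omega> \<noteq> {} \<and> bounded \<Omega> \<and>
     (\<forall>x\<in>frontier \<Omega>. \<exists>r e g. lipschitz_chart \<Omega> x r e g)"

text \<open>
  The unit vector \<open>\<nu>\<close> is the outward normal at \<open>x\<close> if, to first order at \<open>x\<close>, the set is the
  half-space \<open>{y. (y - x) \<bullet> \<nu> < 0}\<close>. It is unique if it exists, and for a Lipschitz domain it exists
  at almost every boundary point, namely wherever a chart is differentiable.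
\<close>

definition is_outward_normal :: "'a::euclidean_space set \<Rightarrow> 'a \<Rightarrow> 'a \<Rightarrow> bool" where
  "is_outward_normal \<Omega> x \<nu> \<longleftrightarrow>
     norm \<nu> = 1 \<and>
     (\<forall>\<epsilon>>0. \<exists>r>0. \<forall>y\<in>ball x r.
        ((y - x) \<bullet> \<nu> < - \<epsilon> * norm (y - x) \<longrightarrow> y \<in> \<Omega>) \<and>
        ((y - x) \<bullet> \<nu> > \<epsilon> * norm (y - x) \<longrightarrow> y \<notin> \<Omega>))"

definition outward_normal :: "'a::euclidean_space set \<Rightarrow> 'a \<Rightarrow> 'a" where
  "outward_normal \<Omega> x = (THE \<nu>. is_outward_normal \<Omega> x \<nu>)"

text \<open>
  The restriction of \<open>\<sigma>\<close> to the boundary is the surface measure: in every chart it is the integral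
  of \<open>sqrt (1 + |\<nabla>g|\<^sup>2)\<close> over the hyperplane \<open>e\<^sup>\<bottom>\<close>. The \<open>(d-1)\<close>-dimensional Lebesgue measure of a
  subset of the hyperplane is written as the \<open>d\<close>-dimensional measure of the cylinder of height 1
  over it; \<open>y - (y \<bullet> e) e + g y e\<close> is the point of the graph lying over \<open>y\<close>. The
  \<open>(d-1)\<close>-dimensional Hausdorff measure satisfies this for every Lipschitz domain, and since the
  charts cover the boundary there is no other choice there; no condition is put on \<open>\<sigma>\<close> elsewhere,
  so that one measure can serve two domains. As for \<open>lebesgue\<close>, the Borel measure is completed: the
  outward normal is only determined almost everywhere.
\<close>

definition surface_measure :: "'a::euclidean_space set \<Rightarrow> 'a measure \<Rightarrow> bool" where
  "surface_measure \<Omega> \<sigma> \<longleftrightarrow>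
     (\<exists>\<beta>. sets \<beta> = sets borel \<and> \<sigma> = completion \<beta>) \<and>
     (\<forall>x r e g A. lipschitz_chart \<Omega> x r e g \<longrightarrow> A \<in> sets borel \<longrightarrow> A \<subseteq> ball x r \<longrightarrow>
        emeasure \<sigma> (A \<inter> frontier \<Omega>) =
          (\<integral>\<^sup>+ y. indicator {y. 0 \<le> y \<bullet> e \<and> y \<bullet> e \<le> 1 \<and> y - (y \<bullet> e) *\<^sub>R e + g y *\<^sub>R e \<in> A} y *
                  ennreal (sqrt (1 + (onorm (frechet_derivative g (at y)))\<^sup>2)) \<partial>lborel))"

text \<open>
  The entry in row \<open>i\<close> and column \<open>j\<close> is \<open>\<partial>\<^sub>j v\<^sub>i\<close>. The derivative is taken within the closure, so it
  is the usual one inside the domain and also makes sense on the boundary.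
\<close>

definition grad :: "(real^'d) set \<Rightarrow> (real^'d \<Rightarrow> real^'d) \<Rightarrow> real^'d \<Rightarrow> real^'d^'d" where
  "grad \<Omega> v x = jacobian v (at x within closure \<Omega>)"

definition divg :: "(real^'d) set \<Rightarrow> (real^'d \<Rightarrow> real^'d) \<Rightarrow> real^'d \<Rightarrow> real" where
  "divg \<Omega> v x = trace (grad \<Omega> v x)"

definition sym_grad :: "(real^'d) set \<Rightarrow> (real^'d \<Rightarrow> real^'d) \<Rightarrow> real^'d \<Rightarrow> real^'d^'d" where
  "sym_grad \<Omega> v x = (1/2) *\<^sub>R (grad \<Omega> v x + transpose (grad \<Omega> v x))"

definition tensor_div :: "(real^'d) set \<Rightarrow> (real^'d \<Rightarrow> real^'d^'d) \<Rightarrow> real^'d \<Rightarrow> real^'d" where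
  "tensor_div \<Omega> S x = (\<chi> i. divg \<Omega> (\<lambda>y. S y $ i) x)"

definition time_deriv :: "real set \<Rightarrow> (real \<Rightarrow> 'a \<Rightarrow> 'b::real_normed_vector) \<Rightarrow> real \<Rightarrow> 'a \<Rightarrow> 'b" where
  "time_deriv I v t x = vector_derivative (\<lambda>s. v s x) (at t within I)"

definition fluid_stress ::
    "real \<Rightarrow> (real^'d) set \<Rightarrow> (real^'d \<Rightarrow> real^'d) \<Rightarrow> (real^'d \<Rightarrow> real) \<Rightarrow> real^'d \<Rightarrow> real^'d^'d" where
  "fluid_stress \<mu>f \<Omega> u p x = - (p x *\<^sub>R mat 1) + (2 * \<mu>f) *\<^sub>R sym_grad \<Omega> u x"

definition structure_stress ::
    "real \<Rightarrow> real \<Rightarrow> (real^'d) set \<Rightarrow> (real^'d \<Rightarrow> real^'d) \<Rightarrow> real^'d \<Rightarrow> real^'d^'d" where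
  "structure_stress \<mu>s lam \<Omega> \<eta> x = (2 * \<mu>s) *\<^sub>R sym_grad \<Omega> \<eta> x + (lam * divg \<Omega> \<eta> x) *\<^sub>R mat 1"

definition space_C1 :: "real set \<Rightarrow> (real^'d) set \<Rightarrow> (real \<Rightarrow> real^'d \<Rightarrow> real^'d) \<Rightarrow> bool" where
  "space_C1 I \<Omega> v \<longleftrightarrow>
     continuous_on (I \<times> closure \<Omega>) (\<lambda>(t, x). v t x) \<and>
     (\<forall>t\<in>I. \<forall>x\<in>closure \<Omega>. v t differentiable (at x within closure \<Omega>)) \<and>
     continuous_on (I \<times> closure \<Omega>) (\<lambda>(t, x). grad \<Omega> (v t) x)"

definition time_C1 :: "real set \<Rightarrow> (real^'d) set \<Rightarrow> (real \<Rightarrow> real^'d \<Rightarrow> real^'d) \<Rightarrow> bool" where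
  "time_C1 I \<Omega> v \<longleftrightarrow>
     (\<forall>t\<in>I. \<forall>x\<in>closure \<Omega>. (\<lambda>s. v s x) differentiable (at t within I)) \<and>
     continuous_on (I \<times> closure \<Omega>) (\<lambda>(t, x). time_deriv I v t x)"

text \<open>Continuous differentiability of a tensor field in the open domain only, not up to the boundary.\<close>

definition tensor_C1 :: "(real^'d) set \<Rightarrow> (real^'d \<Rightarrow> real^'d^'d) \<Rightarrow> bool" where
  "tensor_C1 \<Omega> S \<longleftrightarrow>
     (\<forall>i. (\<forall>x\<in>\<Omega>. (\<lambda>y. S y $ i) differentiable (at x)) \<and>
          continuous_on \<Omega> (grad \<Omega> (\<lambda>y. S y $ i)))"

definition fluid_regular where
  "fluid_regular \<mu>f \<Omega>f I (u :: real \<Rightarrow> real^'d \<Rightarrow> real^'d) p \<longleftrightarrow>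
     space_C1 I \<Omega>f u \<and> time_C1 I \<Omega>f u \<and>
     continuous_on (I \<times> closure \<Omega>f) (\<lambda>(t, x). p t x) \<and>
     (\<forall>t\<in>I. tensor_C1 \<Omega>f (fluid_stress \<mu>f \<Omega>f (u t) (p t)))"

definition structure_regular where
  "structure_regular \<mu>s lam \<Omega>s I (\<eta> :: real \<Rightarrow> real^'d \<Rightarrow> real^'d) \<xi> \<longleftrightarrow>
     space_C1 I \<Omega>s \<eta> \<and> time_C1 I \<Omega>s \<eta> \<and>
     space_C1 I \<Omega>s \<xi> \<and> time_C1 I \<Omega>s \<xi> \<and>
     (\<forall>t\<in>I. tensor_C1 \<Omega>s (structure_stress \<mu>s lam \<Omega>s (\<eta> t)))"

text \<open>
  A quantity with a superscript is a function of the superscript \<open>n\<close> and of time. The initial data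
  are the values \<open>v 0 0\<close>; \<open>v 0 t\<close> is not used for other \<open>t\<close>.
\<close>

definition time_shift :: "real \<Rightarrow> (nat \<Rightarrow> real \<Rightarrow> 'b) \<Rightarrow> nat \<Rightarrow> real \<Rightarrow> 'b" where
  "time_shift dt v n t = (if n = 0 then v 0 0 else v n (t - dt))"

definition step_interval :: "real \<Rightarrow> nat \<Rightarrow> real set" where
  "step_interval dt n = {real n * dt .. real (n + 1) * dt}"

definition robin_data where
  "robin_data L dt (u :: nat \<Rightarrow> real \<Rightarrow> real^'d \<Rightarrow> real^'d) \<xi> Sf Ss n t x \<nu> =
     (L/2) *\<^sub>R time_shift dt u n t x + (L/2) *\<^sub>R time_shift dt \<xi> n t x +
     (1/2) *\<^sub>R (time_shift dt Sf n t x *v \<nu>) + (1/2) *\<^sub>R (time_shift dt Ss n t x *v \<nu>)"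

text \<open>
  \<open>Sf\<close> and \<open>Ss\<close> are the sequences of fluid and structure stresses. On the boundary outside the
  interface \<open>\<Gamma>\<close>, the Dirichlet condition holds on \<open>Df\<close> (resp. \<open>Ds\<close>) and the zero-traction
  condition on the rest.
\<close>

definition fluid_subproblem where
  "fluid_subproblem \<rho>f L \<Omega>f \<Gamma> Df \<sigma> dt (u :: nat \<Rightarrow> real \<Rightarrow> real^'d \<Rightarrow> real^'d) \<xi> Sf Ss n \<longleftrightarrow>
     (\<forall>t\<in>step_interval dt n. \<forall>x\<in>\<Omega>f.
        \<rho>f *\<^sub>R time_deriv (step_interval dt n) (u (n+1)) t x - tensor_div \<Omega>f (Sf (n+1) t) x = 0 \<and>
        divg \<Omega>f (u (n+1) t) x = 0) \<and>
     (\<forall>x\<in>\<Omega>f. u (n+1) (real n * dt) x = u n (real n * dt) x) \<and>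
     (\<forall>t\<in>step_interval dt n. AE x in \<sigma>. x \<in> \<Gamma> \<longrightarrow>
        L *\<^sub>R u (n+1) t x + Sf (n+1) t x *v outward_normal \<Omega>f x =
          robin_data L dt u \<xi> Sf Ss n t x (outward_normal \<Omega>f x)) \<and>
     (\<forall>t\<in>step_interval dt n. \<forall>x\<in>Df. u (n+1) t x = 0) \<and>
     (\<forall>t\<in>step_interval dt n. AE x in \<sigma>. x \<in> frontier \<Omega>f - \<Gamma> - Df \<longrightarrow>
        Sf (n+1) t x *v outward_normal \<Omega>f x = 0)"

definition structure_subproblem where
  "structure_subproblem \<rho>s L \<Omega>s \<Gamma> Ds \<sigma> dt (u :: nat \<Rightarrow> real \<Rightarrow> real^'d \<Rightarrow> real^'d) \<eta> \<xi> Sf Ss n \<longleftrightarrow>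
     (\<forall>t\<in>step_interval dt n. \<forall>x\<in>\<Omega>s.
        time_deriv (step_interval dt n) (\<eta> (n+1)) t x = \<xi> (n+1) t x \<and>
        \<rho>s *\<^sub>R time_deriv (step_interval dt n) (\<xi> (n+1)) t x - tensor_div \<Omega>s (Ss (n+1) t) x = 0) \<and>
     (\<forall>x\<in>\<Omega>s. \<xi> (n+1) (real n * dt) x = \<xi> n (real n * dt) x \<and>
              \<eta> (n+1) (real n * dt) x = \<eta> n (real n * dt) x) \<and>
     (\<forall>t\<in>step_interval dt n. AE x in \<sigma>. x \<in> \<Gamma> \<longrightarrow>
        L *\<^sub>R \<xi> (n+1) t x + Ss (n+1) t x *v outward_normal \<Omega>s x =
          robin_data L dt u \<xi> Sf Ss n t x (outward_normal \<Omega>s x)) \<and>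
     (\<forall>t\<in>step_interval dt n. \<forall>x\<in>Ds. \<eta> (n+1) t x = 0 \<and> \<xi> (n+1) t x = 0) \<and>
     (\<forall>t\<in>step_interval dt n. AE x in \<sigma>. x \<in> frontier \<Omega>s - \<Gamma> - Ds \<longrightarrow>
        Ss (n+1) t x *v outward_normal \<Omega>s x = 0)"

text \<open>On matrices, \<open>norm\<close> is the Frobenius norm.\<close>

definition L2_norm_on :: "'a measure \<Rightarrow> 'a set \<Rightarrow> ('a \<Rightarrow> 'b::real_normed_vector) \<Rightarrow> real" where
  "L2_norm_on M A v = sqrt (LINT x:A|M. (norm (v x))\<^sup>2)"

definition in_L2_on ::
    "'a measure \<Rightarrow> 'a set \<Rightarrow> ('a \<Rightarrow> 'b::{banach, second_countable_topology}) \<Rightarrow> bool" where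
  "in_L2_on M A v \<longleftrightarrow> set_borel_measurable M A v \<and> set_integrable M A (\<lambda>x. (norm (v x))\<^sup>2)"

definition elastic_norm :: "real \<Rightarrow> real \<Rightarrow> (real^'d) set \<Rightarrow> (real^'d \<Rightarrow> real^'d) \<Rightarrow> real" where
  "elastic_norm \<mu>s lam \<Omega>s \<eta> =
     sqrt (2 * \<mu>s * (L2_norm_on lebesgue \<Omega>s (sym_grad \<Omega>s \<eta>))\<^sup>2 +
           lam * (L2_norm_on lebesgue \<Omega>s (divg \<Omega>s \<eta>))\<^sup>2)"

definition energy where
  "energy \<rho>f \<rho>s \<mu>s lam \<Omega>f \<Omega>s dt (u :: nat \<Rightarrow> real \<Rightarrow> real^'d \<Rightarrow> real^'d) \<eta> \<xi> n =
     \<rho>s / 2 * (L2_norm_on lebesgue \<Omega>s (\<xi> n (real n * dt)))\<^sup>2 +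
     1 / 2 * (elastic_norm \<mu>s lam \<Omega>s (\<eta> n (real n * dt)))\<^sup>2 +
     \<rho>f / 2 * (L2_norm_on lebesgue \<Omega>f (u n (real n * dt)))\<^sup>2"

definition dissipation where
  "dissipation \<mu>f \<Omega>f dt (u :: nat \<Rightarrow> real \<Rightarrow> real^'d \<Rightarrow> real^'d) n =
     2 * \<mu>f * (LINT t:step_interval dt (n - 1)|lebesgue.
                 (L2_norm_on lebesgue \<Omega>f (sym_grad \<Omega>f (u n t)))\<^sup>2)"

definition interface_energy where
  "interface_energy L \<Omega>f \<Omega>s \<Gamma> \<sigma> dt (u :: nat \<Rightarrow> real \<Rightarrow> real^'d \<Rightarrow> real^'d) \<xi> Sf Ss n =
     (if n = 0 then
        L * dt / 2 * ((L2_norm_on \<sigma> \<Gamma> (u 0 0))\<^sup>2 + (L2_norm_on \<sigma> \<Gamma> (\<xi> 0 0))\<^sup>2) +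
        dt / (2 * L) *
          ((L2_norm_on \<sigma> \<Gamma> (\<lambda>x. Sf 0 0 x *v outward_normal \<Omega>f x))\<^sup>2 +
           (L2_norm_on \<sigma> \<Gamma> (\<lambda>x. Ss 0 0 x *v outward_normal \<Omega>s x))\<^sup>2)
      else
        L / 2 * (LINT t:step_interval dt (n - 1)|lebesgue.
          (L2_norm_on \<sigma> \<Gamma> (u n t))\<^sup>2 + (L2_norm_on \<sigma> \<Gamma> (\<xi> n t))\<^sup>2) +
        1 / (2 * L) * (LINT t:step_interval dt (n - 1)|lebesgue.
          (L2_norm_on \<sigma> \<Gamma> (\<lambda>x. Sf n t x *v outward_normal \<Omega>f x))\<^sup>2 +
          (L2_norm_on \<sigma> \<Gamma> (\<lambda>x. Ss n t x *v outward_normal \<Omega>s x))\<^sup>2))"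

end

theory Submission
  imports Defs
begin

text \<open>
  In each subproblem the energy changes by the work of the interface traction minus the dissipation.
  By polarisation that work and the new interface quantity add up to
  \<open>(\<bar>L u + \<sigma>\<^sub>f n\<^sub>f\<bar>\<^sup>2 + \<bar>L \<xi> + \<sigma>\<^sub>s n\<^sub>s\<bar>\<^sup>2) / (2 L)\<close>; the Robin conditions rewrite this through the
  shifted data, and the parallelogram law bounds it by the old interface quantity. The sum over the
  time steps telescopes.

  The energy balance needs the divergence theorem for fields that are \<open>C\<^sup>1\<close> inside a Lipschitz domain,
  continuous up to the boundary, and of bounded divergence. Below a graph \<open>g\<close> it follows by translating
  the domain: the difference quotient of \<open>\<integral>G\<close> over the subgraph in direction \<open>\<tau>\<close> is an integral over a
  layer of thickness \<open>O(\<delta>)\<close> at the graph and converges to the flux wherever \<open>g\<close> is differentiable.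
  Applying this to \<open>g - h\<close> and letting \<open>h\<close> tend to 0 removes the need for derivatives at the boundary,
  and a partition of unity globalises the result.
\<close>

section \<open>Graph coordinates\<close>

text \<open>The obstacle is the boundary regularity of the stresses. They contain
  \<open>grad\<close> of a velocity or displacement and the pressure, which are merely continuous up
  to the boundary, so their first derivatives may be unbounded there. What stays bounded is the
  divergence, because the momentum equation equates it with a density times an acceleration that is
  continuous on the closure. Hence limits at the boundary can be taken only after the partial
  derivatives have been summed to a divergence.

  The second constraint is that the surface measure is known only through charts, and the normal
  only almost everywhere. Integrals over the hyperplane of a chart therefore become integrals over a
  cylinder in the whole space, the flux is computed with \<open>e - gradient g\<close>, whose length
  is the surface density, and everything that mentions \<open>outward_normal\<close> is measurable
  only for the completed measure, through almost everywhere equality with a Borel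
  expression.\<close>

definition cylinder :: "'a::euclidean_space \<Rightarrow> 'a set" where
  "cylinder e = {y. 0 \<le> y \<bullet> e \<and> y \<bullet> e \<le> 1}"

definition graph_point :: "'a::euclidean_space \<Rightarrow> ('a \<Rightarrow> real) \<Rightarrow> 'a \<Rightarrow> 'a" where
  "graph_point e g y = y - (y \<bullet> e) *\<^sub>R e + g y *\<^sub>R e"

lemma cylinder_borel [measurable]: "cylinder e \<in> sets borel"
  unfolding cylinder_def by measurable

text \<open>Integrates along the lines in direction \<open>e\<close> without choosing a basis that
  contains \<open>e\<close>: for fixed \<open>y\<close>, the \<open>s\<close> with
  \<open>y - s *\<^sub>R e\<close> in the cylinder form an interval of length one, so after a
  translation and an exchange of integrals every point is counted exactly once.\<close>

lemma nn_integral_lborel_cylinder: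
  fixes f :: "'a::euclidean_space \<Rightarrow> ennreal"
  assumes e: "norm e = 1" and f [measurable]: "f \<in> borel_measurable borel"
  shows "(\<integral>\<^sup>+y. f y \<partial>lborel) =
    (\<integral>\<^sup>+y. indicator (cylinder e) y * (\<integral>\<^sup>+s. f (y + s *\<^sub>R e) \<partial>lborel) \<partial>lborel)"
proof -
  have ee: "e \<bullet> e = 1" using e by (simp add: norm_eq_1)
  have "(\<integral>\<^sup>+y. indicator (cylinder e) y * (\<integral>\<^sup>+s. f (y + s *\<^sub>R e) \<partial>lborel) \<partial>lborel)
      = (\<integral>\<^sup>+y. (\<integral>\<^sup>+s. indicator (cylinder e) y * f (y + s *\<^sub>R e) \<partial>lborel) \<partial>lborel)"
    by (simp add: nn_integral_cmult)
  also have "\<dots> = (\<integral>\<^sup>+s. (\<integral>\<^sup>+y. indicator (cylinder e) y * f (y + s *\<^sub>R e) \<partial>lborel) \<partial>lborel)"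
    by (intro lborel_pair.Fubini') measurable
  also have "\<dots> = (\<integral>\<^sup>+s. (\<integral>\<^sup>+y. indicator (cylinder e) (y - s *\<^sub>R e) * f y \<partial>lborel) \<partial>lborel)"
  proof (rule nn_integral_cong)
    fix s :: real
    have "(\<integral>\<^sup>+y. indicator (cylinder e) (y - s *\<^sub>R e) * f y \<partial>lborel) =
      (\<integral>\<^sup>+y. indicator (cylinder e) (y - s *\<^sub>R e) * f y \<partial>(distr lborel borel ((+) (s *\<^sub>R e))))"
      by (simp add: lborel_distr_plus)
    also have "\<dots> = (\<integral>\<^sup>+y. indicator (cylinder e) (s *\<^sub>R e + y - s *\<^sub>R e) * f (s *\<^sub>R e + y) \<partial>lborel)"
      by (subst nn_integral_distr) (auto simp: )
    finally show "(\<integral>\<^sup>+y. indicator (cylinder e) y * f (y + s *\<^sub>R e) \<partial>lborel) =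
      (\<integral>\<^sup>+y. indicator (cylinder e) (y - s *\<^sub>R e) * f y \<partial>lborel)"
      by (simp add: add.commute)
  qed
  also have "\<dots> = (\<integral>\<^sup>+y. (\<integral>\<^sup>+s. indicator (cylinder e) (y - s *\<^sub>R e) * f y \<partial>lborel) \<partial>lborel)"
    by (intro lborel_pair.Fubini') measurable
  also have "\<dots> = (\<integral>\<^sup>+y. f y \<partial>lborel)"
  proof (rule nn_integral_cong)
    fix y :: 'a
    have "(\<integral>\<^sup>+s. indicator (cylinder e) (y - s *\<^sub>R e) * f y \<partial>lborel) =
      (\<integral>\<^sup>+s. indicator {y \<bullet> e - 1 .. y \<bullet> e} s * f y \<partial>lborel)"
      by (intro nn_integral_cong) (auto simp: cylinder_def inner_diff_left ee split: split_indicator)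
    also have "\<dots> = f y"
      by (simp add: nn_integral_multc)
    finally show "(\<integral>\<^sup>+s. indicator (cylinder e) (y - s *\<^sub>R e) * f y \<partial>lborel) = f y" .
  qed
  finally show ?thesis ..
qed

text \<open>Coordinates of a layer at the graph, stretched by \<open>1 / \<delta>\<close> along
  \<open>e\<close>: \<open>r = 0\<close> is the graph, and a layer of thickness proportional to
  \<open>\<delta>\<close> occupies a range of \<open>r\<close> that stays bounded as
  \<open>\<delta>\<close> tends to 0.\<close>

definition slab_map :: "'a::euclidean_space \<Rightarrow> ('a \<Rightarrow> real) \<Rightarrow> real \<Rightarrow> 'a \<times> real \<Rightarrow> 'a" where
  "slab_map e g \<delta> = (\<lambda>(y, r). y - (y \<bullet> e) *\<^sub>R e + (g y + \<delta> * r) *\<^sub>R e)"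

lemma slab_map_measurable [measurable]:
  assumes [measurable]: "g \<in> borel_measurable borel"
  shows "slab_map e g \<delta> \<in> borel_measurable (lborel \<Otimes>\<^sub>M lborel)"
  unfolding slab_map_def by measurable

text \<open>The affine substitution of slope \<open>\<delta>\<close> on each line in direction
  \<open>e\<close> turns \<open>nn_integral_lborel_cylinder\<close> into slab coordinates. As an
  equality of measures it transfers integrals of signed functions at once.\<close>

lemma lborel_eq_slab_distr:
  fixes e :: "'a::euclidean_space"
  assumes e: "norm e = 1" and g [measurable]: "g \<in> borel_measurable borel" and \<delta>: "\<delta> > 0"
  shows "lborel = distr (density (lborel \<Otimes>\<^sub>M lborel) (\<lambda>(y, r). ennreal \<delta> * indicator (cylinder e) y))
    borel (slab_map e g \<delta>)"
proof (rule measure_eqI)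
  fix A :: "'a set" assume "A \<in> sets lborel"
  hence A [measurable]: "A \<in> sets borel" by simp
  have inner: "(\<integral>\<^sup>+s. indicator A (y + s *\<^sub>R e) \<partial>lborel) =
      ennreal \<delta> * (\<integral>\<^sup>+r. indicator A (slab_map e g \<delta> (y, r)) \<partial>lborel)" for y
    using \<delta> by (subst nn_integral_real_affine[where c = \<delta> and t = "g y - y \<bullet> e"])
      (auto simp: slab_map_def algebra_simps)
  have "emeasure lborel A = (\<integral>\<^sup>+y. indicator A y \<partial>lborel)" by simp
  also have "\<dots> = (\<integral>\<^sup>+y. indicator (cylinder e) y * (\<integral>\<^sup>+s. indicator A (y + s *\<^sub>R e) \<partial>lborel) \<partial>lborel)"
    by (rule nn_integral_lborel_cylinder[OF e]) measurable
  also have "\<dots> = (\<integral>\<^sup>+y. (\<integral>\<^sup>+r. ennreal \<delta> * indicator (cylinder e) y * indicator A (slab_map e g \<delta> (y, r)) \<partial>lborel) \<partial>lborel)"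
    by (intro nn_integral_cong) (simp add: inner nn_integral_cmult mult_ac)
  also have "\<dots> = (\<integral>\<^sup>+w. (case w of (y, r) \<Rightarrow> ennreal \<delta> * indicator (cylinder e) y) * indicator A (slab_map e g \<delta> w) \<partial>(lborel \<Otimes>\<^sub>M lborel))"
    by (subst lborel.nn_integral_fst[symmetric]) auto
  also have "\<dots> = emeasure (distr (density (lborel \<Otimes>\<^sub>M lborel) (\<lambda>(y, r). ennreal \<delta> * indicator (cylinder e) y))
    borel (slab_map e g \<delta>)) A"
  proof -
    have "emeasure (distr (density (lborel \<Otimes>\<^sub>M lborel) (\<lambda>(y, r). ennreal \<delta> * indicator (cylinder e) y))
        borel (slab_map e g \<delta>)) A =
      (\<integral>\<^sup>+w. (case w of (y, r) \<Rightarrow> ennreal \<delta> * indicator (cylinder e) y) *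
        indicator (slab_map e g \<delta> -` A \<inter> space (lborel \<Otimes>\<^sub>M lborel)) w \<partial>(lborel \<Otimes>\<^sub>M lborel))"
      using measurable_sets[OF slab_map_measurable[OF g] A]
      by (subst emeasure_distr, simp, simp, subst emeasure_density) auto
    also have "\<dots> = (\<integral>\<^sup>+w. (case w of (y, r) \<Rightarrow> ennreal \<delta> * indicator (cylinder e) y) * indicator A (slab_map e g \<delta> w) \<partial>(lborel \<Otimes>\<^sub>M lborel))"
      by (intro nn_integral_cong) (auto simp: space_pair_measure split: split_indicator)
    finally show ?thesis by simp
  qed
  finally show "emeasure lborel A = \<dots>" .
qed simp

lemma integral_lborel_slab:
  fixes e :: "'a::euclidean_space" and f :: "'a \<Rightarrow> real"
  assumes e: "norm e = 1" and g [measurable]: "g \<in> borel_measurable borel" and \<delta>: "\<delta> > 0"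
    and f [measurable]: "f \<in> borel_measurable borel"
  shows "(\<integral>y. f y \<partial>lborel) =
    \<delta> * (\<integral>w. indicator (cylinder e) (fst w) * f (slab_map e g \<delta> w) \<partial>(lborel \<Otimes>\<^sub>M lborel))"
proof -
  have *: "(\<lambda>(y, r). ennreal \<delta> * indicator (cylinder e) y) = (\<lambda>w. ennreal (\<delta> * indicator (cylinder e) (fst w)))"
    using \<delta> by (auto split: split_indicator)
  have "(\<integral>y. f y \<partial>lborel) = (\<integral>w. (\<delta> * indicator (cylinder e) (fst w)) * f (slab_map e g \<delta> w) \<partial>(lborel \<Otimes>\<^sub>M lborel))"
    apply (subst lborel_eq_slab_distr[OF e g \<delta>])
    apply (subst integral_distr, simp, simp)
    unfolding * using \<delta>
    by (subst integral_density) auto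
  thus ?thesis by (simp add: mult.assoc)
qed

text \<open>A limit along one fixed sequence of steps is Borel measurable for every continuous
  \<open>g\<close>, whatever happens at points without a derivative; wherever \<open>g\<close> is
  differentiable it is the usual gradient.\<close>

definition gradient :: "('a::euclidean_space \<Rightarrow> real) \<Rightarrow> 'a \<Rightarrow> 'a" where
  "gradient g y = (\<Sum>b\<in>Basis. lim (\<lambda>n. (g (y + inverse (real (Suc n)) *\<^sub>R b) - g y) / inverse (real (Suc n))) *\<^sub>R b)"

lemma gradient_measurable:
  assumes "continuous_on UNIV g"
  shows "gradient g \<in> borel_measurable borel"
proof -
  have [measurable]: "g \<in> borel_measurable borel"
    using assms by (rule borel_measurable_continuous_onI)
  show ?thesis unfolding gradient_def
    by (intro borel_measurable_sum borel_measurable_scaleR borel_measurable_lim_metric) auto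
qed

lemma has_derivative_directional:
  fixes g :: "'a::real_normed_vector \<Rightarrow> real"
  assumes "(g has_derivative D) (at y)" and \<epsilon>: "\<epsilon> \<longlonglongrightarrow> 0" "\<And>n. \<epsilon> n \<noteq> 0"
  shows "(\<lambda>n. (g (y + \<epsilon> n *\<^sub>R v) - g y) / \<epsilon> n) \<longlonglongrightarrow> D v"
proof -
  have lin: "linear D" using assms(1) has_derivative_linear by blast
  have "((\<lambda>t. g (y + t *\<^sub>R v)) has_derivative (\<lambda>t. D (t *\<^sub>R v))) (at 0)"
    by (rule has_derivative_compose[where g = g and f = "\<lambda>t. y + t *\<^sub>R v"])
      (auto intro!: derivative_eq_intros assms(1) )
  moreover have "(\<lambda>t. D (t *\<^sub>R v)) = (*) (D v)"
    using lin by (auto simp: linear_cmul)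
  ultimately have "((\<lambda>t. g (y + t *\<^sub>R v)) has_field_derivative D v) (at 0)"
    unfolding has_field_derivative_def by simp
  hence "((\<lambda>t. (g (y + t *\<^sub>R v) - g y) / t) \<longlongrightarrow> D v) (at 0)"
    by (simp add: has_field_derivative_iff)
  moreover have "filterlim \<epsilon> (at 0) sequentially"
    using \<epsilon> by (simp add: filterlim_at)
  ultimately show ?thesis by (rule filterlim_compose)
qed

lemma gradient_inner:
  fixes g :: "'a::euclidean_space \<Rightarrow> real"
  assumes D: "(g has_derivative D) (at y)"
  shows "gradient g y \<bullet> v = D v"
proof -
  have lin: "linear D" using D has_derivative_linear by blast
  have "lim (\<lambda>n. (g (y + inverse (real (Suc n)) *\<^sub>R b) - g y) / inverse (real (Suc n))) = D b" for b
    by (intro limI has_derivative_directional[OF D] LIMSEQ_inverse_real_of_nat) auto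
  hence "gradient g y \<bullet> v = (\<Sum>b\<in>Basis. D b * (b \<bullet> v))"
    by (simp add: gradient_def inner_sum_left)
  also have "\<dots> = D (\<Sum>b\<in>Basis. (v \<bullet> b) *\<^sub>R b)"
    by (simp add: linear_sum[OF lin] linear_cmul[OF lin] inner_commute mult.commute)
  also have "\<dots> = D v" by (simp add: euclidean_representation)
  finally show ?thesis .
qed

lemma gradient_has_derivative:
  fixes g :: "'a::euclidean_space \<Rightarrow> real"
  assumes "g differentiable (at y)"
  shows "(g has_derivative (\<lambda>v. gradient g y \<bullet> v)) (at y)"
  using assms gradient_inner unfolding differentiable_def by (metis (no_types, lifting) ext)

text \<open>Connects the operator norm in \<open>surface_measure\<close> with
  \<open>gradient\<close>. The lower bound tests the functional on the gradient itself.\<close>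

lemma onorm_frechet_derivative:
  fixes g :: "'a::euclidean_space \<Rightarrow> real"
  assumes "g differentiable (at y)"
  shows "onorm (frechet_derivative g (at y)) = norm (gradient g y)"
proof -
  have "frechet_derivative g (at y) = (\<lambda>v. gradient g y \<bullet> v)"
    using gradient_has_derivative[OF assms] frechet_derivative_at by metis
  moreover have "onorm (\<lambda>v. gradient g y \<bullet> v) = norm (gradient g y)"
  proof (rule antisym)
    show "onorm (\<lambda>v. gradient g y \<bullet> v) \<le> norm (gradient g y)"
      by (rule onorm_le) (simp add: Cauchy_Schwarz_ineq2)
    have "norm (gradient g y) * norm (gradient g y) \<le> onorm (\<lambda>v. gradient g y \<bullet> v) * norm (gradient g y)"
      using onorm[of "\<lambda>v. gradient g y \<bullet> v" "gradient g y"]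
      by (simp add: bounded_linear_inner_right power2_norm_eq_inner[symmetric] power2_eq_square)
    thus "norm (gradient g y) \<le> onorm (\<lambda>v. gradient g y \<bullet> v)"
      by (cases "gradient g y = 0") (auto simp: onorm_pos_le bounded_linear_inner_right)
  qed
  ultimately show ?thesis by simp
qed

section \<open>Translation invariance and bounded supports\<close>

lemma integral_translate_lborel:
  fixes f :: "'a::euclidean_space \<Rightarrow> real"
  assumes "f \<in> borel_measurable borel"
  shows "(\<integral>y. f (y + c) \<partial>lborel) = (\<integral>y. f y \<partial>lborel)"
proof -
  have "(\<integral>y. f y \<partial>lborel) = (\<integral>y. f y \<partial>(distr lborel borel ((+) c)))"
    by (simp add: lborel_distr_plus)
  also have "\<dots> = (\<integral>y. f (c + y) \<partial>lborel)"
    using assms by (subst integral_distr) auto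
  finally show ?thesis by (simp add: add.commute)
qed

lemma integrable_translate_lborel:
  fixes f :: "'a::euclidean_space \<Rightarrow> real"
  assumes "integrable lborel f"
  shows "integrable lborel (\<lambda>y. f (y + c))"
proof -
  have [measurable]: "f \<in> borel_measurable borel" using assms by (auto dest: borel_measurable_integrable)
  have "integrable (distr lborel borel ((+) c)) f"
    using assms by (simp add: lborel_distr_plus)
  hence "integrable lborel (\<lambda>y. f (c + y))"
    by (subst (asm) integrable_distr_eq) auto
  thus ?thesis by (simp add: add.commute)
qed

lemma integrable_bounded_support:
  fixes f :: "'a::euclidean_space \<Rightarrow> real"
  assumes "f \<in> borel_measurable borel" "\<And>y. \<bar>f y\<bar> \<le> B" "\<And>y. norm y > R \<Longrightarrow> f y = 0"
  shows "integrable lborel f"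
proof -
  have "integrable lborel (\<lambda>y. B * indicator (cball (0::'a) R) y)"
    using emeasure_bounded_finite[of "cball 0 R :: 'a set"]
    by (intro integrable_mult_right integrable_real_indicator) auto
  thus ?thesis
    by (rule Bochner_Integration.integrable_bound) (use assms in \<open>auto split: split_indicator simp: not_le intro!: AE_I2 abs_ge_self[THEN order_trans[rotated]]\<close>)
qed

text \<open>The difference of indicators is the signed indicator of the interval between 0 and
  \<open>q\<close>; the layer between a graph and its translate can have either sign.\<close>

lemma integral_signed_interval:
  fixes q :: real
  shows "(\<integral>r. (indicator {..<q} r - indicator {..<0} r :: real) \<partial>lborel) = q"
proof (cases "q \<ge> 0")
  case True
  have "(\<integral>r. (indicator {..<q} r - indicator {..<0} r :: real) \<partial>lborel) = (\<integral>r. indicator {0..<q} r \<partial>lborel)"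
    by (intro Bochner_Integration.integral_cong) (use True in \<open>auto split: split_indicator\<close>)
  thus ?thesis using True by simp
next
  case False
  have "(\<integral>r. (indicator {..<q} r - indicator {..<0} r :: real) \<partial>lborel) = (\<integral>r. - indicator {q..<0} r \<partial>lborel)"
    by (intro Bochner_Integration.integral_cong) (use False in \<open>auto split: split_indicator\<close>)
  thus ?thesis using False by simp
qed

text \<open>By Pythagoras the part of a vector orthogonal to \<open>e\<close> is no longer than the
  vector, and inside the cylinder the part along \<open>e\<close> is at most 1. This confines to a
  ball the cylinder points whose graph point lies in a given ball.\<close>

lemma cylinder_norm_le:
  fixes e :: "'a::euclidean_space"
  assumes e: "norm e = 1" and y: "y \<in> cylinder e"
  shows "norm y \<le> norm (y - (y \<bullet> e) *\<^sub>R e + s *\<^sub>R e) + 1"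
proof -
  have ee: "e \<bullet> e = 1" using e by (simp add: norm_eq_1)
  have "(norm (y - (y \<bullet> e) *\<^sub>R e + s *\<^sub>R e))\<^sup>2 = (norm (y - (y \<bullet> e) *\<^sub>R e))\<^sup>2 + s\<^sup>2"
    unfolding power2_norm_eq_inner
    by (simp add: inner_add_left inner_add_right inner_diff_left inner_diff_right ee inner_commute algebra_simps)
      (simp add: power2_eq_square)
  hence "(norm (y - (y \<bullet> e) *\<^sub>R e))\<^sup>2 \<le> (norm (y - (y \<bullet> e) *\<^sub>R e + s *\<^sub>R e))\<^sup>2" by simp
  hence "norm (y - (y \<bullet> e) *\<^sub>R e) \<le> norm (y - (y \<bullet> e) *\<^sub>R e + s *\<^sub>R e)"
    by (simp add: power2_le_iff_abs_le)
  moreover have "norm y \<le> norm (y - (y \<bullet> e) *\<^sub>R e) + norm ((y \<bullet> e) *\<^sub>R e)"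
    by (metis add.commute diff_add_cancel norm_triangle_ineq)
  moreover have "norm ((y \<bullet> e) *\<^sub>R e) \<le> 1" using y e by (simp add: cylinder_def)
  ultimately show ?thesis by linarith
qed

text \<open>The scalar case for one direction \<open>\<tau>\<close>. The hypothesis
  \<open>quot\<close> compares \<open>G\<close> at a point below the graph with a point that may lie
  above it, so \<open>G\<close> has to be controlled slightly beyond the graph; this is why the
  lemma is applied to lowered graphs.\<close>

lemma
  fixes e \<tau> :: "'a::euclidean_space" and g G D :: "'a \<Rightarrow> real"
  assumes e: "norm e = 1"
    and inv: "\<And>y s. g (y + s *\<^sub>R e) = g y"
    and lip: "C-lipschitz_on UNIV g"
    and diff: "AE y in lborel. g differentiable (at y)"
    and G [measurable]: "G \<in> borel_measurable borel"
    and bound: "\<And>y. \<bar>G y\<bar> \<le> B"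
    and supp: "\<And>y. norm y > R \<Longrightarrow> G y = 0"
    and \<delta>0: "\<delta>0 > 0"
    and quot: "\<And>y \<delta>. y \<bullet> e < g y \<Longrightarrow> 0 < \<delta> \<Longrightarrow> \<delta> \<le> \<delta>0 \<Longrightarrow> \<bar>G (y + \<delta> *\<^sub>R \<tau>) - G y\<bar> \<le> K * \<delta>"
    and deriv: "\<And>y. y \<bullet> e < g y \<Longrightarrow> ((\<lambda>\<delta>. G (y + \<delta> *\<^sub>R \<tau>)) has_field_derivative D y) (at 0)"
    and cont: "\<And>y. isCont G (graph_point e g y)"
  shows subgraph_derivative_integrable: "integrable lborel (\<lambda>y. indicator {y. y \<bullet> e < g y} y * D y)"
    and graph_trace_integrable: "integrable lborel (\<lambda>y. indicator (cylinder e) y *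
          ((\<tau> \<bullet> e - gradient g y \<bullet> \<tau>) * G (graph_point e g y)))"
    and integral_subgraph_derivative: "(\<integral>y. indicator {y. y \<bullet> e < g y} y * D y \<partial>lborel) =
      (\<integral>y. indicator (cylinder e) y * ((\<tau> \<bullet> e - gradient g y \<bullet> \<tau>) * G (graph_point e g y)) \<partial>lborel)"
proof -
  define U where "U = {y. y \<bullet> e < g y}"
  define q where "q y = \<tau> \<bullet> e - gradient g y \<bullet> \<tau>" for y
  \<comment> \<open>Scaled by \<open>\<delta>0\<close> so that every member of the sequence
    satisfies the constraint in \<open>quot\<close>.\<close>
  define \<delta> where "\<delta> n = \<delta>0 * inverse (real (Suc n))" for n
  have \<delta>_pos: "\<delta> n > 0" for n using \<delta>0 by (simp add: \<delta>_def)
  have \<delta>_le: "\<delta> n \<le> \<delta>0" for n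
    using \<delta>0 by (simp add: \<delta>_def field_simps)
  have \<delta>_lim: "\<delta> \<longlonglongrightarrow> 0"
    unfolding \<delta>_def using tendsto_mult_right_zero[OF LIMSEQ_inverse_real_of_nat] by simp
  have contg: "continuous_on UNIV g" using lip by (rule lipschitz_on_continuous_on)
  have ee: "e \<bullet> e = 1" using e by (simp add: norm_eq_1)
  have [measurable]: "g \<in> borel_measurable borel"
    using contg by (rule borel_measurable_continuous_onI)
  have [measurable]: "gradient g \<in> borel_measurable borel" by (rule gradient_measurable[OF contg])
  have [measurable]: "U \<in> sets borel" unfolding U_def by measurable
  have [measurable]: "q \<in> borel_measurable borel" unfolding q_def by measurable
  have [measurable]: "graph_point e g \<in> borel_measurable borel" unfolding graph_point_def by measurable
  have Gint: "integrable lborel G" by (rule integrable_bounded_support[OF G bound supp])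

  define Q where "Q n y = indicator U y * ((G (y + \<delta> n *\<^sub>R \<tau>) - G y) / \<delta> n)" for n y
  have Q_meas [measurable]: "Q n \<in> borel_measurable borel" for n
    unfolding Q_def by measurable
  have Q_lim: "(\<lambda>n. Q n y) \<longlonglongrightarrow> indicator U y * D y" for y
  proof (cases "y \<in> U")
    case True
    hence "((\<lambda>\<delta>. (G (y + \<delta> *\<^sub>R \<tau>) - G y) / \<delta>) \<longlongrightarrow> D y) (at 0)"
      using deriv[of y] by (simp add: U_def has_field_derivative_iff)
    moreover have "filterlim \<delta> (at 0) sequentially"
      using \<delta>_pos \<delta>_lim by (simp add: filterlim_at less_imp_neq[symmetric])
    ultimately have "(\<lambda>n. (G (y + \<delta> n *\<^sub>R \<tau>) - G y) / \<delta> n) \<longlonglongrightarrow> D y"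
      by (rule filterlim_compose)
    thus ?thesis using True by (simp add: Q_def)
  qed (simp add: Q_def)
  have D_meas: "(\<lambda>y. indicator U y * D y) \<in> borel_measurable lborel"
    by (rule borel_measurable_LIMSEQ_real[OF Q_lim]) simp
  \<comment> \<open>A translated argument can reach the support of \<open>G\<close> from at most
    \<open>\<delta>0 * norm \<tau>\<close> away.\<close>
  define R' where "R' = R + \<delta>0 * norm \<tau>"
  have Q_bound: "norm (Q n y) \<le> \<bar>K\<bar> * indicator (cball 0 R') y" for n y
  proof (cases "norm y \<le> R'")
    case True
    have "\<bar>Q n y\<bar> \<le> \<bar>K\<bar>"
    proof (cases "y \<in> U")
      case True
      have "\<bar>G (y + \<delta> n *\<^sub>R \<tau>) - G y\<bar> \<le> K * \<delta> n"
        using True \<delta>_pos \<delta>_le by (intro quot) (auto simp: U_def)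
      also have "\<dots> \<le> \<bar>K\<bar> * \<delta> n" using \<delta>_pos[of n] by (intro mult_right_mono) auto
      finally have "\<bar>(G (y + \<delta> n *\<^sub>R \<tau>) - G y) / \<delta> n\<bar> \<le> \<bar>K\<bar>"
        using \<delta>_pos[of n] by (simp add: divide_simps)
      thus ?thesis using True by (simp add: Q_def)
    qed (simp add: Q_def)
    thus ?thesis using True by simp
  next
    case False
    have "norm y \<le> norm (y + \<delta> n *\<^sub>R \<tau>) + norm (\<delta> n *\<^sub>R \<tau>)"
      by (metis add_diff_cancel_right' norm_triangle_ineq4)
    moreover have "norm (\<delta> n *\<^sub>R \<tau>) \<le> \<delta>0 * norm \<tau>"
      using \<delta>_le[of n] \<delta>_pos[of n] by (simp add: mult_right_mono)
    moreover have "0 \<le> \<delta>0 * norm \<tau>" using \<delta>0 by simp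
    ultimately have "G (y + \<delta> n *\<^sub>R \<tau>) = 0" "G y = 0"
      using False by (auto simp: R'_def intro!: supp)
    thus ?thesis by (simp add: Q_def)
  qed
  have dom1: "integrable lborel (\<lambda>y. \<bar>K\<bar> * indicator (cball (0::'a) R') y)"
    using emeasure_bounded_finite[of "cball 0 R' :: 'a set"]
    by (intro integrable_mult_right integrable_real_indicator) auto
  show "integrable lborel (\<lambda>y. indicator {y. y \<bullet> e < g y} y * D y)"
    unfolding U_def[symmetric]
    by (rule integrable_dominated_convergence[where s = Q, OF D_meas _ dom1]) (use Q_lim Q_bound in auto)
  have lim1: "(\<lambda>n. \<integral>y. Q n y \<partial>lborel) \<longlonglongrightarrow> (\<integral>y. indicator U y * D y \<partial>lborel)"
    by (rule integral_dominated_convergence[where s = Q, OF D_meas _ dom1]) (use Q_lim Q_bound in auto)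

  \<comment> \<open>In the slab coordinates of step \<open>\<delta> n\<close>, the translate of
    \<open>U\<close> by \<open>\<delta> n *\<^sub>R \<tau>\<close> consists of the points with
    \<open>r < qn n y\<close>, and \<open>U\<close> of those with \<open>r < 0\<close>. Hence
    \<open>H n\<close> lives between these two heights, and its limit \<open>H0\<close> between 0
    and \<open>q y\<close>.\<close>
  define qn where "qn n y = (g (y - \<delta> n *\<^sub>R \<tau>) - g y) / \<delta> n + \<tau> \<bullet> e" for n y
  have [measurable]: "qn n \<in> borel_measurable borel" for n unfolding qn_def by measurable
  define H where "H n w = indicator (cylinder e) (fst w) *
    ((indicator {..<qn n (fst w)} (snd w) - indicator {..<0} (snd w)) * G (slab_map e g (\<delta> n) w))" for n w
  define H0 where "H0 w = indicator (cylinder e) (fst w) *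
    ((indicator {..<q (fst w)} (snd w) - indicator {..<0} (snd w)) * G (graph_point e g (fst w)))" for w
  have ind: "indicator {..<a} (r::real) = (if r < a then 1 else 0 :: real)" for a r
    by auto
  have H_meas [measurable]: "H n \<in> borel_measurable (lborel \<Otimes>\<^sub>M lborel)" for n
    unfolding H_def ind by measurable
  have H0_meas [measurable]: "H0 \<in> borel_measurable (lborel \<Otimes>\<^sub>M lborel)"
    unfolding H0_def ind by measurable
  have QH: "(\<integral>y. Q n y \<partial>lborel) = (\<integral>w. H n w \<partial>(lborel \<Otimes>\<^sub>M lborel))" for n
  proof -
    have i1: "integrable lborel (\<lambda>y. indicator U y * G y)"
      using integrable_mult_indicator[of U lborel G] Gint by simp
    have i2: "integrable lborel (\<lambda>y. indicator U y * G (y + \<delta> n *\<^sub>R \<tau>))"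
      using integrable_mult_indicator[of U lborel "\<lambda>y. G (y + \<delta> n *\<^sub>R \<tau>)"] integrable_translate_lborel[OF Gint] by simp
    have i3: "integrable lborel (\<lambda>y. indicator U (y - \<delta> n *\<^sub>R \<tau>) * G y)"
      using integrable_translate_lborel[OF i2, of "- \<delta> n *\<^sub>R \<tau>"] by simp
    have "(\<integral>y. Q n y \<partial>lborel) = (\<integral>y. (indicator U y * G (y + \<delta> n *\<^sub>R \<tau>) - indicator U y * G y) / \<delta> n \<partial>lborel)"
      by (simp add: Q_def right_diff_distrib)
    also have "\<dots> = ((\<integral>y. indicator U y * G (y + \<delta> n *\<^sub>R \<tau>) \<partial>lborel) - (\<integral>y. indicator U y * G y \<partial>lborel)) / \<delta> n"
      by (simp add: Bochner_Integration.integral_diff[OF i2 i1])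
    \<comment> \<open>The shift moves from the function to the domain, so that only the layer
      between \<open>U\<close> and its translate remains.\<close>
    also have "(\<integral>y. indicator U y * G (y + \<delta> n *\<^sub>R \<tau>) \<partial>lborel) = (\<integral>y. indicator U (y - \<delta> n *\<^sub>R \<tau>) * G y \<partial>lborel)"
      using integral_translate_lborel[of "\<lambda>y. indicator U (y - \<delta> n *\<^sub>R \<tau>) * G y" "\<delta> n *\<^sub>R \<tau>"] by simp
    also have "\<dots> - (\<integral>y. indicator U y * G y \<partial>lborel) = (\<integral>y. indicator U (y - \<delta> n *\<^sub>R \<tau>) * G y - indicator U y * G y \<partial>lborel)"
      by (simp add: Bochner_Integration.integral_diff[OF i3 i1])
    also have "\<dots> / \<delta> n = (\<integral>w. indicator (cylinder e) (fst w) *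
        (indicator U (slab_map e g (\<delta> n) w - \<delta> n *\<^sub>R \<tau>) * G (slab_map e g (\<delta> n) w) - indicator U (slab_map e g (\<delta> n) w) * G (slab_map e g (\<delta> n) w)) \<partial>(lborel \<Otimes>\<^sub>M lborel))"
      using \<delta>_pos[of n] by (subst integral_lborel_slab[OF e _ \<delta>_pos[of n]]) auto
    also have "\<dots> = (\<integral>w. H n w \<partial>(lborel \<Otimes>\<^sub>M lborel))"
    proof (rule Bochner_Integration.integral_cong[OF refl])
      fix w :: "'a \<times> real"
      obtain y r where w: "w = (y, r)" by fastforce
      let ?P = "slab_map e g (\<delta> n) w"
      have P: "?P = y + (g y + \<delta> n * r - y \<bullet> e) *\<^sub>R e"
        by (simp add: w slab_map_def algebra_simps)
      have Pe: "?P \<bullet> e = g y + \<delta> n * r" by (simp add: P inner_add_left ee)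
      have "?P \<in> U \<longleftrightarrow> r < 0"
        using \<delta>_pos[of n] by (simp add: U_def Pe) (simp add: P inv mult_less_0_iff)
      hence 1: "indicator U ?P = (indicator {..<0} r :: real)" by (auto split: split_indicator)
      have "g (?P - \<delta> n *\<^sub>R \<tau>) = g (y - \<delta> n *\<^sub>R \<tau>)"
        using inv[of "y - \<delta> n *\<^sub>R \<tau>" "g y + \<delta> n * r - y \<bullet> e"] by (simp add: P algebra_simps)
      hence "?P - \<delta> n *\<^sub>R \<tau> \<in> U \<longleftrightarrow> r < qn n y"
        using \<delta>_pos[of n] by (simp add: U_def Pe inner_diff_left qn_def field_simps)
      hence 2: "indicator U (?P - \<delta> n *\<^sub>R \<tau>) = (indicator {..<qn n y} r :: real)" by (auto split: split_indicator)
      show "indicator (cylinder e) (fst w) * (indicator U (?P - \<delta> n *\<^sub>R \<tau>) * G ?P - indicator U ?P * G ?P) = H n w"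
        unfolding H_def 1 2 by (simp add: w algebra_simps)
    qed
    finally show ?thesis .
  qed
  define Kq where "Kq = C * norm \<tau> + norm \<tau>"
  have qn_bound: "\<bar>qn n y\<bar> \<le> Kq" for n y
  proof -
    have "\<bar>g (y - \<delta> n *\<^sub>R \<tau>) - g y\<bar> \<le> C * norm (\<delta> n *\<^sub>R \<tau>)"
      using lipschitz_onD[OF lip, of "y - \<delta> n *\<^sub>R \<tau>" y] by (simp add: dist_norm)
    hence "\<bar>(g (y - \<delta> n *\<^sub>R \<tau>) - g y) / \<delta> n\<bar> \<le> C * norm \<tau>"
      using \<delta>_pos[of n] by (simp add: field_simps)
    moreover have "\<bar>\<tau> \<bullet> e\<bar> \<le> norm \<tau>" using Cauchy_Schwarz_ineq2[of \<tau> e] e by simp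
    ultimately show ?thesis unfolding qn_def Kq_def by linarith
  qed
  \<comment> \<open>One bounded set carries all \<open>H n\<close>: heights are bounded through the
    Lipschitz constant, horizontal positions through the support of \<open>G\<close> and
    \<open>cylinder_norm_le\<close>.\<close>
  define E where "E = cball (0::'a) (R + 1) \<times> {-Kq..Kq}"
  have H_bound: "norm (H n w) \<le> B * indicator E w" for n w
  proof -
    obtain y r where w: "w = (y, r)" by fastforce
    show ?thesis
    proof (cases "w \<in> E")
      case True
      have "\<bar>H n w\<bar> \<le> 1 * (1 * \<bar>G (slab_map e g (\<delta> n) w)\<bar>)"
        unfolding H_def abs_mult by (intro mult_mono) (auto split: split_indicator)
      thus ?thesis using True bound[of "slab_map e g (\<delta> n) w"] by simp
    next
      case False
      have "H n w = 0"
      proof (cases "y \<in> cylinder e \<and> \<bar>r\<bar> \<le> Kq")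
        case True
        hence "norm y > R + 1" using False by (auto simp: E_def w)
        hence "norm (slab_map e g (\<delta> n) w) > R"
          using cylinder_norm_le[OF e, of y "g y + \<delta> n * r"] True by (simp add: w slab_map_def)
        thus ?thesis by (simp add: H_def supp)
      next
        case False
        thus ?thesis using qn_bound[of n y] by (auto simp: H_def w split: split_indicator)
      qed
      thus ?thesis using False by simp
    qed
  qed
  have dom2: "integrable (lborel \<Otimes>\<^sub>M lborel) (\<lambda>w. B * indicator E w)"
  proof (intro integrable_mult_right integrable_real_indicator)
    show "E \<in> sets (lborel \<Otimes>\<^sub>M lborel)" unfolding E_def by (intro pair_measureI) auto
    have "emeasure (lborel \<Otimes>\<^sub>M lborel) E = emeasure lborel (cball (0::'a) (R + 1)) * emeasure lborel {-Kq..Kq}"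
      unfolding E_def by (rule lborel.emeasure_pair_measure_Times) auto
    also have "\<dots> < \<infinity>"
      using emeasure_bounded_finite[of "cball 0 (R+1) :: 'a set"] emeasure_bounded_finite[of "{-Kq..Kq}"]
      by (simp add: ennreal_mult_less_top top.not_eq_extremum)
    finally show "emeasure (lborel \<Otimes>\<^sub>M lborel) E < \<infinity>" .
  qed
  have H_lim: "AE w in lborel \<Otimes>\<^sub>M lborel. (\<lambda>n. H n w) \<longlonglongrightarrow> H0 w"
  proof -
    \<comment> \<open>At \<open>r = q y\<close> the indicator jumps and need not converge; for each
      \<open>y\<close> this is a single height, hence a null set in the product.\<close>
    have pt: "(\<lambda>n. H n (y, r)) \<longlonglongrightarrow> H0 (y, r)" if y: "g differentiable (at y)" and r: "r \<noteq> q y" for y r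
    proof -
      have "(\<lambda>n. (g (y + (- \<delta> n) *\<^sub>R \<tau>) - g y) / (- \<delta> n)) \<longlonglongrightarrow> gradient g y \<bullet> \<tau>"
        using \<delta>_lim \<delta>_pos by (intro has_derivative_directional gradient_has_derivative y)
          (auto intro!: tendsto_eq_intros simp: less_imp_neq[symmetric])
      hence "(\<lambda>n. \<tau> \<bullet> e - (g (y + (- \<delta> n) *\<^sub>R \<tau>) - g y) / (- \<delta> n)) \<longlonglongrightarrow> \<tau> \<bullet> e - gradient g y \<bullet> \<tau>"
        by (intro tendsto_intros)
      hence qlim: "(\<lambda>n. qn n y) \<longlonglongrightarrow> q y" by (simp add: qn_def q_def add.commute)
      have "(\<lambda>n. indicator {..<qn n y} r - indicator {..<0} r :: real) \<longlonglongrightarrow> indicator {..<q y} r - indicator {..<0} r"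
      proof (rule tendsto_eventually)
        have "eventually (\<lambda>n. (r < qn n y) = (r < q y)) sequentially"
        proof (cases "r < q y")
          case True thus ?thesis using order_tendstoD(1)[OF qlim True] by simp
        next
          case False
          hence "q y < r" using r by simp
          from order_tendstoD(2)[OF qlim this] False show ?thesis by (auto elim: eventually_mono)
        qed
        thus "eventually (\<lambda>n. indicator {..<qn n y} r - indicator {..<0} r = (indicator {..<q y} r - indicator {..<0} r :: real)) sequentially"
          by eventually_elim (auto simp: ind)
      qed
      moreover have "(\<lambda>n. G (slab_map e g (\<delta> n) (y, r))) \<longlonglongrightarrow> G (graph_point e g y)"
      proof (rule isCont_tendsto_compose[OF cont])
        show "(\<lambda>n. slab_map e g (\<delta> n) (y, r)) \<longlonglongrightarrow> graph_point e g y"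
          unfolding slab_map_def graph_point_def using \<delta>_lim by (auto intro!: tendsto_eq_intros)
      qed
      ultimately show ?thesis unfolding H_def H0_def fst_conv snd_conv by (intro tendsto_mult tendsto_const)
    qed
    \<comment> \<open>The argument on the product measure works with measurable sets, so the points
      of non-differentiability are enclosed in a Borel null set.\<close>
    from diff obtain Z where Z: "{y \<in> space lborel. \<not> g differentiable (at y)} \<subseteq> Z" "emeasure lborel Z = 0" "Z \<in> sets lborel"
      by (rule AE_E)
    have [measurable]: "Z \<in> sets borel" using Z(3) by simp
    have "AE w in lborel \<Otimes>\<^sub>M lborel. fst w \<notin> Z \<and> snd w \<noteq> q (fst w)"
    proof (rule lborel_pair.AE_pair_measure)
      show "{w \<in> space (lborel \<Otimes>\<^sub>M lborel). fst w \<notin> Z \<and> snd w \<noteq> q (fst w)} \<in> sets (lborel \<Otimes>\<^sub>M lborel)"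
        by measurable
      have "AE y in lborel. y \<notin> Z" using Z by (intro AE_not_in) auto
      thus "AE y in lborel. AE r in lborel. fst (y, r) \<notin> Z \<and> snd (y, r) \<noteq> q (fst (y, r))"
        by eventually_elim (use AE_lborel_singleton in auto)
    qed
    thus ?thesis by eventually_elim (use Z(1) in \<open>auto simp: prod_eq_iff intro!: pt\<close>)
  qed
  have H0_int: "integrable (lborel \<Otimes>\<^sub>M lborel) H0"
    by (rule integrable_dominated_convergence[where s = H, OF H0_meas _ dom2 H_lim]) (use H_bound in auto)
  have lim2: "(\<lambda>n. \<integral>w. H n w \<partial>(lborel \<Otimes>\<^sub>M lborel)) \<longlonglongrightarrow> (\<integral>w. H0 w \<partial>(lborel \<Otimes>\<^sub>M lborel))"
    by (rule integral_dominated_convergence[where s = H, OF H0_meas _ dom2 H_lim]) (use H_bound in auto)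
  \<comment> \<open>Integrating out the rescaled height leaves the signed thickness
    \<open>q y\<close> of the layer.\<close>
  have inner: "(\<integral>r. H0 (y, r) \<partial>lborel) = indicator (cylinder e) y * (q y * G (graph_point e g y))" for y
    unfolding H0_def by (simp add: integral_signed_interval)
  show "integrable lborel (\<lambda>y. indicator (cylinder e) y * ((\<tau> \<bullet> e - gradient g y \<bullet> \<tau>) * G (graph_point e g y)))"
    using lborel_pair.integrable_fst'[OF H0_int] by (simp add: inner q_def)
  have "(\<integral>y. indicator U y * D y \<partial>lborel) = (\<integral>w. H0 w \<partial>(lborel \<Otimes>\<^sub>M lborel))"
    using lim1 lim2 by (simp add: QH LIMSEQ_unique)
  also have "\<dots> = (\<integral>y. indicator (cylinder e) y * (q y * G (graph_point e g y)) \<partial>lborel)"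
    using lborel_pair.integral_fst'[OF H0_int] by (simp add: inner)
  finally show "(\<integral>y. indicator {y. y \<bullet> e < g y} y * D y \<partial>lborel) =
      (\<integral>y. indicator (cylinder e) y * ((\<tau> \<bullet> e - gradient g y \<bullet> \<tau>) * G (graph_point e g y)) \<partial>lborel)"
    by (simp add: U_def q_def)
qed

section \<open>The divergence theorem below a Lipschitz graph\<close>

text \<open>The difference quotient in the direction of the gradient itself tends to the square of
  its length.\<close>

lemma norm_gradient_le_lipschitz:
  fixes g :: "'a::euclidean_space \<Rightarrow> real"
  assumes lip: "C-lipschitz_on UNIV g" and "g differentiable (at y)"
  shows "norm (gradient g y) \<le> C"
proof -
  let ?v = "gradient g y"
  have "(\<lambda>n. \<bar>(g (y + inverse (real (Suc n)) *\<^sub>R ?v) - g y) / inverse (real (Suc n))\<bar>) \<longlonglongrightarrow> \<bar>?v \<bullet> ?v\<bar>"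
    by (intro tendsto_rabs has_derivative_directional gradient_has_derivative assms LIMSEQ_inverse_real_of_nat) auto
  moreover have "\<bar>(g (y + inverse (real (Suc n)) *\<^sub>R ?v) - g y) / inverse (real (Suc n))\<bar> \<le> C * norm ?v" for n
  proof -
    have *: "\<bar>a / t\<bar> \<le> C * norm ?v" if "\<bar>a\<bar> \<le> C * (t * norm ?v)" "t > 0" for a t :: real
      using that by (simp add: abs_divide divide_le_eq mult_ac)
    show ?thesis
      by (rule *) (use lipschitz_onD[OF lip, of "y + inverse (real (Suc n)) *\<^sub>R ?v" y] in \<open>simp_all add: dist_norm\<close>)
  qed
  ultimately have "\<bar>?v \<bullet> ?v\<bar> \<le> C * norm ?v"
    by (intro LIMSEQ_le_const2) auto
  hence "norm ?v * norm ?v \<le> C * norm ?v"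
    by (simp add: power2_norm_eq_inner[symmetric] power2_eq_square)
  thus ?thesis using lipschitz_on_nonneg[OF lip] by (cases "?v = 0") auto
qed

text \<open>Each partial derivative \<open>F' y b\<close> may blow up at the graph. For a lowered
  graph the directional identities hold one by one; they are summed over the basis before the graph
  is raised again, because only the divergence has a bound that survives the limit.\<close>

lemma
  fixes e :: "'a::euclidean_space" and g :: "'a \<Rightarrow> real" and F :: "'a \<Rightarrow> 'a" and F' :: "'a \<Rightarrow> 'a \<Rightarrow> 'a"
  assumes e: "norm e = 1"
    and inv: "\<And>y s. g (y + s *\<^sub>R e) = g y"
    and lip: "C-lipschitz_on UNIV g"
    and diff: "AE y in lborel. g differentiable (at y)"
    and supp: "\<And>y. norm y > R \<Longrightarrow> F y = 0"
    and cont: "continuous_on {y. y \<bullet> e \<le> g y} F"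
    and deriv: "\<And>y. y \<bullet> e < g y \<Longrightarrow> (F has_derivative F' y) (at y)"
    and cont': "\<And>b. b \<in> Basis \<Longrightarrow> continuous_on {y. y \<bullet> e < g y} (\<lambda>y. F' y b)"
    and div: "\<And>y. y \<bullet> e < g y \<Longrightarrow> \<bar>\<Sum>b\<in>Basis. F' y b \<bullet> b\<bar> \<le> B"
  shows graph_flux_integrable: "integrable lborel (\<lambda>y. indicator (cylinder e) y * (F (graph_point e g y) \<bullet> (e - gradient g y)))"
    and integral_subgraph_divergence: "(\<integral>y. indicator {y. y \<bullet> e < g y} y * (\<Sum>b\<in>Basis. F' y b \<bullet> b) \<partial>lborel) =
      (\<integral>y. indicator (cylinder e) y * (F (graph_point e g y) \<bullet> (e - gradient g y)) \<partial>lborel)"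
proof -
  define U where "U = {y. y \<bullet> e < g y}"
  have ee: "e \<bullet> e = 1" using e by (simp add: norm_eq_1)
  have C0: "0 \<le> C" using lip lipschitz_on_nonneg by blast
  have contg: "continuous_on UNIV g" using lip by (rule lipschitz_on_continuous_on)
  have [measurable]: "g \<in> borel_measurable borel"
    using contg by (rule borel_measurable_continuous_onI)
  have [measurable]: "gradient g \<in> borel_measurable borel" by (rule gradient_measurable[OF contg])
  have Uo: "open U" unfolding U_def
    using contg by (intro open_Collect_less continuous_intros)
  have Um [measurable]: "U \<in> sets borel" using Uo by simp
  have closed_le: "closed {y. y \<bullet> e \<le> g y - c}" for c
    using contg by (intro closed_Collect_le continuous_intros)

  have "compact (cball 0 R \<inter> {y. y \<bullet> e \<le> g y})"
    using closed_le[of 0] by (intro compact_Int_closed) auto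
  hence "bounded (F ` (cball 0 R \<inter> {y. y \<bullet> e \<le> g y}))"
    by (intro compact_imp_bounded compact_continuous_image continuous_on_subset[OF cont]) auto
  then obtain B0 where "B0 > 0" and B0: "\<forall>z\<in>F ` (cball 0 R \<inter> {y. y \<bullet> e \<le> g y}). norm z \<le> B0"
    unfolding bounded_pos by blast
  have Fb: "norm (F y) \<le> B0" if "y \<bullet> e \<le> g y" for y
  proof (cases "norm y > R")
    case False
    thus ?thesis using that by (intro bspec[OF B0] imageI) auto
  qed (use supp \<open>B0 > 0\<close> in auto)

  \<comment> \<open>The extension by zero may jump at the graph of \<open>g\<close>, but the lowered
    graphs and the short segments that start below them stay inside \<open>U\<close>.\<close>
  define G where "G b y = (if y \<in> U then F y \<bullet> b else 0)" for b y
  have contFU: "continuous_on U F" using cont by (rule continuous_on_subset) (auto simp: U_def)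
  have G_meas [measurable]: "G b \<in> borel_measurable borel" for b
    unfolding G_def by (intro borel_measurable_continuous_on_if continuous_intros contFU Um)
  have G_bd: "\<bar>G b y\<bar> \<le> B0" if "b \<in> Basis" for b y
  proof (cases "y \<in> U")
    case True
    have "\<bar>F y \<bullet> b\<bar> \<le> norm (F y)" using that Basis_le_norm by blast
    also have "\<dots> \<le> B0" using True by (intro Fb) (auto simp: U_def)
    finally show ?thesis by (simp add: G_def True)
  qed (use \<open>B0 > 0\<close> in \<open>simp add: G_def\<close>)
  \<comment> \<open>The derivative inherits the support, since the exterior of the ball is
    open.\<close>
  have F'0: "F' y v = 0" if "y \<in> U" "norm y > R" for y v
  proof -
    have "open {y::'a. norm y > R}" by (intro open_Collect_less continuous_intros)
    from has_derivative_transform_within_open[OF has_derivative_const this, of y 0 F]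
    have "(F has_derivative (\<lambda>v. 0)) (at y)" using supp that by simp
    moreover have "(F has_derivative F' y) (at y)" using deriv that by (simp add: U_def)
    ultimately have "F' y = (\<lambda>v. 0)" by (rule has_derivative_unique[symmetric])
    thus ?thesis by simp
  qed
  have G_deriv: "((\<lambda>\<delta>. G b (y + \<delta> *\<^sub>R v)) has_field_derivative F' (y + t *\<^sub>R v) v \<bullet> b) (at t)" if "y + t *\<^sub>R v \<in> U" for b y v t
  proof -
    have FD: "(F has_derivative F' (y + t *\<^sub>R v)) (at (y + t *\<^sub>R v))" using deriv that by (simp add: U_def)
    have lin: "linear (F' (y + t *\<^sub>R v))" using FD has_derivative_linear by blast
    have "((\<lambda>y. F y \<bullet> b) has_derivative (\<lambda>w. F' (y + t *\<^sub>R v) w \<bullet> b)) (at (y + t *\<^sub>R v))"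
      using FD by (auto intro!: derivative_eq_intros)
    hence GD: "(G b has_derivative (\<lambda>w. F' (y + t *\<^sub>R v) w \<bullet> b)) (at (y + t *\<^sub>R v))"
      using Uo that by (rule has_derivative_transform_within_open) (auto simp: G_def)
    have "((\<lambda>\<delta>. G b (y + \<delta> *\<^sub>R v)) has_derivative (\<lambda>\<delta>. F' (y + t *\<^sub>R v) (\<delta> *\<^sub>R v) \<bullet> b)) (at t)"
      by (rule has_derivative_compose[where g = "G b" and f = "\<lambda>t. y + t *\<^sub>R v"])
        (auto intro!: derivative_eq_intros GD)
    moreover have "(\<lambda>\<delta>. F' (y + t *\<^sub>R v) (\<delta> *\<^sub>R v) \<bullet> b) = (*) (F' (y + t *\<^sub>R v) v \<bullet> b)"
      using lin by (auto simp: linear_cmul)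
    ultimately show ?thesis unfolding has_field_derivative_def by simp
  qed

  define h where "h n = inverse (real (Suc n))" for n
  have hp: "h n > 0" for n by (simp add: h_def)
  have h_lim: "h \<longlonglongrightarrow> 0" unfolding h_def by (rule LIMSEQ_inverse_real_of_nat)
  define gh where "gh n y = g y - h n" for n y
  have grad_gh: "gradient (gh n) = gradient g" for n by (rule ext) (simp add: gradient_def gh_def)
  have step:
    "integrable lborel (\<lambda>y. indicator {y. y \<bullet> e < gh n y} y * (F' y b \<bullet> b)) \<and>
     integrable lborel (\<lambda>y. indicator (cylinder e) y * ((b \<bullet> e - gradient g y \<bullet> b) * G b (graph_point e (gh n) y))) \<and>
     (\<integral>y. indicator {y. y \<bullet> e < gh n y} y * (F' y b \<bullet> b) \<partial>lborel) =
     (\<integral>y. indicator (cylinder e) y * ((b \<bullet> e - gradient g y \<bullet> b) * G b (graph_point e (gh n) y)) \<partial>lborel)"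
    if b: "b \<in> Basis" for n b
  proof -
    \<comment> \<open>\<open>K\<close> reaches halfway up from the lowered graph to the graph of
      \<open>g\<close>. It is a compact subset of \<open>U\<close>, so \<open>F' y b\<close> is
      bounded on it.\<close>
    define K where "K = cball 0 R \<inter> {y. y \<bullet> e \<le> g y - h n / 2}"
    have "compact K" unfolding K_def using closed_le by (intro compact_Int_closed) auto
    moreover have "continuous_on K (\<lambda>y. F' y b)"
      using cont'[OF b] by (rule continuous_on_subset) (use hp[of n] in \<open>auto simp: K_def\<close>)
    ultimately have "bounded ((\<lambda>y. F' y b) ` K)"
      by (intro compact_imp_bounded compact_continuous_image)
    then obtain B1 where "B1 > 0" and "\<forall>z\<in>(\<lambda>y. F' y b) ` K. norm z \<le> B1"
      unfolding bounded_pos by blast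
    hence B1: "norm (F' y b) \<le> B1" if "y \<in> K" for y using that by blast
    have B1': "\<bar>F' y b \<bullet> b\<bar> \<le> B1" if "y \<bullet> e \<le> g y - h n / 2" for y
    proof (cases "norm y > R")
      case True
      thus ?thesis using F'0[of y b] that hp[of n] \<open>B1 > 0\<close> by (simp add: U_def)
    next
      case False
      hence "norm (F' y b) \<le> B1" using that by (intro B1) (auto simp: K_def)
      thus ?thesis using Basis_le_norm[OF b, of "F' y b"] by linarith
    qed
    \<comment> \<open>A shift of length \<open>t\<close> along \<open>b\<close> changes
      \<open>y \<bullet> e - g y\<close> by at most \<open>t * (1 + C)\<close>; this choice spends
      exactly half of the gap \<open>h n\<close>.\<close>
    define \<delta>0 where "\<delta>0 = h n / (2 * (1 + C))"
    have \<delta>0: "\<delta>0 > 0" using hp[of n] C0 by (simp add: \<delta>0_def)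
    have stay: "(y + t *\<^sub>R b) \<bullet> e \<le> g (y + t *\<^sub>R b) - h n / 2" if "y \<bullet> e < gh n y" "0 \<le> t" "t \<le> \<delta>0" for y t
    proof -
      have "\<bar>b \<bullet> e\<bar> \<le> 1" using Cauchy_Schwarz_ineq2[of b e] b e by simp
      hence "t * (b \<bullet> e) \<le> t" using that(2) by (simp add: mult_left_le)
      moreover have "\<bar>g (y + t *\<^sub>R b) - g y\<bar> \<le> C * t"
        using lipschitz_onD[OF lip, of "y + t *\<^sub>R b" y] that(2) b by (simp add: dist_norm)
      moreover have "t * (1 + C) \<le> h n / 2"
        using that(3) C0 by (simp add: \<delta>0_def field_simps)
      moreover have "y \<bullet> e < g y - h n" using that by (simp add: gh_def)
      ultimately show ?thesis by (simp add: inner_add_left algebra_simps)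
    qed
    have inv': "gh n (y + s *\<^sub>R e) = gh n y" for y s by (simp add: gh_def inv)
    have lip': "C-lipschitz_on UNIV (gh n)"
      using lip by (auto simp: gh_def lipschitz_on_def dist_norm)
    have diff': "AE y in lborel. gh n differentiable (at y)"
    proof -
      have gh_eq: "gh n = (\<lambda>y. g y - h n)" by (simp add: gh_def fun_eq_iff)
      from diff show ?thesis unfolding gh_eq by eventually_elim simp
    qed
    have supp': "G b y = 0" if "norm y > R" for y using supp[OF that] by (simp add: G_def)
    have quot: "\<bar>G b (y + \<delta> *\<^sub>R b) - G b y\<bar> \<le> B1 * \<delta>" if "y \<bullet> e < gh n y" "0 < \<delta>" "\<delta> \<le> \<delta>0" for y \<delta>
    proof -
      have in_U: "y + t *\<^sub>R b \<in> U" if "0 \<le> t" "t \<le> \<delta>" for t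
        using stay[of y t] \<open>y \<bullet> e < gh n y\<close> \<open>\<delta> \<le> \<delta>0\<close> that hp[of n] by (auto simp: U_def)
      obtain z where z: "0 < z" "z < \<delta>" "G b (y + \<delta> *\<^sub>R b) - G b (y + 0 *\<^sub>R b) = (\<delta> - 0) * (F' (y + z *\<^sub>R b) b \<bullet> b)"
        using MVT2[OF \<open>0 < \<delta>\<close>, of "\<lambda>t. G b (y + t *\<^sub>R b)" "\<lambda>t. F' (y + t *\<^sub>R b) b \<bullet> b"] G_deriv in_U by auto
      have "\<bar>F' (y + z *\<^sub>R b) b \<bullet> b\<bar> \<le> B1" using z that by (intro B1' stay) auto
      thus ?thesis using z that by (simp add: abs_mult mult.commute[of B1] mult_left_mono)
    qed
    have der: "((\<lambda>\<delta>. G b (y + \<delta> *\<^sub>R b)) has_field_derivative F' y b \<bullet> b) (at 0)" if "y \<bullet> e < gh n y" for y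
      using G_deriv[of y 0 b b] that hp[of n] by (simp add: U_def gh_def)
    have ct: "isCont (G b) (graph_point e (gh n) y)" for y
    proof -
      let ?p = "graph_point e (gh n) y"
      have "?p = y + (gh n y - y \<bullet> e) *\<^sub>R e" by (simp add: graph_point_def algebra_simps)
      hence "?p \<bullet> e = g y - h n" "g ?p = g y" by (simp_all add: inner_add_left ee inv gh_def)
      hence p: "?p \<in> U" using hp[of n] by (simp add: U_def)
      have 1: "isCont (\<lambda>y. F y \<bullet> b) ?p"
        using contFU Uo p continuous_on_eq_continuous_at by (intro continuous_intros) blast
      have 2: "eventually (\<lambda>y. F y \<bullet> b = G b y) (nhds ?p)"
        using eventually_nhds_in_open[OF Uo p] by eventually_elim (simp add: G_def)
      show ?thesis using 1 isCont_cong[OF 2] by simp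
    qed
    note A = e inv' lip' diff' G_meas G_bd[OF b] supp' \<delta>0 quot der ct
    show ?thesis
      using subgraph_derivative_integrable[OF A] graph_trace_integrable[OF A] integral_subgraph_derivative[OF A]
      unfolding grad_gh by blast
  qed

  have sum_flux: "(\<Sum>b\<in>Basis. (b \<bullet> e - gradient g y \<bullet> b) * (w \<bullet> b)) = w \<bullet> (e - gradient g y)" for w y
    unfolding euclidean_inner[of w "e - gradient g y"] by (auto simp: inner_diff_left inner_diff_right inner_commute mult.commute intro!: sum.cong)
  define P where "P n y = F (graph_point e (gh n) y)" for n y
  have PG: "G b (graph_point e (gh n) y) = P n y \<bullet> b" for b n y
  proof -
    let ?p = "graph_point e (gh n) y"
    have "?p = y + (gh n y - y \<bullet> e) *\<^sub>R e" by (simp add: graph_point_def algebra_simps)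
    hence "?p \<bullet> e = g y - h n" "g ?p = g y" by (simp_all add: inner_add_left ee inv gh_def)
    hence p: "?p \<in> U" using hp[of n] by (simp add: U_def)
    thus ?thesis by (simp add: G_def P_def)
  qed
  have eq_n: "(\<integral>y. indicator {y. y \<bullet> e < gh n y} y * (\<Sum>b\<in>Basis. F' y b \<bullet> b) \<partial>lborel) =
     (\<integral>y. indicator (cylinder e) y * (P n y \<bullet> (e - gradient g y)) \<partial>lborel)" for n
  proof -
    have "(\<integral>y. indicator {y. y \<bullet> e < gh n y} y * (\<Sum>b\<in>Basis. F' y b \<bullet> b) \<partial>lborel) =
      (\<Sum>b\<in>Basis. (\<integral>y. indicator {y. y \<bullet> e < gh n y} y * (F' y b \<bullet> b) \<partial>lborel))"
      unfolding sum_distrib_left using step by (intro Bochner_Integration.integral_sum) auto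
    also have "\<dots> = (\<Sum>b\<in>Basis. (\<integral>y. indicator (cylinder e) y * ((b \<bullet> e - gradient g y \<bullet> b) * G b (graph_point e (gh n) y)) \<partial>lborel))"
      using step by (intro sum.cong) auto
    also have "\<dots> = (\<integral>y. (\<Sum>b\<in>Basis. indicator (cylinder e) y * ((b \<bullet> e - gradient g y \<bullet> b) * G b (graph_point e (gh n) y))) \<partial>lborel)"
      using step by (intro Bochner_Integration.integral_sum[symmetric]) auto
    finally show ?thesis by (simp add: sum_distrib_left[symmetric] PG sum_flux)
  qed

  define dv where "dv y = (\<Sum>b\<in>Basis. F' y b \<bullet> b)" for y
  have dv_cont: "continuous_on U dv"
    unfolding dv_def using cont' by (intro continuous_intros) (auto simp: U_def)
  have dvm [measurable]: "(\<lambda>y. indicator U y * dv y) \<in> borel_measurable borel"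
    using borel_measurable_continuous_on_indicator[OF Um dv_cont] by simp
  have dv0: "\<bar>indicator U y * dv y\<bar> \<le> \<bar>B\<bar> * indicator (cball 0 R) y" for y
    using div[of y] F'0[of y] by (auto simp: dv_def U_def split: split_indicator)
  have sub: "{y. y \<bullet> e < gh n y} \<subseteq> U" for n using hp[of n] by (auto simp: U_def gh_def)
  have dom1: "integrable lborel (\<lambda>y. \<bar>B\<bar> * indicator (cball (0::'a) R) y)"
    using emeasure_bounded_finite[of "cball 0 R :: 'a set"]
    by (intro integrable_mult_right integrable_real_indicator) auto
  have gh_meas [measurable]: "gh n \<in> borel_measurable borel" for n unfolding gh_def by measurable
  have pw1: "(\<lambda>n. indicator {y. y \<bullet> e < gh n y} y * dv y) \<longlonglongrightarrow> indicator U y * dv y" for y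
  proof (rule tendsto_eventually, cases "y \<in> U")
    case True
    hence "g y - y \<bullet> e > 0" by (simp add: U_def)
    from order_tendstoD(2)[OF h_lim this]
    show "eventually (\<lambda>n. indicator {y. y \<bullet> e < gh n y} y * dv y = indicator U y * dv y) sequentially"
      by eventually_elim (use True in \<open>simp add: gh_def\<close>)
  qed (insert sub, auto split: split_indicator intro!: always_eventually)
  have meas1: "(\<lambda>y. indicator {y. y \<bullet> e < gh n y} y * dv y) \<in> borel_measurable lborel" for n
  proof -
    have "(\<lambda>y. indicator {y. y \<bullet> e < gh n y} y * dv y) = (\<lambda>y. indicator {y. y \<bullet> e < gh n y} y * (indicator U y * dv y))"
      by (rule ext) (use sub[of n] in \<open>auto split: split_indicator\<close>)
    also have "\<dots> \<in> borel_measurable lborel" using dvm by measurable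
    finally show ?thesis .
  qed
  have lim1: "(\<lambda>n. \<integral>y. indicator {y. y \<bullet> e < gh n y} y * dv y \<partial>lborel) \<longlonglongrightarrow> (\<integral>y. indicator U y * dv y \<partial>lborel)"
  proof (rule integral_dominated_convergence[OF _ meas1 dom1])
    show "AE y in lborel. norm (indicator {y. y \<bullet> e < gh n y} y * dv y) \<le> \<bar>B\<bar> * indicator (cball 0 R) y" for n
    proof (rule AE_I2)
      fix y
      have "norm (indicator {y. y \<bullet> e < gh n y} y * dv y) \<le> \<bar>indicator U y * dv y\<bar>"
        using sub[of n] by (auto split: split_indicator)
      thus "norm (indicator {y. y \<bullet> e < gh n y} y * dv y) \<le> \<bar>B\<bar> * indicator (cball 0 R) y"
        using dv0[of y] by linarith
    qed
  qed (use pw1 in auto)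

  have gp_n: "graph_point e (gh n) y = graph_point e g y - h n *\<^sub>R e" for n y
    by (simp add: graph_point_def gh_def algebra_simps)
  have gp: "graph_point e g y \<bullet> e = g y \<and> g (graph_point e g y) = g y" for y
  proof -
    have "graph_point e g y = y + (g y - y \<bullet> e) *\<^sub>R e" by (simp add: graph_point_def algebra_simps)
    thus ?thesis by (simp add: inner_add_left ee inv)
  qed
  have le_n: "graph_point e (gh n) y \<bullet> e \<le> g (graph_point e (gh n) y)" for n y
    using hp[of n] gp[of y] inv[of "graph_point e g y" "- h n"] by (simp add: gp_n inner_diff_left ee)
  have P_lim: "(\<lambda>n. P n y) \<longlonglongrightarrow> F (graph_point e g y)" for y
    unfolding P_def
  proof (rule continuous_on_tendsto_compose[OF cont])
    show "(\<lambda>n. graph_point e (gh n) y) \<longlonglongrightarrow> graph_point e g y"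
      unfolding gp_n using h_lim by (auto intro!: tendsto_eq_intros)
    show "eventually (\<lambda>n. graph_point e (gh n) y \<in> {y. y \<bullet> e \<le> g y}) sequentially" using le_n by auto
  qed (use gp in auto)
  have P_meas [measurable]: "P n \<in> borel_measurable borel" for n
  proof -
    have [measurable]: "graph_point e (gh n) \<in> borel_measurable borel"
      unfolding graph_point_def by measurable
    have "(\<lambda>y. \<Sum>b\<in>Basis. G b (graph_point e (gh n) y) *\<^sub>R b) \<in> borel_measurable borel" by measurable
    thus ?thesis by (simp add: PG euclidean_representation)
  qed
  \<comment> \<open>\<open>B0\<close> bounds \<open>F\<close>, \<open>1 + C\<close> bounds
    \<open>e - gradient g\<close>, and by \<open>cylinder_norm_le\<close> the integrands vanish at
    cylinder points of norm above \<open>R + 2\<close>.\<close>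
  define dom where "dom y = indicator (cylinder e \<inter> cball 0 (R + 2)) y * (B0 * (1 + C))" for y
  have dom2: "integrable lborel dom"
    unfolding dom_def
  proof (intro integrable_mult_left integrable_real_indicator)
    have "emeasure lborel (cylinder e \<inter> cball 0 (R + 2)) \<le> emeasure lborel (cball (0::'a) (R + 2))"
      by (intro emeasure_mono) auto
    also have "\<dots> < \<infinity>" using emeasure_bounded_finite[of "cball 0 (R+2) :: 'a set"] by simp
    finally show "emeasure lborel (cylinder e \<inter> cball 0 (R + 2)) < \<infinity>" .
  qed auto
  have bd2: "AE y in lborel. norm (indicator (cylinder e) y * (P n y \<bullet> (e - gradient g y))) \<le> dom y" for n
    using diff
  proof eventually_elim
    fix y assume y: "g differentiable (at y)"
    have "norm (P n y) \<le> B0" unfolding P_def using le_n by (intro Fb)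
    moreover have "norm (e - gradient g y) \<le> 1 + C"
      using norm_gradient_le_lipschitz[OF lip y] norm_triangle_ineq4[of e "gradient g y"] e by simp
    ultimately have 1: "\<bar>P n y \<bullet> (e - gradient g y)\<bar> \<le> B0 * (1 + C)"
      using Cauchy_Schwarz_ineq2[of "P n y" "e - gradient g y"] \<open>B0 > 0\<close>
      using mult_mono[of "norm (P n y)" B0 "norm (e - gradient g y)" "1 + C"] by simp
    have 2: "P n y = 0" if "y \<in> cylinder e" "norm y > R + 2"
    proof -
      have "norm (graph_point e (gh n) y) > R"
        using cylinder_norm_le[OF e that(1), of "gh n y"] that(2) by (simp add: graph_point_def)
      thus ?thesis by (simp add: P_def supp)
    qed
    show "norm (indicator (cylinder e) y * (P n y \<bullet> (e - gradient g y))) \<le> dom y"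
      using 1 2 by (auto simp: dom_def not_le split: split_indicator)
  qed
  have pw2: "(\<lambda>n. indicator (cylinder e) y * (P n y \<bullet> (e - gradient g y))) \<longlonglongrightarrow>
      indicator (cylinder e) y * (F (graph_point e g y) \<bullet> (e - gradient g y))" for y
    by (intro tendsto_intros P_lim)
  have meas2: "(\<lambda>y. indicator (cylinder e) y * (P n y \<bullet> (e - gradient g y))) \<in> borel_measurable lborel" for n
    by measurable
  have meas3: "(\<lambda>y. indicator (cylinder e) y * (F (graph_point e g y) \<bullet> (e - gradient g y))) \<in> borel_measurable lborel"
    by (rule borel_measurable_LIMSEQ_real[OF pw2 meas2])
  show "integrable lborel (\<lambda>y. indicator (cylinder e) y * (F (graph_point e g y) \<bullet> (e - gradient g y)))"
    by (rule integrable_dominated_convergence[where s = "\<lambda>n y. indicator (cylinder e) y * (P n y \<bullet> (e - gradient g y))", OF meas3 meas2 dom2 _ bd2]) (use pw2 in auto)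
  have lim2: "(\<lambda>n. \<integral>y. indicator (cylinder e) y * (P n y \<bullet> (e - gradient g y)) \<partial>lborel) \<longlonglongrightarrow>
      (\<integral>y. indicator (cylinder e) y * (F (graph_point e g y) \<bullet> (e - gradient g y)) \<partial>lborel)"
    by (rule integral_dominated_convergence[where s = "\<lambda>n y. indicator (cylinder e) y * (P n y \<bullet> (e - gradient g y))", OF meas3 meas2 dom2 _ bd2]) (use pw2 in auto)
  show "(\<integral>y. indicator {y. y \<bullet> e < g y} y * (\<Sum>b\<in>Basis. F' y b \<bullet> b) \<partial>lborel) =
      (\<integral>y. indicator (cylinder e) y * (F (graph_point e g y) \<bullet> (e - gradient g y)) \<partial>lborel)"
    using LIMSEQ_unique[OF lim1 lim2[folded eq_n[unfolded dv_def[symmetric]]]] by (simp add: U_def dv_def)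
qed

section \<open>Charts and the surface measure\<close>

text \<open>The preimages under \<open>f\<close> and \<open>g\<close> differ by a subset of a null
  set. This is how functions of \<open>outward_normal\<close> become measurable: almost everywhere
  they agree with Borel expressions built from a chart.\<close>

lemma borel_measurable_completion_AE:
  fixes f g :: "'a \<Rightarrow> 'b::topological_space"
  assumes g: "g \<in> borel_measurable M" and eq: "AE x in M. f x = g x"
  shows "f \<in> borel_measurable (completion M)"
proof (rule measurableI)
  fix A :: "'b set" assume A: "A \<in> sets borel"
  have g': "g \<in> borel_measurable (completion M)" using g by (rule measurable_completion)
  have ne: "Measurable.pred (completion M) (\<lambda>x. f x \<noteq> g x)"
    by (rule sets_completion_AE) (use eq in simp)
  have nA: "Measurable.pred (completion M) (\<lambda>x. f x \<noteq> g x \<and> f x \<in> A)"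
    by (rule sets_completion_AE) (use eq in eventually_elim, simp)
  have gA: "Measurable.pred (completion M) (\<lambda>x. g x \<in> A)"
    using measurable_sets[OF g' A] by (simp add: pred_def vimage_def Int_def conj_commute)
  have "Measurable.pred (completion M) (\<lambda>x. (f x \<noteq> g x \<and> f x \<in> A) \<or> (\<not> (f x \<noteq> g x) \<and> g x \<in> A))"
    using ne nA gA by measurable
  moreover have "(\<lambda>x. (f x \<noteq> g x \<and> f x \<in> A) \<or> (\<not> (f x \<noteq> g x) \<and> g x \<in> A)) = (\<lambda>x. f x \<in> A)" by auto
  ultimately have "Measurable.pred (completion M) (\<lambda>x. f x \<in> A)" by (simp only:)
  thus "f -` A \<inter> space (completion M) \<in> sets (completion M)"
    by (simp add: pred_def vimage_def Int_def conj_commute)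
qed simp

text \<open>From \<open>x\<close> the direction \<open>\<nu>' - \<nu>\<close> points strictly inward
  with respect to \<open>\<nu>\<close> and strictly outward with respect to \<open>\<nu>'\<close>,
  which is impossible.\<close>

lemma outward_normal_unique:
  assumes n1: "is_outward_normal \<Omega> x \<nu>" and n2: "is_outward_normal \<Omega> x \<nu>'"
  shows "\<nu> = \<nu>'"
proof (rule ccontr)
  assume ne: "\<nu> \<noteq> \<nu>'"
  define w where "w = \<nu>' - \<nu>"
  define c where "c = 1 - \<nu> \<bullet> \<nu>'"
  have nn: "\<nu> \<bullet> \<nu> = 1" "\<nu>' \<bullet> \<nu>' = 1"
    using n1 n2 by (simp_all add: is_outward_normal_def norm_eq_1)
  have "w \<bullet> w = 2 * c" by (simp add: w_def c_def inner_diff_left inner_diff_right nn inner_commute)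
  moreover have "w \<bullet> w > 0" using ne by (simp add: w_def)
  ultimately have c: "c > 0" by simp
  have w: "norm w > 0" using ne by (simp add: w_def)
  have wn: "w \<bullet> \<nu> = - c" "w \<bullet> \<nu>' = c"
    by (simp_all add: w_def c_def inner_diff_left nn inner_commute[of \<nu>' \<nu>])
  \<comment> \<open>Along \<open>t *\<^sub>R w\<close> both inner products have modulus
    \<open>t * c\<close>, and this tolerance amounts to half of it.\<close>
  define \<epsilon> where "\<epsilon> = c / (2 * norm w)"
  have \<epsilon>: "\<epsilon> > 0" using c w by (simp add: \<epsilon>_def)
  obtain r1 where r1: "r1 > 0" "\<And>y. y \<in> ball x r1 \<Longrightarrow> (y - x) \<bullet> \<nu> < - \<epsilon> * norm (y - x) \<Longrightarrow> y \<in> \<Omega>"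
    using n1 \<epsilon> unfolding is_outward_normal_def by meson
  obtain r2 where r2: "r2 > 0" "\<And>y. y \<in> ball x r2 \<Longrightarrow> (y - x) \<bullet> \<nu>' > \<epsilon> * norm (y - x) \<Longrightarrow> y \<notin> \<Omega>"
    using n2 \<epsilon> unfolding is_outward_normal_def by meson
  define t where "t = min r1 r2 / (2 * norm w)"
  have t: "t > 0" using r1 r2 w by (simp add: t_def)
  have "t * norm w < r1" "t * norm w < r2" using r1 r2 w by (auto simp: t_def min_def)
  hence b: "x + t *\<^sub>R w \<in> ball x r1" "x + t *\<^sub>R w \<in> ball x r2" using t by (auto simp: dist_norm)
  have e1: "\<epsilon> * norm (t *\<^sub>R w) = t * c / 2" using t w by (simp add: \<epsilon>_def)
  have "x + t *\<^sub>R w \<in> \<Omega>" using t c e1 by (intro r1(2) b) (simp add: wn)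
  moreover have "x + t *\<^sub>R w \<notin> \<Omega>" using t c e1 by (intro r2(2) b) (simp add: wn)
  ultimately show False by simp
qed

lemma outward_normal_eq: "is_outward_normal \<Omega> x \<nu> \<Longrightarrow> outward_normal \<Omega> x = \<nu>"
  unfolding outward_normal_def by (rule the_equality) (auto intro: outward_normal_unique)

definition surface_density :: "('a::euclidean_space \<Rightarrow> real) \<Rightarrow> 'a \<Rightarrow> real" where
  "surface_density g y = sqrt (1 + (norm (gradient g y))\<^sup>2)"

lemma surface_density_ge_1: "surface_density g y \<ge> 1"
  by (simp add: surface_density_def)

text \<open>The normalised gradient of \<open>y \<bullet> e - g y\<close>, which is negative inside
  the domain. Where \<open>g\<close> is differentiable, the normalising factor equals the surface
  density, so in the flux the square roots cancel and \<open>e - gradient g\<close> remains.\<close>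

definition chart_normal :: "'a::euclidean_space \<Rightarrow> ('a \<Rightarrow> real) \<Rightarrow> 'a \<Rightarrow> 'a" where
  "chart_normal e g y = (1 / surface_density g y) *\<^sub>R (e - gradient g y)"

lemma gradient_invariant:
  assumes inv: "\<And>y s. g (y + s *\<^sub>R e) = g y"
  shows "gradient g (y + s *\<^sub>R e) = gradient g y"
proof -
  have "g (y + s *\<^sub>R e + t *\<^sub>R b) = g (y + t *\<^sub>R b)" for t b
    using inv[of "y + t *\<^sub>R b" s] by (simp add: add_ac)
  thus ?thesis by (simp add: gradient_def inv)
qed

lemma graph_point_alt: "graph_point e g y = y + (g y - y \<bullet> e) *\<^sub>R e"
  by (simp add: graph_point_def algebra_simps)

context
  fixes \<Omega> :: "'a::euclidean_space set" and x e :: 'a and r :: real and g :: "'a \<Rightarrow> real"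
  assumes op: "open \<Omega>" and chart: "lipschitz_chart \<Omega> x r e g"
begin

lemma
  shows chart_e: "norm e = 1" "e \<bullet> e = 1" and chart_inv: "\<And>y s. g (y + s *\<^sub>R e) = g y"
    and chart_diff: "AE y in lborel. g differentiable (at y)"
  using chart by (auto simp: lipschitz_chart_def norm_eq_1)

lemma chart_lip: obtains C where "C-lipschitz_on UNIV g"
  using chart by (auto simp: lipschitz_chart_def)

lemma chart_cont: "continuous_on UNIV g"
  by (rule chart_lip) (rule lipschitz_on_continuous_on)

lemma chart_mem: "y \<in> ball x r \<Longrightarrow> y \<in> \<Omega> \<longleftrightarrow> y \<bullet> e < g y"
  using chart unfolding lipschitz_chart_def by blast

text \<open>A point on the graph is a limit of domain points because lowering it along
  \<open>e\<close> leaves \<open>g\<close> unchanged; conversely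
  \<open>y \<bullet> e \<le> g y\<close> is a closed condition.\<close>

lemma chart_closure:
  assumes y: "y \<in> ball x r"
  shows "y \<in> closure \<Omega> \<longleftrightarrow> y \<bullet> e \<le> g y"
proof
  assume "y \<in> closure \<Omega>"
  hence "y \<in> closure (ball x r \<inter> \<Omega>)" using y open_Int_closure_subset[OF open_ball, of x r \<Omega>] by blast
  moreover have "closure (ball x r \<inter> \<Omega>) \<subseteq> {y. y \<bullet> e \<le> g y}"
  proof (rule closure_minimal)
    show "closed {y. y \<bullet> e \<le> g y}" using chart_cont by (intro closed_Collect_le continuous_intros)
  qed (use chart_mem in \<open>auto simp: less_imp_le\<close>)
  ultimately show "y \<bullet> e \<le> g y" by blast
next
  assume le: "y \<bullet> e \<le> g y"
  show "y \<in> closure \<Omega>"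
    unfolding closure_approachable
  proof (intro allI impI)
    fix \<epsilon> :: real assume \<epsilon>: "\<epsilon> > 0"
    define t where "t = min \<epsilon> (r - dist x y) / 2"
    have t: "t > 0" "t < \<epsilon>" "t < r - dist x y" using \<epsilon> y by (auto simp: t_def min_def)
    have d: "dist (y - t *\<^sub>R e) y = t" using t chart_e by (simp add: dist_norm)
    have "dist x (y - t *\<^sub>R e) \<le> dist x y + t" using d dist_triangle[of x "y - t *\<^sub>R e" y] by (simp add: dist_commute)
    hence "y - t *\<^sub>R e \<in> ball x r" using t by simp
    moreover have "(y - t *\<^sub>R e) \<bullet> e < g (y - t *\<^sub>R e)"
      using chart_inv[of y "-t"] t le by (simp add: inner_diff_left chart_e)
    ultimately have "y - t *\<^sub>R e \<in> \<Omega>" using chart_mem by blast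
    thus "\<exists>z\<in>\<Omega>. dist z y < \<epsilon>" using d t by force
  qed
qed

lemma chart_frontier: "y \<in> ball x r \<Longrightarrow> y \<in> frontier \<Omega> \<longleftrightarrow> y \<bullet> e = g y"
  using chart_closure[of y] chart_mem[of y] op by (auto simp: frontier_def interior_open)

lemma graph_point_on_graph:
  "graph_point e g y \<bullet> e = g y" "g (graph_point e g y) = g y" "gradient g (graph_point e g y) = gradient g y"
  by (simp_all add: graph_point_alt inner_add_left chart_e chart_inv gradient_invariant)

lemma graph_point_frontier: "graph_point e g y \<in> ball x r \<Longrightarrow> graph_point e g y \<in> frontier \<Omega>"
  using chart_frontier graph_point_on_graph by simp

lemma chart_gradient_orthogonal:
  assumes "g differentiable (at y)" shows "gradient g y \<bullet> e = 0"
proof -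
  have "(\<lambda>n. (g (y + inverse (real (Suc n)) *\<^sub>R e) - g y) / inverse (real (Suc n))) \<longlonglongrightarrow> gradient g y \<bullet> e"
    by (intro has_derivative_directional gradient_has_derivative assms LIMSEQ_inverse_real_of_nat) auto
  thus ?thesis by (simp add: chart_inv LIMSEQ_const_iff)
qed

lemma norm_chart_normal:
  assumes "g differentiable (at y)" shows "norm (e - gradient g y) = surface_density g y"
proof -
  have "(norm (e - gradient g y))\<^sup>2 = 1 + (norm (gradient g y))\<^sup>2"
    using chart_gradient_orthogonal[OF assms]
    by (simp add: power2_norm_eq_inner inner_diff_left inner_diff_right inner_commute chart_e)
  thus ?thesis by (metis norm_ge_zero real_sqrt_pow2 real_sqrt_unique surface_density_def)
qed

text \<open>To first order \<open>z \<bullet> e - g z\<close> is the inner product of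
  \<open>z - y\<close> with \<open>e - gradient g y\<close>. The remainder is at most
  \<open>\<epsilon> * norm (z - y)\<close>, and multiplying out the normalising factor, which is at
  least 1, only widens the margin.\<close>

lemma chart_normal_is_outward_normal:
  assumes y: "y \<in> ball x r" "y \<in> frontier \<Omega>" and d: "g differentiable (at y)"
  shows "is_outward_normal \<Omega> y (chart_normal e g y)"
  unfolding is_outward_normal_def
proof (intro conjI allI impI)
  let ?W = "surface_density g y" and ?n = "chart_normal e g y"
  have W: "?W \<ge> 1" by (rule surface_density_ge_1)
  show "norm ?n = 1" using norm_chart_normal[OF d] W by (simp add: chart_normal_def)
  fix \<epsilon> :: real assume \<epsilon>: "\<epsilon> > 0"
  have "\<exists>\<delta>>0. \<forall>z. norm (z - y) < \<delta> \<longrightarrow> norm (g z - g y - gradient g y \<bullet> (z - y)) \<le> \<epsilon> * norm (z - y)"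
    using gradient_has_derivative[OF d] \<epsilon> unfolding has_derivative_at_alt by blast
  then obtain \<delta> where \<delta>: "\<delta> > 0" "\<And>z. norm (z - y) < \<delta> \<Longrightarrow> \<bar>g z - g y - gradient g y \<bullet> (z - y)\<bar> \<le> \<epsilon> * norm (z - y)"
    by auto
  define r' where "r' = min \<delta> (r - dist x y)"
  have yg: "y \<bullet> e = g y" using chart_frontier y by blast
  show "\<exists>r>0. \<forall>z\<in>ball y r. ((z - y) \<bullet> ?n < - \<epsilon> * norm (z - y) \<longrightarrow> z \<in> \<Omega>) \<and> (\<epsilon> * norm (z - y) < (z - y) \<bullet> ?n \<longrightarrow> z \<notin> \<Omega>)"
  proof (intro exI[of _ r'] conjI ballI impI)
    show "r' > 0" using y \<delta> by (simp add: r'_def)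
  next
    fix z assume z: "z \<in> ball y r'"
    have zx: "z \<in> ball x r" using z dist_triangle[of x z y] by (simp add: r'_def)
    have "norm (z - y) < \<delta>" using z by (simp add: r'_def dist_norm norm_minus_commute)
    note rem = \<delta>(2)[OF this]
    have zn: "(z - y) \<bullet> ?n = (z - y) \<bullet> (e - gradient g y) / ?W" by (simp add: chart_normal_def)
    have ex: "z \<bullet> e - g z = (z - y) \<bullet> (e - gradient g y) - (g z - g y - gradient g y \<bullet> (z - y))"
      using yg by (simp add: inner_diff_left inner_diff_right inner_commute)
    have wle: "\<epsilon> * norm (z - y) \<le> \<epsilon> * norm (z - y) * ?W" using W \<epsilon> mult_left_mono[OF W, of "\<epsilon> * norm (z - y)"] by simp
    {
      assume "(z - y) \<bullet> ?n < - \<epsilon> * norm (z - y)"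
      hence "(z - y) \<bullet> (e - gradient g y) < - \<epsilon> * norm (z - y) * ?W"
        using W unfolding zn by (simp add: divide_less_eq)
      hence "z \<bullet> e < g z" using ex rem wle by linarith
      thus "z \<in> \<Omega>" using chart_mem zx by blast
    next
      assume "\<epsilon> * norm (z - y) < (z - y) \<bullet> ?n"
      hence "(z - y) \<bullet> (e - gradient g y) > \<epsilon> * norm (z - y) * ?W"
        using W unfolding zn by (simp add: less_divide_eq)
      hence "z \<bullet> e > g z" using ex rem wle by linarith
      thus "z \<notin> \<Omega>" using chart_mem[OF zx] by simp
    }
  qed
qed

lemma chart_measurable:
  "g \<in> borel_measurable borel" "gradient g \<in> borel_measurable borel" "graph_point e g \<in> borel_measurable borel"
  "surface_density g \<in> borel_measurable borel" "chart_normal e g \<in> borel_measurable borel"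
proof -
  show 1 [measurable]: "g \<in> borel_measurable borel" using chart_cont by (rule borel_measurable_continuous_onI)
  show 2 [measurable]: "gradient g \<in> borel_measurable borel" using chart_cont by (rule gradient_measurable)
  show "graph_point e g \<in> borel_measurable borel" unfolding graph_point_def by measurable
  show 3 [measurable]: "surface_density g \<in> borel_measurable borel" unfolding surface_density_def by measurable
  show "chart_normal e g \<in> borel_measurable borel" unfolding chart_normal_def by measurable
qed

section \<open>Transfer of surface integrals to the cylinder\<close>

context
  fixes \<sigma> \<beta> :: "'a measure"
  assumes surf: "surface_measure \<Omega> \<sigma>" and \<beta>: "sets \<beta> = sets borel" "\<sigma> = completion \<beta>"
begin

lemma chart_emeasure:
  assumes [measurable]: "A \<in> sets borel"
  shows "emeasure \<beta> (A \<inter> ball x r \<inter> frontier \<Omega>) =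
    (\<integral>\<^sup>+y. indicator (cylinder e) y * indicator (A \<inter> ball x r) (graph_point e g y) * ennreal (surface_density g y) \<partial>lborel)"
proof -
  note [measurable] = chart_measurable
  have [measurable]: "A \<inter> ball x r \<inter> frontier \<Omega> \<in> sets borel" by (intro sets.Int assms borel_closed borel_open) auto
  have "emeasure \<beta> (A \<inter> ball x r \<inter> frontier \<Omega>) = emeasure \<sigma> (A \<inter> ball x r \<inter> frontier \<Omega>)"
    using \<beta> by simp
  also have "\<dots> = (\<integral>\<^sup>+ y. indicator {y. 0 \<le> y \<bullet> e \<and> y \<bullet> e \<le> 1 \<and> y - (y \<bullet> e) *\<^sub>R e + g y *\<^sub>R e \<in> A \<inter> ball x r} y *
                  ennreal (sqrt (1 + (onorm (frechet_derivative g (at y)))\<^sup>2)) \<partial>lborel)"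
    using surf[unfolded surface_measure_def, THEN conjunct2, rule_format, OF chart, of "A \<inter> ball x r"] by simp
  also have "\<dots> = (\<integral>\<^sup>+y. indicator (cylinder e) y * indicator (A \<inter> ball x r) (graph_point e g y) * ennreal (surface_density g y) \<partial>lborel)"
    by (intro nn_integral_cong_AE, use chart_diff in eventually_elim)
      (auto simp: cylinder_def graph_point_def surface_density_def onorm_frechet_derivative split: split_indicator)
  finally show ?thesis .
qed

text \<open>Lifts the chart condition from sets to measures, so that integrability and integrals of
  signed functions transfer by push-forward and density.\<close>

lemma chart_measure_eq:
  "density \<beta> (\<lambda>y. ennreal (indicator (ball x r \<inter> frontier \<Omega>) y)) =
   distr (density lborel (\<lambda>y. ennreal (indicator (cylinder e) y * indicator (ball x r) (graph_point e g y) * surface_density g y)))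
     borel (graph_point e g)" (is "?M1 = ?M2")
proof (rule measure_eqI)
  note [measurable] = chart_measurable
  show "sets ?M1 = sets ?M2" using \<beta> by simp
  fix A assume "A \<in> sets ?M1"
  hence A [measurable]: "A \<in> sets borel" using \<beta> by simp
  have [measurable]: "ball x r \<inter> frontier \<Omega> \<in> sets borel" by (intro sets.Int borel_closed borel_open) auto
  have [measurable]: "ball x r \<in> sets borel" by simp
  have w [measurable]: "(\<lambda>y. indicator (cylinder e) y * indicator (ball x r) (graph_point e g y) * surface_density g y) \<in> borel_measurable borel"
    by measurable
  have "emeasure ?M1 A = (\<integral>\<^sup>+y. indicator (A \<inter> ball x r \<inter> frontier \<Omega>) y \<partial>\<beta>)"
  proof (subst emeasure_density)
    show "(\<integral>\<^sup>+y. ennreal (indicator (ball x r \<inter> frontier \<Omega>) y) * indicator A y \<partial>\<beta>) = (\<integral>\<^sup>+y. indicator (A \<inter> ball x r \<inter> frontier \<Omega>) y \<partial>\<beta>)"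
      by (rule nn_integral_cong) (auto split: split_indicator)
  qed (use \<beta> in auto)
  also have "\<dots> = emeasure \<beta> (A \<inter> ball x r \<inter> frontier \<Omega>)"
    using \<beta> by (intro nn_integral_indicator) (simp add: Int_assoc)
  also have "\<dots> = (\<integral>\<^sup>+y. indicator (cylinder e) y * indicator (A \<inter> ball x r) (graph_point e g y) * ennreal (surface_density g y) \<partial>lborel)"
    by (rule chart_emeasure) simp
  also have "\<dots> = (\<integral>\<^sup>+y. ennreal (indicator (cylinder e) y * indicator (ball x r) (graph_point e g y) * surface_density g y) *
      indicator (graph_point e g -` A) y \<partial>lborel)"
    by (intro nn_integral_cong) (auto split: split_indicator)
  also have "\<dots> = emeasure ?M2 A"
    using measurable_sets[OF chart_measurable(3) A]
    by (subst emeasure_distr, simp, simp, subst emeasure_density) auto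
  finally show "emeasure ?M1 A = emeasure ?M2 A" .
qed

text \<open>Stated for the Borel measure \<open>\<beta>\<close>, where push-forward and density
  apply directly; the passage to \<open>\<sigma>\<close> is left to the completion.\<close>

lemma chart_integral:
  fixes f :: "'a \<Rightarrow> real"
  assumes f [measurable]: "f \<in> borel_measurable borel" and supp: "\<And>y. y \<notin> ball x r \<Longrightarrow> f y = 0"
  shows "integrable \<beta> (\<lambda>y. indicator (frontier \<Omega>) y * f y) \<longleftrightarrow>
      integrable lborel (\<lambda>y. indicator (cylinder e) y * (f (graph_point e g y) * surface_density g y))"
    and "(\<integral>y. indicator (frontier \<Omega>) y * f y \<partial>\<beta>) =
      (\<integral>y. indicator (cylinder e) y * (f (graph_point e g y) * surface_density g y) \<partial>lborel)"
proof -
  note [measurable] = chart_measurable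
  have [measurable]: "ball x r \<in> sets borel" by simp
  let ?B = "ball x r \<inter> frontier \<Omega>"
  define w where "w y = indicator (cylinder e) y * indicator (ball x r) (graph_point e g y) * surface_density g y" for y
  have w [measurable]: "w \<in> borel_measurable borel" unfolding w_def by measurable
  have w0: "w y \<ge> 0" for y using surface_density_ge_1[of g y] by (auto simp: w_def split: split_indicator)
  have B [measurable]: "?B \<in> sets borel" by (intro sets.Int borel_closed borel_open) auto
  have fb [measurable]: "f \<in> borel_measurable \<beta>" using f by (simp add: measurable_cong_sets[OF \<beta>(1) refl])
  have Bb [measurable]: "?B \<in> sets \<beta>" using B \<beta> by simp
  have meq: "density \<beta> (\<lambda>y. ennreal (indicator ?B y)) = distr (density lborel (\<lambda>y. ennreal (w y))) borel (graph_point e g)"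
    using chart_measure_eq by (simp add: w_def)
  have e1: "(\<lambda>y. indicator ?B y *\<^sub>R f y) = (\<lambda>y. indicator (frontier \<Omega>) y * f y)"
    by (rule ext) (use supp in \<open>auto split: split_indicator\<close>)
  have e2: "(\<lambda>y. w y *\<^sub>R f (graph_point e g y)) = (\<lambda>y. indicator (cylinder e) y * (f (graph_point e g y) * surface_density g y))"
    by (rule ext) (use supp in \<open>auto simp: w_def split: split_indicator\<close>)
  have "integrable (density \<beta> (\<lambda>y. ennreal (indicator ?B y))) f \<longleftrightarrow> integrable \<beta> (\<lambda>y. indicator ?B y *\<^sub>R f y)"
    by (rule integrable_density) auto
  moreover have "integrable (distr (density lborel (\<lambda>y. ennreal (w y))) borel (graph_point e g)) f \<longleftrightarrow>
     integrable (density lborel (\<lambda>y. ennreal (w y))) (\<lambda>y. f (graph_point e g y))"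
    by (rule integrable_distr_eq) auto
  moreover have "integrable (density lborel (\<lambda>y. ennreal (w y))) (\<lambda>y. f (graph_point e g y)) \<longleftrightarrow>
     integrable lborel (\<lambda>y. w y *\<^sub>R f (graph_point e g y))"
    by (rule integrable_density) (use w0 in auto)
  ultimately show "integrable \<beta> (\<lambda>y. indicator (frontier \<Omega>) y * f y) \<longleftrightarrow>
      integrable lborel (\<lambda>y. indicator (cylinder e) y * (f (graph_point e g y) * surface_density g y))"
    using meq e1 e2 by simp
  have "(\<integral>y. f y \<partial>density \<beta> (\<lambda>y. ennreal (indicator ?B y))) = (\<integral>y. indicator ?B y *\<^sub>R f y \<partial>\<beta>)"
    by (rule integral_density) auto
  moreover have "(\<integral>y. f y \<partial>distr (density lborel (\<lambda>y. ennreal (w y))) borel (graph_point e g)) =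
     (\<integral>y. f (graph_point e g y) \<partial>density lborel (\<lambda>y. ennreal (w y)))"
    by (rule integral_distr) auto
  moreover have "(\<integral>y. f (graph_point e g y) \<partial>density lborel (\<lambda>y. ennreal (w y))) = (\<integral>y. w y *\<^sub>R f (graph_point e g y) \<partial>lborel)"
    by (rule integral_density) (use w0 in auto)
  ultimately show "(\<integral>y. indicator (frontier \<Omega>) y * f y \<partial>\<beta>) =
      (\<integral>y. indicator (cylinder e) y * (f (graph_point e g y) * surface_density g y) \<partial>lborel)"
    using meq e1 e2 by simp
qed

text \<open>The set where \<open>g\<close> is not differentiable is invariant along \<open>e\<close>, so almost every slice of a
  Borel null set containing it can serve as a null set of the hyperplane.\<close>

lemma chart_AE_differentiable:
  "AE y in \<beta>. y \<in> ball x r \<inter> frontier \<Omega> \<longrightarrow> g differentiable (at y)"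
proof -
  note [measurable] = chart_measurable
  from chart_diff obtain Z where Z: "{y \<in> space lborel. \<not> g differentiable (at y)} \<subseteq> Z" "emeasure lborel Z = 0" "Z \<in> sets lborel"
    by (rule AE_E)
  have Zm [measurable]: "Z \<in> sets borel" using Z(3) by simp
  define S where "S s y = y - (y \<bullet> e) *\<^sub>R e + s *\<^sub>R e" for s :: real and y
  have Sm [measurable]: "(\<lambda>(y, s). S s y) \<in> borel_measurable (lborel \<Otimes>\<^sub>M lborel)" unfolding S_def by measurable
  have Sm' [measurable]: "S s \<in> borel_measurable borel" for s unfolding S_def by measurable
  have "0 = (\<integral>\<^sup>+y. indicator Z y \<partial>lborel)" using Z by simp
  also have "\<dots> = (\<integral>\<^sup>+y. indicator (cylinder e) y * (\<integral>\<^sup>+s. indicator Z (y + s *\<^sub>R e) \<partial>lborel) \<partial>lborel)"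
    by (rule nn_integral_lborel_cylinder[OF chart_e(1)]) simp
  also have "\<dots> = (\<integral>\<^sup>+y. (\<integral>\<^sup>+s. indicator (cylinder e) y * indicator Z (S s y) \<partial>lborel) \<partial>lborel)"
  proof (rule nn_integral_cong)
    fix y
    have "(\<integral>\<^sup>+s. indicator Z (y + s *\<^sub>R e) \<partial>lborel) = (\<integral>\<^sup>+s. indicator Z (S s y) \<partial>lborel)"
      by (subst nn_integral_real_affine[where c = 1 and t = "- (y \<bullet> e)"]) (auto simp: S_def algebra_simps)
    thus "indicator (cylinder e) y * (\<integral>\<^sup>+s. indicator Z (y + s *\<^sub>R e) \<partial>lborel) =
      (\<integral>\<^sup>+s. indicator (cylinder e) y * indicator Z (S s y) \<partial>lborel)"
      by (simp add: nn_integral_cmult)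
  qed
  also have "\<dots> = (\<integral>\<^sup>+s. (\<integral>\<^sup>+y. indicator (cylinder e) y * indicator Z (S s y) \<partial>lborel) \<partial>lborel)"
    by (rule lborel_pair.Fubini') measurable
  finally have "AE s in lborel. (\<integral>\<^sup>+y. indicator (cylinder e) y * indicator Z (S s y) \<partial>lborel) = 0"
    by (subst (asm) eq_commute, subst (asm) nn_integral_0_iff_AE) auto
  then obtain s where s: "(\<integral>\<^sup>+y. indicator (cylinder e) y * indicator Z (S s y) \<partial>lborel) = 0"
    using eventually_happens'[of "ae_filter (lborel :: real measure)"] by (auto simp: ae_filter_eq_bot_iff)
  define B where "B = S s -` Z"
  have Bm [measurable]: "B \<in> sets borel" using measurable_sets[OF Sm' Zm] by (simp add: B_def)
  \<comment> \<open>A point and the graph point over it have the same projection to height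
    \<open>s\<close>, so the pull-back \<open>B\<close> of the null slice meets the surface in a
    null set.\<close>
  have SB: "S s (graph_point e g y) = S s y" for y
    by (simp add: S_def graph_point_on_graph) (simp add: graph_point_def)
  have "emeasure \<beta> (B \<inter> ball x r \<inter> frontier \<Omega>) =
    (\<integral>\<^sup>+y. indicator (cylinder e) y * indicator (B \<inter> ball x r) (graph_point e g y) * ennreal (surface_density g y) \<partial>lborel)"
    by (rule chart_emeasure[OF Bm])
  also have "\<dots> = (\<integral>\<^sup>+(y::'a). 0 \<partial>lborel)"
  proof (rule nn_integral_cong_AE)
    have "AE y in lborel. indicator (cylinder e) y * indicator Z (S s y) = (0::ennreal)"
      using s by (subst (asm) nn_integral_0_iff_AE) auto
    thus "AE y in lborel. indicator (cylinder e) y * indicator (B \<inter> ball x r) (graph_point e g y) * ennreal (surface_density g y) = 0"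
      by eventually_elim (auto simp: B_def SB split: split_indicator split_indicator_asm)
  qed
  finally have "B \<inter> ball x r \<inter> frontier \<Omega> \<in> null_sets \<beta>"
    using \<beta>(1) by (intro null_setsI) (auto intro!: sets.Int Bm borel_closed borel_open)
  hence "AE y in \<beta>. y \<notin> B \<inter> ball x r \<inter> frontier \<Omega>" by (rule AE_not_in)
  thus ?thesis
  proof eventually_elim
    fix y assume y: "y \<notin> B \<inter> ball x r \<inter> frontier \<Omega>"
    show "y \<in> ball x r \<inter> frontier \<Omega> \<longrightarrow> g differentiable (at y)"
    proof
      assume "y \<in> ball x r \<inter> frontier \<Omega>"
      hence "S s y \<notin> Z" using y by (auto simp: B_def)
      hence "g differentiable (at (S s y))" using Z(1) by auto
      moreover have "S s y = y + (s - y \<bullet> e) *\<^sub>R e" by (simp add: S_def algebra_simps)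
      ultimately have d: "g differentiable (at (y + (s - y \<bullet> e) *\<^sub>R e))" by simp
      have "(\<lambda>z. g (z + (s - y \<bullet> e) *\<^sub>R e)) differentiable (at y)"
        using differentiable_chain_at[of "\<lambda>z. z + (s - y \<bullet> e) *\<^sub>R e" y g] d by (simp add: o_def)
      thus "g differentiable (at y)" by (simp add: chart_inv)
    qed
  qed
qed

lemma chart_AE_normal:
  "AE y in \<beta>. y \<in> ball x r \<inter> frontier \<Omega> \<longrightarrow> outward_normal \<Omega> y = chart_normal e g y"
  using chart_AE_differentiable
  by eventually_elim (auto intro!: outward_normal_eq chart_normal_is_outward_normal)

text \<open>The density is at most \<open>sqrt (1 + C\<^sup>2)\<close>, and the cylinder points
  whose graph point lies in the ball form a bounded set.\<close>

lemma chart_finite: "emeasure \<beta> (ball x r \<inter> frontier \<Omega>) < \<infinity>"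
proof -
  obtain C where C: "C-lipschitz_on UNIV g" by (rule chart_lip)
  have "emeasure \<beta> (UNIV \<inter> ball x r \<inter> frontier \<Omega>) =
    (\<integral>\<^sup>+y. indicator (cylinder e) y * indicator (UNIV \<inter> ball x r) (graph_point e g y) * ennreal (surface_density g y) \<partial>lborel)"
    by (rule chart_emeasure) simp
  also have "\<dots> \<le> (\<integral>\<^sup>+y. ennreal (sqrt (1 + C\<^sup>2)) * indicator (cball (0::'a) (norm x + r + 1)) y \<partial>lborel)"
  proof (rule nn_integral_mono_AE, rule eventually_mono[OF chart_diff])
    fix y assume "g differentiable (at y)"
    hence "norm (gradient g y) \<le> C" by (rule norm_gradient_le_lipschitz[OF C])
    hence 1: "surface_density g y \<le> sqrt (1 + C\<^sup>2)" by (auto simp: surface_density_def intro!: power_mono)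
    have 2: "norm y \<le> norm x + r + 1" if "y \<in> cylinder e" "graph_point e g y \<in> ball x r"
      using cylinder_norm_le[OF chart_e(1) that(1), of "g y"] that(2) norm_triangle_ineq2[of "graph_point e g y" x]
      by (simp add: graph_point_def[symmetric] dist_norm norm_minus_commute)
    show "indicator (cylinder e) y * indicator (UNIV \<inter> ball x r) (graph_point e g y) * ennreal (surface_density g y)
       \<le> ennreal (sqrt (1 + C\<^sup>2)) * indicator (cball 0 (norm x + r + 1)) y"
      using 1 2 by (auto split: split_indicator intro!: ennreal_leI)
  qed
  also have "\<dots> = ennreal (sqrt (1 + C\<^sup>2)) * emeasure lborel (cball (0::'a) (norm x + r + 1))"
    by (rule nn_integral_cmult_indicator) simp
  also have "\<dots> < \<infinity>"
    using emeasure_bounded_finite[of "cball 0 (norm x + r + 1) :: 'a set"] by (simp add: ennreal_mult_less_top)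
  finally show ?thesis by simp
qed

text \<open>Outside the ball the subgraph of \<open>g\<close> need not resemble
  \<open>\<Omega>\<close>. Since \<open>F\<close> vanishes before the sphere of radius
  \<open>r\<close> is reached, its extension by zero lives on the whole subgraph and the theorem for
  graphs applies.\<close>

lemma chart_divergence:
  fixes F :: "'a \<Rightarrow> 'a" and F' :: "'a \<Rightarrow> 'a \<Rightarrow> 'a"
  assumes \<rho>: "\<rho> < r" and supp: "\<And>y. y \<in> closure \<Omega> \<Longrightarrow> dist x y > \<rho> \<Longrightarrow> F y = 0"
    and cont: "continuous_on (closure \<Omega>) F"
    and deriv: "\<And>y. y \<in> \<Omega> \<Longrightarrow> (F has_derivative F' y) (at y)"
    and cont': "\<And>b. b \<in> Basis \<Longrightarrow> continuous_on \<Omega> (\<lambda>y. F' y b)"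
    and div: "\<And>y. y \<in> \<Omega> \<Longrightarrow> \<bar>\<Sum>b\<in>Basis. F' y b \<bullet> b\<bar> \<le> B"
  shows "set_integrable \<sigma> (frontier \<Omega>) (\<lambda>y. F y \<bullet> outward_normal \<Omega> y)"
    and "(LINT y:\<Omega>|lborel. (\<Sum>b\<in>Basis. F' y b \<bullet> b)) = (LINT y:frontier \<Omega>|\<sigma>. F y \<bullet> outward_normal \<Omega> y)"
proof -
  note [measurable] = chart_measurable
  obtain C where C: "C-lipschitz_on UNIV g" by (rule chart_lip)
  define F1 where "F1 y = (if y \<in> closure \<Omega> \<and> y \<in> ball x r then F y else 0)" for y
  define F1' where "F1' y = (if y \<in> \<Omega> \<and> y \<in> ball x r then F' y else (\<lambda>v. 0))" for y
  have cl: "\<Omega> \<subseteq> closure \<Omega>" by (rule closure_subset)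
  have out: "open {y. dist x y > \<rho>}" by (intro open_Collect_less continuous_intros)
  have F1_out: "F1 y = 0" if "dist x y > \<rho>" for y using supp that by (simp add: F1_def)
  \<comment> \<open>Two open sets cover the space: on one the extended field is zero, on the other
    the chart describes \<open>\<Omega>\<close>. Continuity and derivatives are checked on
    each.\<close>
  have cover: "dist x y > \<rho> \<or> y \<in> ball x r" for y using \<rho> by (auto simp: not_less)
  have F'0: "F' y = (\<lambda>v. 0)" if "y \<in> \<Omega>" "dist x y > \<rho>" for y
  proof -
    have o: "open (\<Omega> \<inter> {y. dist x y > \<rho>})" using op out by blast
    from has_derivative_transform_within_open[OF has_derivative_const o, of y 0 F]
    have "(F has_derivative (\<lambda>v. 0)) (at y)" using supp that cl by auto
    thus ?thesis using deriv[OF that(1)] by (metis has_derivative_unique)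
  qed
  have e1: "continuous_on {y. y \<bullet> e \<le> g y} F1"
    unfolding continuous_on_def
  proof
    fix y assume y: "y \<in> {y. y \<bullet> e \<le> g y}"
    consider "dist x y > \<rho>" | "y \<in> ball x r" using cover by blast
    thus "(F1 \<longlongrightarrow> F1 y) (at y within {y. y \<bullet> e \<le> g y})"
    proof cases
      case 1
      have "eventually (\<lambda>z. F1 z = 0) (at y within {y. y \<bullet> e \<le> g y})"
        using eventually_at_in_open'[OF out, of y] 1 F1_out
        by (auto simp: eventually_at_filter elim!: eventually_mono)
      thus ?thesis using F1_out[OF 1] by (simp add: tendsto_eventually)
    next
      case 2
      have yc: "y \<in> closure \<Omega>" using chart_closure[OF 2] y by simp
      have "(F \<longlongrightarrow> F y) (at y within closure \<Omega>)" using cont yc by (simp add: continuous_on_def)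
      hence "(F \<longlongrightarrow> F1 y) (at y within closure \<Omega>)" using 2 yc by (simp add: F1_def)
      hence "(F \<longlongrightarrow> F1 y) (at y within (closure \<Omega> \<inter> ball x r))" by (rule tendsto_within_subset) simp
      hence "(F1 \<longlongrightarrow> F1 y) (at y within (closure \<Omega> \<inter> ball x r))"
        by (rule Lim_transform_within[OF _ zero_less_one]) (auto simp: F1_def)
      moreover have "closure \<Omega> \<inter> ball x r = {y. y \<bullet> e \<le> g y} \<inter> ball x r" using chart_closure by blast
      ultimately have "(F1 \<longlongrightarrow> F1 y) (at y within ({y. y \<bullet> e \<le> g y} \<inter> ball x r))" by simp
      moreover have "at y within ({y. y \<bullet> e \<le> g y} \<inter> ball x r) = at y within {y. y \<bullet> e \<le> g y}"
        by (rule at_within_nhd[OF 2]) auto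
      ultimately show ?thesis by simp
    qed
  qed
  have e2: "(F1 has_derivative F1' y) (at y)" if y: "y \<bullet> e < g y" for y
  proof (cases "y \<in> ball x r")
    case True
    hence yo: "y \<in> \<Omega>" using chart_mem y by blast
    have o: "open (\<Omega> \<inter> ball x r)" using op by blast
    have "(F1 has_derivative F' y) (at y)"
      by (rule has_derivative_transform_within_open[OF deriv[OF yo] o]) (use yo True cl in \<open>auto simp: F1_def\<close>)
    thus ?thesis using yo True by (simp add: F1'_def)
  next
    case False
    hence "dist x y > \<rho>" using cover by blast
    with has_derivative_transform_within_open[OF has_derivative_const out, of y 0 F1]
    have "(F1 has_derivative (\<lambda>v. 0)) (at y)" using F1_out by simp
    thus ?thesis using False by (simp add: F1'_def)
  qed
  have e3: "continuous_on {y. y \<bullet> e < g y} (\<lambda>y. F1' y b)" if b: "b \<in> Basis" for b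
  proof -
    have oU: "open {y. y \<bullet> e < g y}" using chart_cont by (intro open_Collect_less continuous_intros)
    have "isCont (\<lambda>y. F1' y b) y" if y: "y \<bullet> e < g y" for y
    proof (cases "y \<in> ball x r")
      case True
      hence yo: "y \<in> \<Omega>" using chart_mem y by blast
      have c: "isCont (\<lambda>y. F' y b) y" using cont'[OF b] op yo continuous_on_eq_continuous_at by blast
      have "eventually (\<lambda>z. F1' z b = F' z b) (nhds y)"
        using eventually_nhds_in_open[OF open_Int[OF op open_ball], of y x r] yo True
        by (auto simp: F1'_def elim!: eventually_mono)
      from isCont_cong[OF this] c show ?thesis by simp
    next
      case False
      hence d: "dist x y > \<rho>" using cover by blast
      have "eventually (\<lambda>z. F1' z b = 0) (nhds y)"
        using eventually_nhds_in_open[OF out, of y] d F'0 by (auto simp: F1'_def elim!: eventually_mono)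
      from isCont_cong[OF this] show ?thesis by simp
    qed
    thus ?thesis using continuous_on_eq_continuous_at[OF oU] by auto
  qed
  have e4: "\<bar>\<Sum>b\<in>Basis. F1' y b \<bullet> b\<bar> \<le> \<bar>B\<bar>" for y
    using div[of y] by (auto simp: F1'_def)
  have e5: "F1 y = 0" if "norm y > norm x + r" for y
  proof (rule F1_out)
    show "dist x y > \<rho>" using that \<rho> norm_triangle_ineq2[of y x] by (simp add: dist_norm norm_minus_commute)
  qed
  note A = chart_e(1) chart_inv C chart_diff e5 e1 e2 e3 e4
  have Gauss: "(\<integral>y. indicator {y. y \<bullet> e < g y} y * (\<Sum>b\<in>Basis. F1' y b \<bullet> b) \<partial>lborel) =
      (\<integral>y. indicator (cylinder e) y * (F1 (graph_point e g y) \<bullet> (e - gradient g y)) \<partial>lborel)"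
    by (rule integral_subgraph_divergence[OF A])
  have flux: "integrable lborel (\<lambda>y. indicator (cylinder e) y * (F1 (graph_point e g y) \<bullet> (e - gradient g y)))"
    by (rule graph_flux_integrable[OF A])
  have lhs: "indicator {y. y \<bullet> e < g y} y * (\<Sum>b\<in>Basis. F1' y b \<bullet> b) = indicator \<Omega> y *\<^sub>R (\<Sum>b\<in>Basis. F' y b \<bullet> b)" for y
    using chart_mem[of y] F'0[of y] cover[of y] by (auto simp: F1'_def split: split_indicator)
  \<comment> \<open>The Borel version of the flux density, with the normal taken from the chart; on
    the boundary it agrees almost everywhere with the one given by
    \<open>outward_normal\<close>.\<close>
  define f where "f y = (if y \<in> frontier \<Omega> then F1 y else 0) \<bullet> chart_normal e g y" for y
  have fm [measurable]: "f \<in> borel_measurable borel"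
  proof -
    have "(\<lambda>y. if y \<in> frontier \<Omega> then (if y \<in> ball x r then F y else 0) else 0) \<in> borel_measurable borel"
    proof -
      have [measurable]: "(\<lambda>y. if y \<in> frontier \<Omega> then F y else 0) \<in> borel_measurable borel"
        by (rule borel_measurable_continuous_on_if)
          (auto intro!: borel_closed continuous_on_subset[OF cont] simp: frontier_def)
      have [measurable]: "ball x r \<in> sets borel" by simp
      have "(\<lambda>y. if y \<in> ball x r then (if y \<in> frontier \<Omega> then F y else 0) else 0) \<in> borel_measurable borel"
        by measurable
      thus ?thesis by (rule back_subst[of "\<lambda>f. f \<in> borel_measurable borel"]) auto
    qed
    also have "(\<lambda>y. if y \<in> frontier \<Omega> then (if y \<in> ball x r then F y else 0) else 0) = (\<lambda>y. if y \<in> frontier \<Omega> then F1 y else 0)"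
      by (auto simp: F1_def frontier_def)
    finally show ?thesis unfolding f_def by measurable
  qed
  have fsupp: "f y = 0" if "y \<notin> ball x r" for y using that by (simp add: f_def F1_def)
  have fgp: "f (graph_point e g y) * surface_density g y = F1 (graph_point e g y) \<bullet> (e - gradient g y)" for y
  proof (cases "graph_point e g y \<in> ball x r")
    case True
    have "surface_density g (graph_point e g y) = surface_density g y" by (simp add: surface_density_def graph_point_on_graph)
    thus ?thesis using graph_point_frontier[OF True] surface_density_ge_1[of g y]
      by (simp add: f_def chart_normal_def graph_point_on_graph)
  qed (simp add: f_def F1_def)
  have int_f: "integrable \<beta> (\<lambda>y. indicator (frontier \<Omega>) y * f y)"
    using flux chart_integral(1)[of f, OF fm] fsupp by (simp add: fgp)
  have eq_f: "(\<integral>y. indicator (frontier \<Omega>) y * f y \<partial>\<beta>) = (\<integral>y. indicator (cylinder e) y * (F1 (graph_point e g y) \<bullet> (e - gradient g y)) \<partial>lborel)"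
    using chart_integral(2)[of f, OF fm] fsupp by (simp add: fgp)
  have fb [measurable]: "(\<lambda>y. indicator (frontier \<Omega>) y * f y) \<in> borel_measurable \<beta>"
    using int_f by (rule borel_measurable_integrable)
  have AEf: "AE y in \<beta>. indicator (frontier \<Omega>) y *\<^sub>R (F y \<bullet> outward_normal \<Omega> y) = indicator (frontier \<Omega>) y * f y"
    using chart_AE_normal
  proof eventually_elim
    fix y assume n: "y \<in> ball x r \<inter> frontier \<Omega> \<longrightarrow> outward_normal \<Omega> y = chart_normal e g y"
    show "indicator (frontier \<Omega>) y *\<^sub>R (F y \<bullet> outward_normal \<Omega> y) = indicator (frontier \<Omega>) y * f y"
    proof (cases "y \<in> frontier \<Omega>")
      case True
      hence "y \<in> closure \<Omega>" by (simp add: frontier_def)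
      thus ?thesis using True n supp[of y] cover[of y] by (auto simp: f_def F1_def)
    qed simp
  qed
  have m: "(\<lambda>y. indicator (frontier \<Omega>) y *\<^sub>R (F y \<bullet> outward_normal \<Omega> y)) \<in> borel_measurable \<sigma>"
    unfolding \<beta>(2) by (rule borel_measurable_completion_AE[OF fb AEf])
  have AE\<sigma>: "AE y in \<sigma>. indicator (frontier \<Omega>) y * f y = indicator (frontier \<Omega>) y *\<^sub>R (F y \<bullet> outward_normal \<Omega> y)"
    unfolding \<beta>(2) using AE_completion[OF AEf] by eventually_elim (rule sym)
  have int_f\<sigma>: "integrable \<sigma> (\<lambda>y. indicator (frontier \<Omega>) y * f y)"
    unfolding \<beta>(2) using int_f by (simp add: integrable_completion)
  show "set_integrable \<sigma> (frontier \<Omega>) (\<lambda>y. F y \<bullet> outward_normal \<Omega> y)"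
    unfolding set_integrable_def by (rule integrable_cong_AE_imp[OF int_f\<sigma> m]) (use AE\<sigma> in \<open>eventually_elim, auto\<close>)
  have "(LINT y:\<Omega>|lborel. (\<Sum>b\<in>Basis. F' y b \<bullet> b)) = (\<integral>y. indicator (frontier \<Omega>) y * f y \<partial>\<beta>)"
    unfolding set_lebesgue_integral_def lhs[symmetric] Gauss eq_f ..
  also have "\<dots> = (\<integral>y. indicator (frontier \<Omega>) y * f y \<partial>\<sigma>)"
    unfolding \<beta>(2) by (simp add: integral_completion)
  also have "\<dots> = (LINT y:frontier \<Omega>|\<sigma>. F y \<bullet> outward_normal \<Omega> y)"
    unfolding set_lebesgue_integral_def
    by (rule integral_cong_AE[OF _ m AE\<sigma>]) (use int_f\<sigma> in \<open>rule borel_measurable_integrable\<close>)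
  finally show "(LINT y:\<Omega>|lborel. (\<Sum>b\<in>Basis. F' y b \<bullet> b)) = (LINT y:frontier \<Omega>|\<sigma>. F y \<bullet> outward_normal \<Omega> y)" .
qed

lemma chart_normal_measurable:
  "(\<lambda>y. indicator (ball x r \<inter> frontier \<Omega>) y *\<^sub>R outward_normal \<Omega> y) \<in> borel_measurable \<sigma>"
  unfolding \<beta>(2)
proof (rule borel_measurable_completion_AE)
  note [measurable] = chart_measurable
  have [measurable]: "ball x r \<inter> frontier \<Omega> \<in> sets borel" by (intro sets.Int borel_closed borel_open) auto
  have "(\<lambda>y. indicator (ball x r \<inter> frontier \<Omega>) y *\<^sub>R chart_normal e g y) \<in> borel_measurable borel"
    by measurable
  thus "(\<lambda>y. indicator (ball x r \<inter> frontier \<Omega>) y *\<^sub>R chart_normal e g y) \<in> borel_measurable \<beta>"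
    by (simp add: measurable_cong_sets[OF \<beta>(1) refl])
  show "AE y in \<beta>. indicator (ball x r \<inter> frontier \<Omega>) y *\<^sub>R outward_normal \<Omega> y =
      indicator (ball x r \<inter> frontier \<Omega>) y *\<^sub>R chart_normal e g y"
    using chart_AE_normal by eventually_elim (auto split: split_indicator)
qed

lemma chart_AE_norm_normal:
  "AE y in \<beta>. y \<in> ball x r \<inter> frontier \<Omega> \<longrightarrow> norm (outward_normal \<Omega> y) = 1"
  using chart_AE_differentiable
proof eventually_elim
  fix y assume "y \<in> ball x r \<inter> frontier \<Omega> \<longrightarrow> g differentiable (at y)"
  thus "y \<in> ball x r \<inter> frontier \<Omega> \<longrightarrow> norm (outward_normal \<Omega> y) = 1"
    using chart_normal_is_outward_normal[of y] outward_normal_eq[of \<Omega> y]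
    by (auto simp: is_outward_normal_def)
qed

end

end

section \<open>The divergence theorem on a Lipschitz domain\<close>

text \<open>Near an interior point a constant \<open>g\<close> above the ball is a chart, so interior and boundary points
  are treated alike.\<close>

lemma lipschitz_chart_exists:
  fixes \<Omega> :: "'a::euclidean_space set"
  assumes \<Omega>: "lipschitz_domain \<Omega>" and x: "x \<in> closure \<Omega>"
  shows "\<exists>r e g. lipschitz_chart \<Omega> x r e g"
proof (cases "x \<in> \<Omega>")
  case True
  have "open \<Omega>" using \<Omega> by (simp add: lipschitz_domain_def)
  then obtain r where r: "r > 0" "ball x r \<subseteq> \<Omega>" using True by (meson openE)
  obtain e :: 'a where e: "e \<in> Basis" using nonempty_Basis by blast
  have "y \<bullet> e < x \<bullet> e + r" if "y \<in> ball x r" for y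
    using Basis_le_norm[OF e, of "y - x"] that by (simp add: dist_norm norm_minus_commute inner_diff_left)
  hence "lipschitz_chart \<Omega> x r e (\<lambda>_. x \<bullet> e + r)"
    using r e by (auto simp: lipschitz_chart_def intro!: exI[of _ 0] lipschitz_onI)
  thus ?thesis by blast
next
  case False
  hence "x \<in> frontier \<Omega>" using x \<Omega> by (simp add: frontier_def lipschitz_domain_def interior_open)
  thus ?thesis using \<Omega> by (simp add: lipschitz_domain_def)
qed

section \<open>Cutoff functions and bounds on compact sets\<close>

lemma set_integrable_bounded_continuous:
  fixes f :: "'a::euclidean_space \<Rightarrow> real"
  assumes A: "A \<in> sets borel" "bounded A" and f: "continuous_on A f" "\<And>x. x \<in> A \<Longrightarrow> \<bar>f x\<bar> \<le> B"
  shows "set_integrable lborel A f"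
proof -
  obtain R where R: "\<And>x. x \<in> A \<Longrightarrow> norm x \<le> R" using A(2) bounded_iff by blast
  show ?thesis unfolding set_integrable_def real_scaleR_def
  proof (rule integrable_bounded_support[where B = "\<bar>B\<bar>" and R = R])
    show "(\<lambda>x. indicator A x * f x) \<in> borel_measurable borel"
      using borel_measurable_continuous_on_indicator[OF A(1) f(1)] by simp
    show "\<bar>indicator A y * f y\<bar> \<le> \<bar>B\<bar>" for y using f(2)[of y] by (auto split: split_indicator)
    show "indicator A y * f y = 0" if "R < norm y" for y using R[of y] that by (auto split: split_indicator)
  qed
qed

text \<open>Squaring the positive part makes it continuously differentiable across the sphere of
  radius \<open>\<rho>\<close>, which is the smoothness that the divergence theorem asks of a
  cutoff.\<close>

definition bump :: "real \<Rightarrow> 'a::euclidean_space \<Rightarrow> 'a \<Rightarrow> real" where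
  "bump \<rho> x y = (max 0 (\<rho>\<^sup>2 - (y - x) \<bullet> (y - x)))\<^sup>2"

definition bump_deriv :: "real \<Rightarrow> 'a::euclidean_space \<Rightarrow> 'a \<Rightarrow> 'a \<Rightarrow> real" where
  "bump_deriv \<rho> x y v = 2 * max 0 (\<rho>\<^sup>2 - (y - x) \<bullet> (y - x)) * (- 2 * ((y - x) \<bullet> v))"

lemma has_field_derivative_max_square:
  "((\<lambda>t. (max 0 t)\<^sup>2) has_field_derivative 2 * max 0 t) (at (t::real))"
proof -
  consider "t > 0" | "t < 0" | "t = 0" by linarith
  thus ?thesis
  proof cases
    case 1
    have "((\<lambda>t. t\<^sup>2) has_field_derivative 2 * max 0 t) (at t)"
      using 1 by (auto intro!: derivative_eq_intros)
    thus ?thesis by (rule has_field_derivative_transform_within_open[of _ _ _ "{0<..}"]) (use 1 in auto)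
  next
    case 2
    have "((\<lambda>t. 0) has_field_derivative 2 * max 0 t) (at t)"
      using 2 by (auto intro!: derivative_eq_intros)
    thus ?thesis by (rule has_field_derivative_transform_within_open[of _ _ _ "{..<0}"]) (use 2 in auto)
  next
    case 3
    have "((\<lambda>h::real. max 0 h) \<longlongrightarrow> max 0 0) (at 0)" by (intro tendsto_intros)
    moreover have "eventually (\<lambda>h::real. max 0 h = (max 0 h)\<^sup>2 / h) (at 0)"
      by (auto simp: eventually_at_filter max_def power2_eq_square)
    ultimately have "((\<lambda>h::real. (max 0 h)\<^sup>2 / h) \<longlongrightarrow> max 0 0) (at 0)"
      by (rule Lim_transform_eventually)
    thus ?thesis by (simp add: 3 has_field_derivative_iff)
  qed
qed

lemma bump_has_derivative: "(bump \<rho> x has_derivative bump_deriv \<rho> x y) (at y)"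
proof -
  have "((\<lambda>y. \<rho>\<^sup>2 - (y - x) \<bullet> (y - x)) has_derivative (\<lambda>v. - 2 * ((y - x) \<bullet> v))) (at y)"
    by (auto intro!: derivative_eq_intros simp: inner_commute)
  from has_derivative_compose[OF this has_field_derivative_max_square[unfolded has_field_derivative_def]]
  show ?thesis by (simp add: bump_def[abs_def] bump_deriv_def[abs_def])
qed

lemma bump_continuous: "continuous_on S (bump \<rho> x)" "continuous_on S (\<lambda>y. bump_deriv \<rho> x y v)"
  unfolding bump_def bump_deriv_def by (intro continuous_intros)+

lemma bump_nonneg: "bump \<rho> x y \<ge> 0" by (simp add: bump_def)

lemma bump_pos: "y \<in> ball x \<rho> \<Longrightarrow> bump \<rho> x y > 0"
proof -
  assume y: "y \<in> ball x \<rho>"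
  hence "norm (y - x) < \<rho>" by (simp add: dist_norm norm_minus_commute)
  hence "(norm (y - x))\<^sup>2 < \<rho>\<^sup>2" by (intro power_strict_mono) auto
  thus ?thesis by (simp add: bump_def power2_norm_eq_inner)
qed

lemma bump_zero: "dist x y > \<rho> \<Longrightarrow> \<rho> > 0 \<Longrightarrow> bump \<rho> x y = 0"
proof -
  assume y: "dist x y > \<rho>" and "\<rho> > 0"
  hence "\<rho>\<^sup>2 < (norm (y - x))\<^sup>2" by (intro power_strict_mono) (auto simp: dist_norm norm_minus_commute)
  thus ?thesis by (simp add: bump_def power2_norm_eq_inner)
qed

lemma continuous_on_compact_bound:
  fixes f :: "'a::metric_space \<Rightarrow> 'b::real_normed_vector"
  assumes "compact K" "continuous_on K f"
  obtains B where "B > 0" "\<And>x. x \<in> K \<Longrightarrow> norm (f x) \<le> B"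
proof -
  have "bounded (f ` K)" using assms by (intro compact_imp_bounded compact_continuous_image)
  then obtain B where "B > 0" "\<forall>z\<in>f ` K. norm z \<le> B" unfolding bounded_pos by blast
  thus ?thesis using that by blast
qed

section \<open>Finite chart covers and the global theorem\<close>

context
  fixes \<Omega> :: "'a::euclidean_space set" and \<sigma> :: "'a measure"
  assumes dom: "lipschitz_domain \<Omega>" and surf: "surface_measure \<Omega> \<sigma>"
begin

lemma domain_simps: "open \<Omega>" "bounded \<Omega>" "compact (closure \<Omega>)" "compact (frontier \<Omega>)" "frontier \<Omega> \<subseteq> closure \<Omega>" "\<Omega> \<subseteq> closure \<Omega>"
proof -
  show "open \<Omega>" "bounded \<Omega>" using dom by (auto simp: lipschitz_domain_def)
  thus "compact (closure \<Omega>)" "compact (frontier \<Omega>)"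
    by (auto simp: compact_closure compact_frontier_bounded)
qed (auto simp: frontier_def closure_subset)

lemma surface_completion: obtains \<beta> where "sets \<beta> = sets borel" "\<sigma> = completion \<beta>"
  using surf by (auto simp: surface_measure_def)

lemma surface_sets: "A \<in> sets borel \<Longrightarrow> A \<in> sets \<sigma>"
  using surface_completion by (metis sets_completionI_sets)

text \<open>The half radii leave a gap between the supports of the cutoffs and the chart balls, as
  \<open>chart_divergence\<close> demands by \<open>\<rho> < r\<close>.\<close>

lemma chart_cover:
  obtains I :: "'a set" and r :: "'a \<Rightarrow> real" and e g where "finite I" "closure \<Omega> \<subseteq> (\<Union>x\<in>I. ball x (r x / 2))"
    "\<And>x. x \<in> I \<Longrightarrow> lipschitz_chart \<Omega> x (r x) (e x) (g x)" "\<And>x. x \<in> I \<Longrightarrow> r x > 0"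
proof -
  have "\<exists>r e g. \<forall>x\<in>closure \<Omega>. lipschitz_chart \<Omega> x (r x) (e x) (g x)"
    using lipschitz_chart_exists[OF dom] by metis
  then obtain r e g where ch: "\<And>x. x \<in> closure \<Omega> \<Longrightarrow> lipschitz_chart \<Omega> x (r x) (e x) (g x)" by blast
  have rp: "r x > 0" if "x \<in> closure \<Omega>" for x using ch[OF that] by (simp add: lipschitz_chart_def)
  have "closure \<Omega> \<subseteq> (\<Union>x\<in>closure \<Omega>. ball x (r x / 2))" using rp by force
  then obtain I where "I \<subseteq> closure \<Omega>" "finite I" "closure \<Omega> \<subseteq> (\<Union>x\<in>I. ball x (r x / 2))"
    using compactE_image[OF domain_simps(3), of "closure \<Omega>" "\<lambda>x. ball x (r x / 2)"] by (metis open_ball)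
  thus ?thesis using that[of I r e g] ch rp by blast
qed

lemma frontier_in_charts:
  assumes "closure \<Omega> \<subseteq> (\<Union>x\<in>I. ball x (r x / 2))" and "\<And>x. x \<in> I \<Longrightarrow> r x > (0::real)"
  shows "frontier \<Omega> = (\<Union>x\<in>I. ball x (r x) \<inter> frontier \<Omega>)"
proof -
  have "y \<in> (\<Union>x\<in>I. ball x (r x))" if y: "y \<in> frontier \<Omega>" for y
  proof -
    obtain x where "x \<in> I" "dist x y < r x / 2" using assms(1) y domain_simps(5) by fastforce
    thus ?thesis using assms(2)[of x] by (auto intro!: bexI[of _ x])
  qed
  thus ?thesis by blast
qed

text \<open>Finiteness is what makes bounded traces and tractions square integrable over the
  interface.\<close>

lemma frontier_finite: "emeasure \<sigma> (frontier \<Omega>) < \<infinity>"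
proof -
  obtain \<beta> where \<beta>: "sets \<beta> = sets borel" "\<sigma> = completion \<beta>" by (rule surface_completion)
  obtain I r e g where I: "finite I" "closure \<Omega> \<subseteq> (\<Union>x\<in>I. ball x (r x / 2))"
    "\<And>x. x \<in> I \<Longrightarrow> lipschitz_chart \<Omega> x (r x) (e x) (g x)" "\<And>x. x \<in> I \<Longrightarrow> r x > 0"
    by (rule chart_cover) blast
  have fr: "frontier \<Omega> = (\<Union>x\<in>I. ball x (r x) \<inter> frontier \<Omega>)" by (rule frontier_in_charts[OF I(2,4)])
  have "emeasure \<beta> (\<Union>x\<in>I. ball x (r x) \<inter> frontier \<Omega>) \<le> (\<Sum>x\<in>I. emeasure \<beta> (ball x (r x) \<inter> frontier \<Omega>))"
  proof (rule emeasure_subadditive_finite[OF I(1)])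
    show "(\<lambda>x. ball x (r x) \<inter> frontier \<Omega>) ` I \<subseteq> sets \<beta>"
      unfolding \<beta>(1) by (intro image_subsetI sets.Int borel_open borel_closed open_ball frontier_closed)
  qed
  also have "\<dots> < \<infinity>"
  proof -
    have "emeasure \<beta> (ball x (r x) \<inter> frontier \<Omega>) < top" if "x \<in> I" for x
      using chart_finite[OF domain_simps(1) I(3)[OF that] surf \<beta>] by simp
    thus ?thesis using I(1) by (simp del: less_top add: infinity_ennreal_def)
  qed
  finally have "emeasure \<beta> (frontier \<Omega>) < \<infinity>" using fr by simp
  moreover have "frontier \<Omega> \<in> sets \<beta>" using \<beta>(1) by (auto intro!: borel_closed)
  ultimately show ?thesis by (simp add: \<beta>(2))
qed

lemma outward_normal_measurable: "(\<lambda>y. indicator (frontier \<Omega>) y *\<^sub>R outward_normal \<Omega> y) \<in> borel_measurable \<sigma>"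
proof -
  obtain \<beta> where \<beta>: "sets \<beta> = sets borel" "\<sigma> = completion \<beta>" by (rule surface_completion)
  obtain I r e g where I: "finite I" "closure \<Omega> \<subseteq> (\<Union>x\<in>I. ball x (r x / 2))"
    "\<And>x. x \<in> I \<Longrightarrow> lipschitz_chart \<Omega> x (r x) (e x) (g x)" "\<And>x. x \<in> I \<Longrightarrow> r x > 0"
    by (rule chart_cover) blast
  have fr: "frontier \<Omega> = (\<Union>x\<in>I. ball x (r x) \<inter> frontier \<Omega>)" by (rule frontier_in_charts[OF I(2,4)])
  have "(\<lambda>y. indicator (\<Union>x\<in>J. ball x (r x) \<inter> frontier \<Omega>) y *\<^sub>R outward_normal \<Omega> y) \<in> borel_measurable \<sigma>"
    if "finite J" "J \<subseteq> I" for J using that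
  proof (induction J rule: finite_induct)
    case (insert x J)
    let ?A = "ball x (r x) \<inter> frontier \<Omega>" and ?B = "\<Union>x\<in>J. ball x (r x) \<inter> frontier \<Omega>"
    have [measurable]: "?A \<in> sets \<sigma>" by (intro surface_sets sets.Int borel_open borel_closed) auto
    have [measurable]: "(\<lambda>y. indicator ?A y *\<^sub>R outward_normal \<Omega> y) \<in> borel_measurable \<sigma>"
      using insert.prems by (intro chart_normal_measurable[OF domain_simps(1) I(3) surf \<beta>]) auto
    have [measurable]: "(\<lambda>y. indicator ?B y *\<^sub>R outward_normal \<Omega> y) \<in> borel_measurable \<sigma>"
      using insert.IH insert.prems by blast
    \<comment> \<open>The factor \<open>1 - indicator ?A y\<close> makes the overlap of the charts
      count once.\<close>
    have "(\<lambda>y. indicator ?A y *\<^sub>R outward_normal \<Omega> y + (1 - indicator ?A y :: real) *\<^sub>R (indicator ?B y *\<^sub>R outward_normal \<Omega> y)) \<in> borel_measurable \<sigma>"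
      by measurable
    also have "(\<lambda>y. indicator ?A y *\<^sub>R outward_normal \<Omega> y + (1 - indicator ?A y :: real) *\<^sub>R (indicator ?B y *\<^sub>R outward_normal \<Omega> y)) =
      (\<lambda>y. indicator (\<Union>x\<in>insert x J. ball x (r x) \<inter> frontier \<Omega>) y *\<^sub>R outward_normal \<Omega> y)"
      by (rule ext) (auto split: split_indicator)
    finally show ?case .
  qed simp
  from this[OF I(1) order_refl] show ?thesis unfolding fr[symmetric] .
qed

lemma outward_normal_AE_unit: "AE y in \<sigma>. y \<in> frontier \<Omega> \<longrightarrow> norm (outward_normal \<Omega> y) = 1"
proof -
  obtain \<beta> where \<beta>: "sets \<beta> = sets borel" "\<sigma> = completion \<beta>" by (rule surface_completion)
  obtain I r e g where I: "finite I" "closure \<Omega> \<subseteq> (\<Union>x\<in>I. ball x (r x / 2))"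
    "\<And>x. x \<in> I \<Longrightarrow> lipschitz_chart \<Omega> x (r x) (e x) (g x)" "\<And>x. x \<in> I \<Longrightarrow> r x > 0"
    by (rule chart_cover) blast
  have fr: "frontier \<Omega> = (\<Union>x\<in>I. ball x (r x) \<inter> frontier \<Omega>)" by (rule frontier_in_charts[OF I(2,4)])
  have "AE y in \<beta>. \<forall>x\<in>I. y \<in> ball x (r x) \<inter> frontier \<Omega> \<longrightarrow> norm (outward_normal \<Omega> y) = 1"
    using chart_AE_norm_normal[OF domain_simps(1) I(3) surf \<beta>] by (intro AE_finite_allI I(1)) auto
  hence "AE y in \<beta>. y \<in> frontier \<Omega> \<longrightarrow> norm (outward_normal \<Omega> y) = 1"
    by eventually_elim (use fr in blast)
  thus ?thesis unfolding \<beta>(2) by (rule AE_completion)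
qed

text \<open>The weights \<open>a x\<close> normalise the cutoffs, whose sum is positive on the
  closure. The divergence of each localised field is \<open>a x\<close> times the old one plus a
  term continuous on the closure, so its boundedness is inherited even where the separate
  derivatives of \<open>F\<close> are unbounded.\<close>

theorem divergence_theorem:
  fixes F :: "'a \<Rightarrow> 'a" and F' :: "'a \<Rightarrow> 'a \<Rightarrow> 'a"
  assumes cont: "continuous_on (closure \<Omega>) F"
    and deriv: "\<And>y. y \<in> \<Omega> \<Longrightarrow> (F has_derivative F' y) (at y)"
    and cont': "\<And>b. b \<in> Basis \<Longrightarrow> continuous_on \<Omega> (\<lambda>y. F' y b)"
    and div: "\<And>y. y \<in> \<Omega> \<Longrightarrow> \<bar>\<Sum>b\<in>Basis. F' y b \<bullet> b\<bar> \<le> B"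
  shows "set_integrable \<sigma> (frontier \<Omega>) (\<lambda>y. F y \<bullet> outward_normal \<Omega> y)"
    and "(LINT y:\<Omega>|lborel. (\<Sum>b\<in>Basis. F' y b \<bullet> b)) = (LINT y:frontier \<Omega>|\<sigma>. F y \<bullet> outward_normal \<Omega> y)"
proof -
  obtain \<beta> where \<beta>: "sets \<beta> = sets borel" "\<sigma> = completion \<beta>" by (rule surface_completion)
  obtain I r e g where I: "finite I" "closure \<Omega> \<subseteq> (\<Union>x\<in>I. ball x (r x / 2))"
    "\<And>x. x \<in> I \<Longrightarrow> lipschitz_chart \<Omega> x (r x) (e x) (g x)" "\<And>x. x \<in> I \<Longrightarrow> r x > 0"
    by (rule chart_cover) blast
  define \<psi> where "\<psi> x = bump (r x / 2) x" for x
  define \<psi>' where "\<psi>' x = bump_deriv (r x / 2) x" for x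
  define \<Psi> where "\<Psi> y = (\<Sum>x\<in>I. \<psi> x y)" for y
  define \<Psi>' where "\<Psi>' y v = (\<Sum>x\<in>I. \<psi>' x y v)" for y v
  have \<psi>D: "(\<psi> x has_derivative \<psi>' x y) (at y)" for x y
    unfolding \<psi>_def \<psi>'_def by (rule bump_has_derivative)
  have \<psi>C: "continuous_on S (\<psi> x)" "continuous_on S (\<lambda>y. \<psi>' x y v)" for S x v
    unfolding \<psi>_def \<psi>'_def by (rule bump_continuous)+
  have \<Psi>D: "(\<Psi> has_derivative \<Psi>' y) (at y)" for y
    unfolding \<Psi>_def[abs_def] \<Psi>'_def[abs_def] by (intro has_derivative_sum \<psi>D)
  have \<Psi>C: "continuous_on S \<Psi>" "continuous_on S (\<lambda>y. \<Psi>' y v)" for S v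
    unfolding \<Psi>_def[abs_def] \<Psi>'_def by (intro continuous_intros \<psi>C)+
  have \<Psi>pos: "\<Psi> y > 0" if "y \<in> closure \<Omega>" for y
  proof -
    from that have "y \<in> (\<Union>x\<in>I. ball x (r x / 2))" using I(2) by (rule rev_subsetD)
    then obtain x where x: "x \<in> I" "y \<in> ball x (r x / 2)" by blast
    have "0 < \<psi> x y" unfolding \<psi>_def by (rule bump_pos[OF x(2)])
    also have "\<psi> x y \<le> \<Psi> y" unfolding \<Psi>_def
      by (rule member_le_sum[OF x(1)]) (auto simp: \<psi>_def bump_nonneg I(1))
    finally show ?thesis .
  qed
  define a where "a x y = \<psi> x y / \<Psi> y" for x y
  define a' where "a' x y v = (\<psi>' x y v * \<Psi> y - \<psi> x y * \<Psi>' y v) / (\<Psi> y * \<Psi> y)" for x y v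
  have aD: "(a x has_derivative a' x y) (at y)" if "y \<in> \<Omega>" for x y
    unfolding a_def[abs_def] a'_def[abs_def]
    using that domain_simps(6) by (intro has_derivative_divide'[OF \<psi>D \<Psi>D]) (force dest: \<Psi>pos)
  have aC: "continuous_on (closure \<Omega>) (a x)" "continuous_on (closure \<Omega>) (\<lambda>y. a' x y v)" for x v
    unfolding a_def[abs_def] a'_def by (intro continuous_intros \<psi>C \<Psi>C, force dest: \<Psi>pos)+
  have a_sum: "(\<Sum>x\<in>I. a x y) = 1" if "y \<in> closure \<Omega>" for y
    using \<Psi>pos[OF that] by (simp add: a_def sum_divide_distrib[symmetric] \<Psi>_def)
  define Fi where "Fi x y = a x y *\<^sub>R F y" for x y
  define Fi' where "Fi' x y v = a x y *\<^sub>R F' y v + a' x y v *\<^sub>R F y" for x y v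
  have FiD: "(Fi x has_derivative Fi' x y) (at y)" if "y \<in> \<Omega>" for x y
    unfolding Fi_def[abs_def] Fi'_def[abs_def] by (intro has_derivative_scaleR aD deriv that)
  have FiC: "continuous_on (closure \<Omega>) (Fi x)" for x
    unfolding Fi_def[abs_def] by (intro continuous_intros aC cont)
  have FiC': "continuous_on \<Omega> (\<lambda>y. Fi' x y b)" if "b \<in> Basis" for x b
    unfolding Fi'_def
    by (intro continuous_intros cont' that continuous_on_subset[OF aC(1) domain_simps(6)]
      continuous_on_subset[OF aC(2) domain_simps(6)] continuous_on_subset[OF cont domain_simps(6)])
  have div_Fi: "(\<Sum>b\<in>Basis. Fi' x y b \<bullet> b) = a x y * (\<Sum>b\<in>Basis. F' y b \<bullet> b) + (\<Sum>b\<in>Basis. a' x y b * (F y \<bullet> b))" for x y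
    by (simp add: Fi'_def inner_add_left sum.distrib sum_distrib_left)
  have bdd: "\<exists>B'. \<forall>y\<in>\<Omega>. \<bar>\<Sum>b\<in>Basis. Fi' x y b \<bullet> b\<bar> \<le> B'" for x
  proof -
    obtain B1 where B1: "B1 > 0" "\<And>y. y \<in> closure \<Omega> \<Longrightarrow> norm (a x y) \<le> B1"
      using continuous_on_compact_bound[OF domain_simps(3) aC(1)] by blast
    have "continuous_on (closure \<Omega>) (\<lambda>y. \<Sum>b\<in>Basis. a' x y b * (F y \<bullet> b))"
      by (intro continuous_intros aC cont)
    then obtain B2 where B2: "B2 > 0" "\<And>y. y \<in> closure \<Omega> \<Longrightarrow> norm (\<Sum>b\<in>Basis. a' x y b * (F y \<bullet> b)) \<le> B2"
      using continuous_on_compact_bound[OF domain_simps(3)] by blast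
    show ?thesis
    proof (intro exI ballI)
      fix y assume y: "y \<in> \<Omega>"
      hence yc: "y \<in> closure \<Omega>" using domain_simps(6) by blast
      have "\<bar>a x y * (\<Sum>b\<in>Basis. F' y b \<bullet> b)\<bar> \<le> B1 * B"
        using B1(1) B1(2)[OF yc] div[OF y] unfolding abs_mult by (intro mult_mono) auto
      thus "\<bar>\<Sum>b\<in>Basis. Fi' x y b \<bullet> b\<bar> \<le> B1 * B + B2"
        unfolding div_Fi using B2(2)[OF yc] by simp
    qed
  qed
  then obtain B' where B': "\<And>x y. y \<in> \<Omega> \<Longrightarrow> \<bar>\<Sum>b\<in>Basis. Fi' x y b \<bullet> b\<bar> \<le> B' x" by metis
  have supp: "Fi x y = 0" if "x \<in> I" "dist x y > r x / 2" for x y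
    using bump_zero[OF that(2)] I(4)[OF that(1)] by (simp add: Fi_def a_def \<psi>_def)
  have half: "r x / 2 < r x" if "x \<in> I" for x using I(4)[OF that] by simp
  note ch = chart_divergence[OF domain_simps(1) I(3) surf \<beta> half supp FiC FiD FiC' B']
  have int_b: "set_integrable \<sigma> (frontier \<Omega>) (\<lambda>y. Fi x y \<bullet> outward_normal \<Omega> y)" if "x \<in> I" for x
    by (rule ch(1)) (use that in auto)
  have eq: "(LINT y:\<Omega>|lborel. (\<Sum>b\<in>Basis. Fi' x y b \<bullet> b)) = (LINT y:frontier \<Omega>|\<sigma>. Fi x y \<bullet> outward_normal \<Omega> y)" if "x \<in> I" for x
    by (rule ch(2)) (use that in auto)
  have int_i: "set_integrable lborel \<Omega> (\<lambda>y. \<Sum>b\<in>Basis. Fi' x y b \<bullet> b)" for x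
    by (rule set_integrable_bounded_continuous[OF _ domain_simps(2) _ B'])
      (auto intro!: borel_open domain_simps continuous_intros FiC')
  have Fi_sum: "(\<Sum>x\<in>I. Fi x y) = F y" if "y \<in> closure \<Omega>" for y
    using a_sum[OF that] by (simp add: Fi_def scaleR_left.sum[symmetric])
  \<comment> \<open>Uniqueness of the derivative identifies the sum, so the derivatives of the
    weights cancel without being computed.\<close>
  have Fi'_sum: "(\<Sum>x\<in>I. Fi' x y v) = F' y v" if y: "y \<in> \<Omega>" for y v
  proof -
    have "((\<lambda>y. \<Sum>x\<in>I. Fi x y) has_derivative (\<lambda>v. \<Sum>x\<in>I. Fi' x y v)) (at y)"
      by (intro has_derivative_sum FiD y)
    hence "(F has_derivative (\<lambda>v. \<Sum>x\<in>I. Fi' x y v)) (at y)"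
      by (rule has_derivative_transform_within_open[OF _ domain_simps(1) y]) (use Fi_sum domain_simps(6) in auto)
    from has_derivative_unique[OF this deriv[OF y]] show ?thesis by metis
  qed
  have bsum: "F y \<bullet> outward_normal \<Omega> y = (\<Sum>x\<in>I. Fi x y \<bullet> outward_normal \<Omega> y)" if "y \<in> frontier \<Omega>" for y
    using Fi_sum[of y] that domain_simps(5) by (auto simp: inner_sum_left[symmetric])
  have bsum': "indicator (frontier \<Omega>) y *\<^sub>R (F y \<bullet> outward_normal \<Omega> y) =
      (\<Sum>x\<in>I. indicator (frontier \<Omega>) y *\<^sub>R (Fi x y \<bullet> outward_normal \<Omega> y))" for y
    using bsum[of y] by (auto split: split_indicator)
  have isum': "indicator \<Omega> y *\<^sub>R (\<Sum>b\<in>Basis. F' y b \<bullet> b) = (\<Sum>x\<in>I. indicator \<Omega> y *\<^sub>R (\<Sum>b\<in>Basis. Fi' x y b \<bullet> b))" for y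
    using Fi'_sum[of y] sum.swap[of "\<lambda>x b. Fi' x y b \<bullet> b" Basis I]
    by (auto simp: inner_sum_left[symmetric] split: split_indicator)
  show "set_integrable \<sigma> (frontier \<Omega>) (\<lambda>y. F y \<bullet> outward_normal \<Omega> y)"
    unfolding set_integrable_def bsum' using int_b
    by (intro Bochner_Integration.integrable_sum) (auto simp: set_integrable_def)
  have "(LINT y:\<Omega>|lborel. (\<Sum>b\<in>Basis. F' y b \<bullet> b)) = (\<Sum>x\<in>I. LINT y:\<Omega>|lborel. (\<Sum>b\<in>Basis. Fi' x y b \<bullet> b))"
    unfolding set_lebesgue_integral_def isum' using int_i
    by (intro Bochner_Integration.integral_sum) (auto simp: set_integrable_def)
  also have "\<dots> = (\<Sum>x\<in>I. LINT y:frontier \<Omega>|\<sigma>. Fi x y \<bullet> outward_normal \<Omega> y)"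
    by (intro sum.cong refl eq)
  also have "\<dots> = (LINT y:frontier \<Omega>|\<sigma>. F y \<bullet> outward_normal \<Omega> y)"
    unfolding set_lebesgue_integral_def bsum' using int_b
    by (intro Bochner_Integration.integral_sum[symmetric]) (auto simp: set_integrable_def)
  finally show "(LINT y:\<Omega>|lborel. (\<Sum>b\<in>Basis. F' y b \<bullet> b)) = (LINT y:frontier \<Omega>|\<sigma>. F y \<bullet> outward_normal \<Omega> y)" .
qed

end

section \<open>Green's identity and integration in time\<close>

lemma sum_Basis_vec:
  fixes f :: "real^'n \<Rightarrow> 'b::comm_monoid_add"
  shows "(\<Sum>b\<in>Basis. f b) = (\<Sum>j\<in>UNIV. f (axis j 1))"
proof -
  have 1: "(Basis :: (real^'n) set) = range (\<lambda>j. axis j 1)" by (auto simp: Basis_vec_def)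
  have 2: "inj (\<lambda>j::'n. axis j (1::real))" by (auto simp: inj_on_def axis_eq_axis)
  show ?thesis unfolding 1 sum.reindex[OF 2] by (simp add: o_def)
qed

lemma inner_transpose: "transpose A \<bullet> transpose B = A \<bullet> (B :: real^'n^'n)"
  unfolding inner_vec_def transpose_def by (simp, rule sum.swap)

lemma inner_transpose_left: "transpose A \<bullet> B = A \<bullet> transpose (B :: real^'n^'n)"
  using inner_transpose[of A "transpose B"] by simp

lemma mat_inner: "mat 1 \<bullet> A = trace (A :: real^'n^'n)"
  by (simp add: inner_vec_def mat_def trace_def if_distrib[of "\<lambda>x. x * _"] cong: if_cong)

lemma sym_part_inner:
  fixes A B :: "real^'n^'n"
  shows "((1/2) *\<^sub>R (A + transpose A)) \<bullet> B = ((1/2) *\<^sub>R (A + transpose A)) \<bullet> ((1/2) *\<^sub>R (B + transpose B))"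
  using inner_transpose_left[of A B] inner_transpose[of A B]
  by (simp add: inner_add_left inner_add_right algebra_simps)

lemma linear_transpose: "linear (transpose :: real^'n^'n \<Rightarrow> _)"
  by (rule linearI) (auto simp: transpose_def vec_eq_iff)

lemma linear_trace: "linear (trace :: real^'n^'n \<Rightarrow> real)"
  by (rule linearI) (auto simp: trace_def sum.distrib sum_distrib_left)

lemma bounded_linear_transpose: "bounded_linear (transpose :: real^'n^'n \<Rightarrow> _)"
  using linear_transpose linear_conv_bounded_linear by blast

lemma bounded_linear_trace: "bounded_linear (trace :: real^'n^'n \<Rightarrow> real)"
  using linear_trace linear_conv_bounded_linear by blast

lemma continuous_on_matrix_vector [continuous_intros]:
  fixes A :: "'a::topological_space \<Rightarrow> real^'n^'m"
  assumes "continuous_on S A" "continuous_on S v"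
  shows "continuous_on S (\<lambda>x. A x *v v x)"
  unfolding matrix_vector_mult_def using assms
  by (intro continuous_intros continuous_on_vec_lambda)

lemma norm_matrix_vector_le: "norm (A *v x) \<le> norm A * norm (x :: real^'n)" for A :: "real^'n^'m"
proof -
  have "(norm (A *v x))\<^sup>2 = (\<Sum>i\<in>UNIV. (A $ i \<bullet> x)\<^sup>2)"
    unfolding power2_norm_eq_inner inner_vec_def[of "A *v x"]
    by (simp add: matrix_vector_mul_component power2_eq_square)
  also have "\<dots> \<le> (\<Sum>i\<in>UNIV. (A $ i \<bullet> A $ i) * (x \<bullet> x))"
    by (intro sum_mono) (rule Cauchy_Schwarz_ineq)
  also have "\<dots> = (norm A * norm x)\<^sup>2"
    by (simp add: power_mult_distrib power2_norm_eq_inner inner_vec_def[of A] sum_distrib_right)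
  finally show ?thesis by (rule power2_le_imp_le) simp
qed

lemma grad_has_derivative:
  assumes "open \<Omega>" "x \<in> \<Omega>" "v differentiable (at x within closure \<Omega>)"
  shows "(v has_derivative (\<lambda>h. grad \<Omega> v x *v h)) (at x)"
proof -
  have "x \<in> interior (closure \<Omega>)" using assms by (meson closure_subset in_mono interior_maximal)
  hence at: "at x within closure \<Omega> = at x" by (rule at_within_interior)
  show ?thesis using assms(3) unfolding at grad_def by (simp add: jacobian_works)
qed

lemma at_closure_open: "open \<Omega> \<Longrightarrow> x \<in> \<Omega> \<Longrightarrow> at x within closure \<Omega> = at x"
  by (meson at_within_interior closure_subset in_mono interior_maximal)

text \<open>Initial conditions equate fields only in the open set, while \<open>grad\<close>
  differentiates within the closure; at interior points the two derivatives coincide.\<close>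

lemma grad_cong:
  assumes "open \<Omega>" "x \<in> \<Omega>" "\<And>y. y \<in> \<Omega> \<Longrightarrow> v y = w y"
  shows "grad \<Omega> v x = grad \<Omega> w x"
proof -
  have "(v has_derivative D) (at x) \<longleftrightarrow> (w has_derivative D) (at x)" for D
    using assms has_derivative_transform_within_open[of v D x UNIV \<Omega> w] has_derivative_transform_within_open[of w D x UNIV \<Omega> v]
    by auto
  hence "frechet_derivative v (at x) = frechet_derivative w (at x)" by (simp add: frechet_derivative_def)
  thus ?thesis by (simp add: grad_def jacobian_def at_closure_open[OF assms(1,2)])
qed

text \<open>The divergence theorem for the combination of the rows of \<open>S\<close> with the
  components of \<open>v\<close> as coefficients; taking rows makes its normal component
  \<open>v y \<bullet> (S y *v n)\<close>. The function \<open>q\<close> extends the divergence of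
  \<open>S\<close> continuously to the closure and thereby bounds the divergence of the
  combination.\<close>

lemma green_identity:
  fixes \<Omega> :: "(real^'d) set" and S :: "real^'d \<Rightarrow> real^'d^'d" and v q :: "real^'d \<Rightarrow> real^'d"
  assumes dom: "lipschitz_domain \<Omega>" and surf: "surface_measure \<Omega> \<sigma>"
    and S: "continuous_on (closure \<Omega>) S" "tensor_C1 \<Omega> S"
    and v: "continuous_on (closure \<Omega>) v" "\<And>x. x \<in> closure \<Omega> \<Longrightarrow> v differentiable (at x within closure \<Omega>)"
      "continuous_on (closure \<Omega>) (grad \<Omega> v)"
    and q: "continuous_on (closure \<Omega>) q" "\<And>x. x \<in> \<Omega> \<Longrightarrow> tensor_div \<Omega> S x = q x"
  shows "set_integrable \<sigma> (frontier \<Omega>) (\<lambda>y. v y \<bullet> (S y *v outward_normal \<Omega> y))"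
    and "(LINT y:\<Omega>|lborel. q y \<bullet> v y + S y \<bullet> grad \<Omega> v y) = (LINT y:frontier \<Omega>|\<sigma>. v y \<bullet> (S y *v outward_normal \<Omega> y))"
proof -
  have op: "open \<Omega>" using dom by (simp add: lipschitz_domain_def)
  have sub: "\<Omega> \<subseteq> closure \<Omega>" by (rule closure_subset)
  define F where "F y = (\<Sum>i\<in>UNIV. v y $ i *\<^sub>R S y $ i)" for y
  define F' where "F' y h = (\<Sum>i\<in>UNIV. v y $ i *\<^sub>R (grad \<Omega> (\<lambda>z. S z $ i) y *v h) + (grad \<Omega> v y *v h) $ i *\<^sub>R S y $ i)" for y h
  have Fn: "F y \<bullet> n = v y \<bullet> (S y *v n)" for y n
    by (simp add: F_def inner_sum_left inner_vec_def[of "v y"] matrix_vector_mul_component)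
  have cont: "continuous_on (closure \<Omega>) F" unfolding F_def by (intro continuous_intros S v)
  have deriv: "(F has_derivative F' y) (at y)" if y: "y \<in> \<Omega>" for y
  proof -
    have "((\<lambda>z. v z $ i) has_derivative (\<lambda>h. (grad \<Omega> v y *v h) $ i)) (at y)" for i
      using bounded_linear.has_derivative[OF bounded_linear_vec_nth grad_has_derivative[OF op y v(2)]] y sub by blast
    moreover have "((\<lambda>z. S z $ i) has_derivative (\<lambda>h. grad \<Omega> (\<lambda>z. S z $ i) y *v h)) (at y)" for i
      using S(2) y at_closure_open[OF op y] by (intro grad_has_derivative[OF op y]) (auto simp: tensor_C1_def)
    ultimately show ?thesis unfolding F_def[abs_def] F'_def[abs_def]
      by (intro has_derivative_sum has_derivative_scaleR)
  qed
  have cont': "continuous_on \<Omega> (\<lambda>y. F' y b)" for b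
  proof -
    have "continuous_on \<Omega> (grad \<Omega> (\<lambda>z. S z $ i))" for i using S(2) by (simp add: tensor_C1_def)
    thus ?thesis unfolding F'_def
      by (intro continuous_intros continuous_on_subset[OF v(1) sub] continuous_on_subset[OF v(3) sub] continuous_on_subset[OF S(1) sub])
  qed
  have div: "(\<Sum>b\<in>Basis. F' y b \<bullet> b) = q y \<bullet> v y + S y \<bullet> grad \<Omega> v y" if y: "y \<in> \<Omega>" for y
  proof -
    have "(\<Sum>b\<in>Basis. F' y b \<bullet> b) = (\<Sum>j\<in>UNIV. \<Sum>i\<in>UNIV. v y $ i * grad \<Omega> (\<lambda>z. S z $ i) y $ j $ j + grad \<Omega> v y $ i $ j * S y $ i $ j)"
      unfolding sum_Basis_vec F'_def
      by (simp add: inner_axis matrix_vector_mul_component cart_eq_inner_axis[symmetric])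
    also have "\<dots> = (\<Sum>i\<in>UNIV. v y $ i * tensor_div \<Omega> S y $ i) + (\<Sum>i\<in>UNIV. \<Sum>j\<in>UNIV. grad \<Omega> v y $ i $ j * S y $ i $ j)"
      by (subst sum.swap) (simp add: sum.distrib tensor_div_def divg_def trace_def sum_distrib_left)
    finally show ?thesis using q(2)[OF y] by (simp add: inner_vec_def mult.commute)
  qed
  have "continuous_on (closure \<Omega>) (\<lambda>y. q y \<bullet> v y + S y \<bullet> grad \<Omega> v y)"
    by (intro continuous_intros q v S)
  then obtain B where "B > 0" "\<And>y. y \<in> closure \<Omega> \<Longrightarrow> norm (q y \<bullet> v y + S y \<bullet> grad \<Omega> v y) \<le> B"
    using continuous_on_compact_bound[OF domain_simps(3)[OF dom surf]] by blast
  hence bd: "\<bar>\<Sum>b\<in>Basis. F' y b \<bullet> b\<bar> \<le> B" if "y \<in> \<Omega>" for y using that sub by (auto simp: div)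
  note D = divergence_theorem[OF dom surf cont deriv cont' bd, unfolded Fn]
  show "set_integrable \<sigma> (frontier \<Omega>) (\<lambda>y. v y \<bullet> (S y *v outward_normal \<Omega> y))" by (rule D(1))
  have "(LINT y:\<Omega>|lborel. q y \<bullet> v y + S y \<bullet> grad \<Omega> v y) = (LINT y:\<Omega>|lborel. (\<Sum>b\<in>Basis. F' y b \<bullet> b))"
    unfolding set_lebesgue_integral_def by (rule Bochner_Integration.integral_cong) (auto simp: div split: split_indicator)
  thus "(LINT y:\<Omega>|lborel. q y \<bullet> v y + S y \<bullet> grad \<Omega> v y) = (LINT y:frontier \<Omega>|\<sigma>. v y \<bullet> (S y *v outward_normal \<Omega> y))"
    using D(2) by simp
qed

section \<open>Integration over space-time cylinders\<close>

lemma continuous_on_slice_right: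
  assumes "continuous_on (I \<times> K) (\<lambda>(t, x). k t x)" "t \<in> I"
  shows "continuous_on K (k t)"
proof -
  have "continuous_on K (\<lambda>x. case (t, x) of (t, x) \<Rightarrow> k t x)"
    by (rule continuous_on_compose2[OF assms(1)]) (use assms(2) in \<open>auto intro!: continuous_on_Pair continuous_on_const continuous_on_id\<close>)
  thus ?thesis by simp
qed

lemma continuous_on_slice_left:
  assumes "continuous_on (I \<times> K) (\<lambda>(t, x). k t x)" "x \<in> K"
  shows "continuous_on I (\<lambda>t. k t x)"
proof -
  have "continuous_on I (\<lambda>t. case (t, x) of (t, x) \<Rightarrow> k t x)"
    by (rule continuous_on_compose2[OF assms(1)]) (use assms(2) in \<open>auto intro!: continuous_on_Pair continuous_on_const continuous_on_id\<close>)
  thus ?thesis by simp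
qed

lemma
  fixes k :: "real \<Rightarrow> 'a::euclidean_space \<Rightarrow> real"
  assumes \<Omega>: "open \<Omega>" "bounded \<Omega>" and k: "continuous_on ({a..b} \<times> closure \<Omega>) (\<lambda>(t, x). k t x)"
  shows cylinder_inner_integrable_time: "set_integrable lborel {a..b} (\<lambda>t. LINT x:\<Omega>|lborel. k t x)"
    and cylinder_inner_integrable_space: "t \<in> {a..b} \<Longrightarrow> set_integrable lborel \<Omega> (k t)"
    and cylinder_Fubini: "(LINT t:{a..b}|lborel. LINT x:\<Omega>|lborel. k t x) = (LINT x:\<Omega>|lborel. LINT t:{a..b}|lborel. k t x)"
proof -
  have sub: "{a..b} \<times> \<Omega> \<subseteq> {a..b} \<times> closure \<Omega>" using closure_subset by auto
  have "compact ({a..b} \<times> closure \<Omega>)" using \<Omega> by (intro compact_Times) (auto simp: compact_closure)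
  then obtain B where B: "\<And>w. w \<in> {a..b} \<times> closure \<Omega> \<Longrightarrow> norm (case w of (t, x) \<Rightarrow> k t x) \<le> B"
    using continuous_on_compact_bound[OF _ k] by blast
  have "set_integrable lborel ({a..b} \<times> \<Omega>) (\<lambda>(t, x). k t x)"
  proof (rule set_integrable_bounded_continuous)
    show "{a..b} \<times> \<Omega> \<in> sets borel" using \<Omega> by (intro borel_Times) auto
    show "bounded ({a..b} \<times> \<Omega>)" using \<Omega> by (intro bounded_Times) auto
    show "continuous_on ({a..b} \<times> \<Omega>) (\<lambda>(t, x). k t x)" by (rule continuous_on_subset[OF k sub])
    show "\<bar>case w of (t, x) \<Rightarrow> k t x\<bar> \<le> B" if "w \<in> {a..b} \<times> \<Omega>" for w
      using B[of w] that sub by auto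
  qed
  hence "integrable (lborel \<Otimes>\<^sub>M lborel) (\<lambda>w. indicator ({a..b} \<times> \<Omega>) w *\<^sub>R (case w of (t, x) \<Rightarrow> k t x))"
    by (simp add: set_integrable_def lborel_prod)
  also have "(\<lambda>w. indicator ({a..b} \<times> \<Omega>) w *\<^sub>R (case w of (t, x) \<Rightarrow> k t x)) =
      (\<lambda>(t, x). indicator {a..b} t * (indicator \<Omega> x * k t x))"
    by (auto split: split_indicator)
  finally have int: "integrable (lborel \<Otimes>\<^sub>M lborel) (\<lambda>(t, x). indicator {a..b} t * (indicator \<Omega> x * k t x))" .
  show "set_integrable lborel {a..b} (\<lambda>t. LINT x:\<Omega>|lborel. k t x)"
    using lborel_pair.integrable_fst[OF int] by (simp add: set_integrable_def set_lebesgue_integral_def)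
  have "(LINT t|lborel. LINT x|lborel. indicator {a..b} t * (indicator \<Omega> x * k t x)) =
      (LINT x|lborel. LINT t|lborel. indicator {a..b} t * (indicator \<Omega> x * k t x))"
    by (rule lborel_pair.Fubini_integral[OF int, symmetric])
  also have "(LINT x|lborel. LINT t|lborel. indicator {a..b} t * (indicator \<Omega> x * k t x)) =
      (LINT x|lborel. LINT t|lborel. indicator \<Omega> x * (indicator {a..b} t * k t x))"
    by (simp add: mult_ac)
  finally show "(LINT t:{a..b}|lborel. LINT x:\<Omega>|lborel. k t x) = (LINT x:\<Omega>|lborel. LINT t:{a..b}|lborel. k t x)"
    by (simp add: set_lebesgue_integral_def)
  assume t: "t \<in> {a..b}"
  show "set_integrable lborel \<Omega> (k t)"
  proof (rule set_integrable_bounded_continuous[where B = B])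
    show "continuous_on \<Omega> (k t)"
      using continuous_on_slice_right[OF continuous_on_subset[OF k sub] t] .
    show "\<bar>k t x\<bar> \<le> B" if "x \<in> \<Omega>" for x using B[of "(t, x)"] t that closure_subset[of \<Omega>] by auto
  qed (use \<Omega> in auto)
qed

text \<open>Here \<open>e\<close> is an energy density with rate \<open>k\<close>, \<open>w\<close>
  a dissipation density and \<open>P\<close> the power supplied. The fundamental theorem of calculus
  is applied at each point \<open>x\<close> and the order of integration is exchanged afterwards, so
  the total energy is never differentiated in time.\<close>

lemma
  fixes e k w :: "real \<Rightarrow> 'a::euclidean_space \<Rightarrow> real" and P :: "real \<Rightarrow> real"
  assumes \<Omega>: "open \<Omega>" "bounded \<Omega>" and ab: "a \<le> b"
    and k: "continuous_on ({a..b} \<times> closure \<Omega>) (\<lambda>(t, x). k t x)"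
    and w: "continuous_on ({a..b} \<times> closure \<Omega>) (\<lambda>(t, x). w t x)"
    and e: "\<And>t x. t \<in> {a..b} \<Longrightarrow> x \<in> \<Omega> \<Longrightarrow> ((\<lambda>t. e t x) has_vector_derivative k t x) (at t within {a..b})"
    and e': "\<And>t. t \<in> {a..b} \<Longrightarrow> set_integrable lborel \<Omega> (e t)"
    and P: "\<And>t. t \<in> {a..b} \<Longrightarrow> (LINT x:\<Omega>|lborel. k t x + w t x) = P t"
  shows energy_balance_integrable: "set_integrable lborel {a..b} P"
    and energy_balance: "(LINT x:\<Omega>|lborel. e b x) + (LINT t:{a..b}|lborel. LINT x:\<Omega>|lborel. w t x) =
      (LINT x:\<Omega>|lborel. e a x) + (LINT t:{a..b}|lborel. P t)"
proof -
  have P': "P t = (LINT x:\<Omega>|lborel. k t x) + (LINT x:\<Omega>|lborel. w t x)" if "t \<in> {a..b}" for t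
    using P[OF that] cylinder_inner_integrable_space[OF \<Omega> k that] cylinder_inner_integrable_space[OF \<Omega> w that]
    by (simp add: set_integral_add)
  note ik = cylinder_inner_integrable_time[OF \<Omega> k] and iw = cylinder_inner_integrable_time[OF \<Omega> w]
  have "set_integrable lborel {a..b} (\<lambda>t. (LINT x:\<Omega>|lborel. k t x) + (LINT x:\<Omega>|lborel. w t x))"
    using ik iw by (rule set_integral_add)
  thus "set_integrable lborel {a..b} P"
    by (subst set_integrable_cong[OF refl refl P']) auto
  have "(LINT t:{a..b}|lborel. P t) = (LINT t:{a..b}|lborel. (LINT x:\<Omega>|lborel. k t x) + (LINT x:\<Omega>|lborel. w t x))"
    using P' by (intro set_lebesgue_integral_cong) auto
  also have "\<dots> = (LINT t:{a..b}|lborel. LINT x:\<Omega>|lborel. k t x) + (LINT t:{a..b}|lborel. LINT x:\<Omega>|lborel. w t x)"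
    using ik iw by (rule set_integral_add)
  also have "(LINT t:{a..b}|lborel. LINT x:\<Omega>|lborel. k t x) = (LINT x:\<Omega>|lborel. LINT t:{a..b}|lborel. k t x)"
    by (rule cylinder_Fubini[OF \<Omega> k])
  also have "\<dots> = (LINT x:\<Omega>|lborel. e b x - e a x)"
  proof (rule set_lebesgue_integral_cong)
    show "\<forall>x. x \<in> \<Omega> \<longrightarrow> (LINT t:{a..b}|lborel. k t x) = e b x - e a x"
    proof (intro allI impI)
      fix x assume x: "x \<in> \<Omega>"
      have "continuous_on {a..b} (\<lambda>t. k t x)"
        using continuous_on_slice_left[OF k] x closure_subset by blast
      thus "(LINT t:{a..b}|lborel. k t x) = e b x - e a x"
        unfolding set_lebesgue_integral_def using ab e x by (intro integral_FTC_Icc) auto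
    qed
  qed (use \<Omega> in auto)
  also have "\<dots> = (LINT x:\<Omega>|lborel. e b x) - (LINT x:\<Omega>|lborel. e a x)"
    using e' ab by (intro set_integral_diff) auto
  finally show "(LINT x:\<Omega>|lborel. e b x) + (LINT t:{a..b}|lborel. LINT x:\<Omega>|lborel. w t x) =
      (LINT x:\<Omega>|lborel. e a x) + (LINT t:{a..b}|lborel. P t)" by simp
qed

lemma time_deriv_works:
  assumes "time_C1 I \<Omega> v" "t \<in> I" "x \<in> closure \<Omega>"
  shows "((\<lambda>s. v s x) has_vector_derivative time_deriv I v t x) (at t within I)"
  using assms unfolding time_C1_def time_deriv_def by (simp add: vector_derivative_works)

text \<open>Integrating \<open>\<partial>\<^sub>t\<eta> = \<xi>\<close> in time and differentiating under the integral sign avoids any assumption on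
  mixed derivatives of \<open>\<eta>\<close>.\<close>

lemma grad_time_derivative:
  fixes \<eta> \<xi> :: "real \<Rightarrow> real^'d \<Rightarrow> real^'d"
  assumes \<Omega>: "open \<Omega>" and \<eta>: "space_C1 {a..b} \<Omega> \<eta>" "time_C1 {a..b} \<Omega> \<eta>" and \<xi>: "space_C1 {a..b} \<Omega> \<xi>"
    and eq: "\<And>t x. t \<in> {a..b} \<Longrightarrow> x \<in> \<Omega> \<Longrightarrow> time_deriv {a..b} \<eta> t x = \<xi> t x"
    and t: "t \<in> {a..b}" and x: "x \<in> \<Omega>"
  shows "((\<lambda>s. grad \<Omega> (\<eta> s) x) has_vector_derivative grad \<Omega> (\<xi> t) x) (at t within {a..b})"
proof -
  have sub: "\<Omega> \<subseteq> closure \<Omega>" by (rule closure_subset)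
  have c\<xi>: "continuous_on ({a..b} \<times> closure \<Omega>) (\<lambda>(t, x). \<xi> t x)"
    and cg: "continuous_on ({a..b} \<times> closure \<Omega>) (\<lambda>(t, x). grad \<Omega> (\<xi> t) x)"
    using \<xi> by (auto simp: space_C1_def)
  obtain \<epsilon> where \<epsilon>: "\<epsilon> > 0" "ball x \<epsilon> \<subseteq> \<Omega>" using \<Omega> x by (meson openE)
  have dgen: "((\<lambda>h. v (x + h *\<^sub>R c)) has_vector_derivative grad \<Omega> v (x + h *\<^sub>R c) *v c) (at h within {-\<epsilon>/2..\<epsilon>/2})"
    if "\<And>x. x \<in> closure \<Omega> \<Longrightarrow> v differentiable (at x within closure \<Omega>)" "x + h *\<^sub>R c \<in> \<Omega>" for v h c
  proof -
    have "(v has_derivative (\<lambda>k. grad \<Omega> v (x + h *\<^sub>R c) *v k)) (at (x + h *\<^sub>R c))"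
      using that sub by (intro grad_has_derivative[OF \<Omega>]) auto
    hence "((\<lambda>h. v (x + h *\<^sub>R c)) has_derivative (\<lambda>k. grad \<Omega> v (x + h *\<^sub>R c) *v (k *\<^sub>R c))) (at h within {-\<epsilon>/2..\<epsilon>/2})"
      by (intro has_derivative_compose[where f = "\<lambda>h. x + h *\<^sub>R c" and g = v and f' = "\<lambda>k. k *\<^sub>R c"])
        (auto intro!: derivative_eq_intros)
    thus ?thesis by (simp add: has_vector_derivative_def matrix_vector_mult_scaleR)
  qed
  have col: "((\<lambda>s. grad \<Omega> (\<eta> s) x *v c) has_vector_derivative grad \<Omega> (\<xi> t) x *v c) (at t within {a..b})"
    if c: "norm c = 1" for c
  proof -
    \<comment> \<open>Half the radius keeps the whole segment, endpoints included, inside the ball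
      contained in \<open>\<Omega>\<close>.\<close>
    let ?H = "{-\<epsilon>/2..\<epsilon>/2}"
    have inside: "x + h *\<^sub>R c \<in> \<Omega>" if "h \<in> ?H" for h
    proof -
      have "\<bar>h\<bar> < \<epsilon>" using that \<epsilon>(1) by auto
      hence "x + h *\<^sub>R c \<in> ball x \<epsilon>" using c by (simp add: dist_norm)
      thus ?thesis using \<epsilon>(2) by blast
    qed
    have d\<eta>: "\<And>y. y \<in> closure \<Omega> \<Longrightarrow> \<eta> s differentiable (at y within closure \<Omega>)" if "s \<in> {a..b}" for s
      using \<eta>(1) that by (simp add: space_C1_def)
    have d\<xi>: "\<And>y. y \<in> closure \<Omega> \<Longrightarrow> \<xi> s differentiable (at y within closure \<Omega>)" if "s \<in> {a..b}" for s
      using \<xi> that by (simp add: space_C1_def)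
    have cl: "continuous_on {a..b} (\<lambda>\<tau>. \<xi> \<tau> y)" if "y \<in> \<Omega>" for y
using continuous_on_slice_left[OF c\<xi>] that sub by blast
    have FTC: "((\<lambda>\<tau>. \<xi> \<tau> y) has_integral (\<eta> s y - \<eta> a y)) {a..s}" if "s \<in> {a..b}" "y \<in> \<Omega>" for s y
    proof (rule fundamental_theorem_of_calculus)
      show "((\<lambda>s. \<eta> s y) has_vector_derivative \<xi> \<tau> y) (at \<tau> within {a..s})" if "\<tau> \<in> {a..s}" for \<tau>
      proof -
        have \<tau>: "\<tau> \<in> {a..b}" using that \<open>s \<in> {a..b}\<close> by auto
        have "((\<lambda>s. \<eta> s y) has_vector_derivative \<xi> \<tau> y) (at \<tau> within {a..b})"
          using time_deriv_works[OF \<eta>(2) \<tau>, of y] eq[OF \<tau> \<open>y \<in> \<Omega>\<close>] \<open>y \<in> \<Omega>\<close> sub by auto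
        thus ?thesis by (rule has_vector_derivative_within_subset) (use \<open>s \<in> {a..b}\<close> in auto)
      qed
    qed (use that in auto)
    \<comment> \<open>The relation integrated in time is differentiated along \<open>c\<close> at
      \<open>h = 0\<close>. The integrand on the right is continuous in time, so the right-hand side
      can then be differentiated in \<open>s\<close>.\<close>
    have key: "grad \<Omega> (\<eta> s) x *v c = grad \<Omega> (\<eta> a) x *v c + integral {a..s} (\<lambda>\<tau>. grad \<Omega> (\<xi> \<tau>) x *v c)" if s: "s \<in> {a..b}" for s
    proof -
      have "((\<lambda>h. integral (cbox a s) (\<lambda>\<tau>. \<xi> \<tau> (x + h *\<^sub>R c))) has_vector_derivative
          integral (cbox a s) (\<lambda>\<tau>. grad \<Omega> (\<xi> \<tau>) (x + 0 *\<^sub>R c) *v c)) (at 0 within ?H)"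
      proof (rule leibniz_rule_vector_derivative[where f = "\<lambda>h \<tau>. \<xi> \<tau> (x + h *\<^sub>R c)"])
        fix h \<tau> assume "h \<in> ?H" "\<tau> \<in> cbox a s"
        thus "((\<lambda>h. \<xi> \<tau> (x + h *\<^sub>R c)) has_vector_derivative grad \<Omega> (\<xi> \<tau>) (x + h *\<^sub>R c) *v c) (at h within ?H)"
          using s by (intro dgen d\<xi> inside) auto
      next
        fix h assume "h \<in> ?H"
        thus "(\<lambda>\<tau>. \<xi> \<tau> (x + h *\<^sub>R c)) integrable_on cbox a s"
          using s continuous_on_subset[OF cl[OF inside[of h]], of "{a..s}"] by (intro integrable_continuous) auto
      next
        have "continuous_on (?H \<times> cbox a s) (\<lambda>w. case (snd w, x + fst w *\<^sub>R c) of (\<tau>, y) \<Rightarrow> grad \<Omega> (\<xi> \<tau>) y)"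
          by (rule continuous_on_compose2[OF cg]) (use s inside sub in \<open>auto intro!: continuous_intros\<close>)
        hence "continuous_on (?H \<times> cbox a s) (\<lambda>w. (case (snd w, x + fst w *\<^sub>R c) of (\<tau>, y) \<Rightarrow> grad \<Omega> (\<xi> \<tau>) y) *v c)"
          by (intro continuous_intros)
        thus "continuous_on (?H \<times> cbox a s) (\<lambda>(h, \<tau>). grad \<Omega> (\<xi> \<tau>) (x + h *\<^sub>R c) *v c)"
          by (simp add: case_prod_beta')
      qed (use \<epsilon> in auto)
      hence 1: "((\<lambda>h. integral (cbox a s) (\<lambda>\<tau>. \<xi> \<tau> (x + h *\<^sub>R c))) has_vector_derivative
          integral {a..s} (\<lambda>\<tau>. grad \<Omega> (\<xi> \<tau>) x *v c)) (at 0 within ?H)" by simp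
      have a: "a \<in> {a..b}" using t by auto
      have 2: "((\<lambda>h. \<eta> s (x + h *\<^sub>R c) - \<eta> a (x + h *\<^sub>R c)) has_vector_derivative
          grad \<Omega> (\<eta> s) (x + 0 *\<^sub>R c) *v c - grad \<Omega> (\<eta> a) (x + 0 *\<^sub>R c) *v c) (at 0 within ?H)"
        by (intro has_vector_derivative_diff dgen d\<eta> s a) (use x in auto)
      have "((\<lambda>h. \<eta> s (x + h *\<^sub>R c) - \<eta> a (x + h *\<^sub>R c)) has_vector_derivative
          integral {a..s} (\<lambda>\<tau>. grad \<Omega> (\<xi> \<tau>) x *v c)) (at 0 within ?H)"
      proof (rule has_vector_derivative_transform[OF _ _ 1])
        show "\<eta> s (x + h *\<^sub>R c) - \<eta> a (x + h *\<^sub>R c) = integral (cbox a s) (\<lambda>\<tau>. \<xi> \<tau> (x + h *\<^sub>R c))" if "h \<in> ?H" for h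
          using integral_unique[OF FTC[OF s inside[OF that]]] by simp
      qed (use \<epsilon> in auto)
      from vector_derivative_unique_within[OF _ this 2]
      have "integral {a..s} (\<lambda>\<tau>. grad \<Omega> (\<xi> \<tau>) x *v c) = grad \<Omega> (\<eta> s) x *v c - grad \<Omega> (\<eta> a) x *v c"
        using \<epsilon> by (simp add: trivial_limit_within islimpt_Icc)
      thus ?thesis by simp
    qed
    have "continuous_on {a..b} (\<lambda>\<tau>. grad \<Omega> (\<xi> \<tau>) x)"
      using continuous_on_slice_left[OF cg] x sub by blast
    hence "continuous_on {a..b} (\<lambda>\<tau>. grad \<Omega> (\<xi> \<tau>) x *v c)" by (intro continuous_intros)
    from integral_has_vector_derivative[OF this t]
    have "((\<lambda>s. grad \<Omega> (\<eta> a) x *v c + integral {a..s} (\<lambda>\<tau>. grad \<Omega> (\<xi> \<tau>) x *v c)) has_vector_derivative grad \<Omega> (\<xi> t) x *v c) (at t within {a..b})"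
      by (auto intro!: derivative_eq_intros)
    from has_vector_derivative_transform[OF t _ this, of "\<lambda>s. grad \<Omega> (\<eta> s) x *v c"] key
    show ?thesis by blast
  qed
  \<comment> \<open>\<open>L j\<close> puts a vector into column \<open>j\<close> of a zero matrix.
    A matrix is the sum of its columns, which are the images of the axes, so the derivatives along
    the axes assemble to that of \<open>grad\<close>.\<close>
  define L where "L j c = (\<chi> i. c $ i *\<^sub>R axis j (1::real))" for j :: 'd and c :: "real^'d"
  have L: "bounded_linear (L j)" for j
    by (intro linear_conv_bounded_linear[THEN iffD1] linearI) (auto simp: L_def vec_eq_iff algebra_simps)
  have dec: "A = (\<Sum>j\<in>UNIV. L j (A *v axis j 1))" for A :: "real^'d^'d"
    by (simp add: L_def vec_eq_iff matrix_vector_mul_component inner_axis)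
      (simp add: axis_def if_distrib cong: if_cong)
  have "((\<lambda>s. \<Sum>j\<in>UNIV. L j (grad \<Omega> (\<eta> s) x *v axis j 1)) has_vector_derivative (\<Sum>j\<in>UNIV. L j (grad \<Omega> (\<xi> t) x *v axis j 1))) (at t within {a..b})"
    by (intro has_vector_derivative_sum bounded_linear.has_vector_derivative[OF L] col) simp
  thus ?thesis unfolding dec[symmetric] .
qed

section \<open>Energy balances of the two subproblems\<close>

lemma boundary_reduction:
  fixes f :: "'a \<Rightarrow> real"
  assumes int: "set_integrable \<sigma> A f" and "B \<in> sets \<sigma>" "B \<subseteq> A" and z: "AE y in \<sigma>. y \<in> A - B \<longrightarrow> f y = 0"
  shows "set_integrable \<sigma> B f" "(LINT y:A|\<sigma>. f y) = (LINT y:B|\<sigma>. f y)"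
proof -
  show B: "set_integrable \<sigma> B f" by (rule set_integrable_subset[OF int assms(2,3)])
  show "(LINT y:A|\<sigma>. f y) = (LINT y:B|\<sigma>. f y)"
    unfolding set_lebesgue_integral_def
  proof (rule integral_cong_AE)
    show "AE y in \<sigma>. indicator A y *\<^sub>R f y = indicator B y *\<^sub>R f y"
      using z by eventually_elim (use assms(3) in \<open>auto split: split_indicator\<close>)
  qed (use int B in \<open>auto simp: set_integrable_def\<close>)
qed

section \<open>Regularity of the fields and the stress power\<close>

lemma continuous_on_sym_grad:
  assumes "continuous_on K (\<lambda>w. grad \<Omega> (v (fst w)) (snd w))"
  shows "continuous_on K (\<lambda>w. sym_grad \<Omega> (v (fst w)) (snd w))" "continuous_on K (\<lambda>w. divg \<Omega> (v (fst w)) (snd w))"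
  unfolding sym_grad_def divg_def
  by (intro continuous_intros assms bounded_linear.continuous_on[OF bounded_linear_transpose]
    bounded_linear.continuous_on[OF bounded_linear_trace])+

lemma space_C1_D:
  assumes "space_C1 I \<Omega> v"
  shows "continuous_on (I \<times> closure \<Omega>) (\<lambda>w. v (fst w) (snd w))"
    and "continuous_on (I \<times> closure \<Omega>) (\<lambda>w. grad \<Omega> (v (fst w)) (snd w))"
    and "continuous_on (I \<times> closure \<Omega>) (\<lambda>w. sym_grad \<Omega> (v (fst w)) (snd w))"
    and "continuous_on (I \<times> closure \<Omega>) (\<lambda>w. divg \<Omega> (v (fst w)) (snd w))"
    and "t \<in> I \<Longrightarrow> continuous_on (closure \<Omega>) (v t)"
    and "t \<in> I \<Longrightarrow> continuous_on (closure \<Omega>) (grad \<Omega> (v t))"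
    and "t \<in> I \<Longrightarrow> x \<in> closure \<Omega> \<Longrightarrow> v t differentiable (at x within closure \<Omega>)"
proof -
  show 1: "continuous_on (I \<times> closure \<Omega>) (\<lambda>w. v (fst w) (snd w))"
    and 2: "continuous_on (I \<times> closure \<Omega>) (\<lambda>w. grad \<Omega> (v (fst w)) (snd w))"
    using assms by (simp_all add: space_C1_def case_prod_beta')
  show "continuous_on (I \<times> closure \<Omega>) (\<lambda>w. sym_grad \<Omega> (v (fst w)) (snd w))"
    "continuous_on (I \<times> closure \<Omega>) (\<lambda>w. divg \<Omega> (v (fst w)) (snd w))"
    by (rule continuous_on_sym_grad[OF 2])+
  show "t \<in> I \<Longrightarrow> continuous_on (closure \<Omega>) (v t)" "t \<in> I \<Longrightarrow> continuous_on (closure \<Omega>) (grad \<Omega> (v t))"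
    using assms continuous_on_slice_right by (auto simp: space_C1_def)
  show "t \<in> I \<Longrightarrow> x \<in> closure \<Omega> \<Longrightarrow> v t differentiable (at x within closure \<Omega>)"
    using assms by (simp add: space_C1_def)
qed

lemma time_C1_D:
  "time_C1 I \<Omega> v \<Longrightarrow> continuous_on (I \<times> closure \<Omega>) (\<lambda>w. time_deriv I v (fst w) (snd w))"
  by (simp add: time_C1_def case_prod_beta')

text \<open>The pressure does no work on a divergence-free velocity, and the symmetric viscous
  stress sees only the symmetric part of the gradient.\<close>

lemma fluid_stress_inner:
  assumes "divg \<Omega> u x = 0"
  shows "fluid_stress \<mu>f \<Omega> u p x \<bullet> grad \<Omega> u x = 2 * \<mu>f * (norm (sym_grad \<Omega> u x))\<^sup>2"
  using assms sym_part_inner[of "grad \<Omega> u x" "grad \<Omega> u x"]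
  by (simp add: fluid_stress_def inner_add_left inner_diff_left mat_inner divg_def sym_grad_def[symmetric] power2_norm_eq_inner)

text \<open>The form is symmetric in \<open>\<eta>\<close> and \<open>\<xi>\<close>; when
  \<open>\<xi>\<close> is the rate of \<open>\<eta>\<close>, it is the time derivative of the
  elastic energy density.\<close>

lemma structure_stress_inner:
  "structure_stress \<mu>s lam \<Omega> \<eta> x \<bullet> grad \<Omega> \<xi> x =
    2 * \<mu>s * (sym_grad \<Omega> \<eta> x \<bullet> sym_grad \<Omega> \<xi> x) + lam * (divg \<Omega> \<eta> x * divg \<Omega> \<xi> x)"
  using sym_part_inner[of "grad \<Omega> \<eta> x" "grad \<Omega> \<xi> x"]
  by (simp add: structure_stress_def inner_add_left mat_inner divg_def sym_grad_def[symmetric])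

lemma has_vector_derivative_inner_self:
  fixes f :: "real \<Rightarrow> 'a::real_inner"
  assumes "(f has_vector_derivative f') (at t within I)"
  shows "((\<lambda>t. c * (f t \<bullet> f t)) has_vector_derivative 2 * c * (f' \<bullet> f t)) (at t within I)"
proof -
  have "((\<lambda>t. f t \<bullet> f t) has_vector_derivative (f t \<bullet> f' + f' \<bullet> f t)) (at t within I)"
    by (rule bounded_bilinear.has_vector_derivative[OF bounded_bilinear_inner assms assms])
  from has_vector_derivative_mult_right[OF this, of c] show ?thesis
    by (simp add: inner_commute algebra_simps)
qed

context
  fixes \<Omega> \<Gamma> D :: "(real^'d) set" and \<sigma> :: "(real^'d) measure" and a b :: real
  assumes dom: "lipschitz_domain \<Omega>" and surf: "surface_measure \<Omega> \<sigma>"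
    and \<Gamma>: "\<Gamma> \<in> sets borel" "\<Gamma> \<subseteq> frontier \<Omega>" and ab: "a \<le> b"
begin

lemma open_bounded: "open \<Omega>" "bounded \<Omega>"
  using dom by (auto simp: lipschitz_domain_def)

lemma set_integrable_continuous_closure:
  fixes f :: "real^'d \<Rightarrow> real"
  assumes "continuous_on (closure \<Omega>) f" shows "set_integrable lborel \<Omega> f"
proof -
  obtain B where "\<And>x. x \<in> closure \<Omega> \<Longrightarrow> norm (f x) \<le> B"
    using continuous_on_compact_bound[OF domain_simps(3)[OF dom surf] assms] by blast
  thus ?thesis using open_bounded closure_subset[of \<Omega>]
    by (intro set_integrable_bounded_continuous[where B = B] continuous_on_subset[OF assms]) auto
qed

text \<open>Off the interface one factor of the work vanishes: the velocity on \<open>D\<close>, the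
  traction almost everywhere on the rest.\<close>

lemma interface_work:
  fixes S :: "real^'d \<Rightarrow> real^'d^'d" and v q :: "real^'d \<Rightarrow> real^'d"
  assumes S: "continuous_on (closure \<Omega>) S" "tensor_C1 \<Omega> S"
    and v: "continuous_on (closure \<Omega>) v" "\<And>x. x \<in> closure \<Omega> \<Longrightarrow> v differentiable (at x within closure \<Omega>)"
      "continuous_on (closure \<Omega>) (grad \<Omega> v)"
    and q: "continuous_on (closure \<Omega>) q" "\<And>x. x \<in> \<Omega> \<Longrightarrow> tensor_div \<Omega> S x = q x"
    and D0: "\<And>x. x \<in> D \<Longrightarrow> v x = 0"
    and N0: "AE x in \<sigma>. x \<in> frontier \<Omega> - \<Gamma> - D \<longrightarrow> S x *v outward_normal \<Omega> x = 0"
  shows "set_integrable \<sigma> \<Gamma> (\<lambda>y. v y \<bullet> (S y *v outward_normal \<Omega> y))"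
    and "(LINT y:\<Omega>|lborel. q y \<bullet> v y + S y \<bullet> grad \<Omega> v y) = (LINT y:\<Gamma>|\<sigma>. v y \<bullet> (S y *v outward_normal \<Omega> y))"
proof -
  note G = green_identity[OF dom surf S v q]
  have "AE y in \<sigma>. y \<in> frontier \<Omega> - \<Gamma> \<longrightarrow> v y \<bullet> (S y *v outward_normal \<Omega> y) = 0"
    using N0 by eventually_elim (use D0 in force)
  note R = boundary_reduction[OF G(1) surface_sets[OF dom surf \<Gamma>(1)] \<Gamma>(2) this]
  show "set_integrable \<sigma> \<Gamma> (\<lambda>y. v y \<bullet> (S y *v outward_normal \<Omega> y))" by (rule R(1))
  show "(LINT y:\<Omega>|lborel. q y \<bullet> v y + S y \<bullet> grad \<Omega> v y) = (LINT y:\<Gamma>|\<sigma>. v y \<bullet> (S y *v outward_normal \<Omega> y))"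
    using G(2) R(2) by simp
qed

lemma
  fixes u :: "real \<Rightarrow> real^'d \<Rightarrow> real^'d" and p :: "real \<Rightarrow> real^'d \<Rightarrow> real"
  assumes reg: "fluid_regular \<mu>f \<Omega> {a..b} u p"
    and S: "\<And>t. S t = fluid_stress \<mu>f \<Omega> (u t) (p t)"
    and eq: "\<And>t x. t \<in> {a..b} \<Longrightarrow> x \<in> \<Omega> \<Longrightarrow>
      \<rho>f *\<^sub>R time_deriv {a..b} u t x - tensor_div \<Omega> (S t) x = 0 \<and> divg \<Omega> (u t) x = 0"
    and D0: "\<And>t x. t \<in> {a..b} \<Longrightarrow> x \<in> D \<Longrightarrow> u t x = 0"
    and N0: "\<And>t. t \<in> {a..b} \<Longrightarrow> AE x in \<sigma>. x \<in> frontier \<Omega> - \<Gamma> - D \<longrightarrow> S t x *v outward_normal \<Omega> x = 0"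
  shows fluid_stress_continuous: "continuous_on ({a..b} \<times> closure \<Omega>) (\<lambda>(t, x). S t x)"
    and fluid_work_integrable: "t \<in> {a..b} \<Longrightarrow> set_integrable \<sigma> \<Gamma> (\<lambda>y. u t y \<bullet> (S t y *v outward_normal \<Omega> y))"
    and fluid_work_integrable_time: "set_integrable lborel {a..b} (\<lambda>t. LINT y:\<Gamma>|\<sigma>. u t y \<bullet> (S t y *v outward_normal \<Omega> y))"
    and fluid_energy_balance: "\<rho>f / 2 * (LINT x:\<Omega>|lborel. (norm (u b x))\<^sup>2)
        + 2 * \<mu>f * (LINT t:{a..b}|lborel. LINT x:\<Omega>|lborel. (norm (sym_grad \<Omega> (u t) x))\<^sup>2)
      = \<rho>f / 2 * (LINT x:\<Omega>|lborel. (norm (u a x))\<^sup>2)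
        + (LINT t:{a..b}|lborel. LINT y:\<Gamma>|\<sigma>. u t y \<bullet> (S t y *v outward_normal \<Omega> y))"
proof -
  have sc: "space_C1 {a..b} \<Omega> u" and tc: "time_C1 {a..b} \<Omega> u"
    and pc: "continuous_on ({a..b} \<times> closure \<Omega>) (\<lambda>w. p (fst w) (snd w))"
    and tC: "\<And>t. t \<in> {a..b} \<Longrightarrow> tensor_C1 \<Omega> (S t)"
    using reg S by (auto simp: fluid_regular_def case_prod_beta')
  have "continuous_on ({a..b} \<times> closure \<Omega>) (\<lambda>w. S (fst w) (snd w))"
    unfolding S fluid_stress_def by (intro continuous_intros pc space_C1_D(3)[OF sc])
  thus Sc: "continuous_on ({a..b} \<times> closure \<Omega>) (\<lambda>(t, x). S t x)" by (simp add: case_prod_beta')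
  define e where "e t x = \<rho>f / 2 * (u t x \<bullet> u t x)" for t x
  define k where "k t x = \<rho>f * (time_deriv {a..b} u t x \<bullet> u t x)" for t x
  define w where "w t x = 2 * \<mu>f * (norm (sym_grad \<Omega> (u t) x))\<^sup>2" for t x
  define P where "P t = (LINT y:\<Gamma>|\<sigma>. u t y \<bullet> (S t y *v outward_normal \<Omega> y))" for t
  have W: "set_integrable \<sigma> \<Gamma> (\<lambda>y. u t y \<bullet> (S t y *v outward_normal \<Omega> y))"
    "(LINT x:\<Omega>|lborel. (\<rho>f *\<^sub>R time_deriv {a..b} u t x) \<bullet> u t x + S t x \<bullet> grad \<Omega> (u t) x) = P t"
    if t: "t \<in> {a..b}" for t
  proof -
    \<comment> \<open>The momentum equation identifies the divergence of the stress with a multiple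
      of this field, which is continuous up to the boundary; that multiple is the \<open>q\<close>
      of \<open>interface_work\<close>.\<close>
    have "continuous_on (closure \<Omega>) (time_deriv {a..b} u t)"
      by (rule continuous_on_slice_right[where k = "time_deriv {a..b} u", OF _ t]) (use tc in \<open>simp add: time_C1_def\<close>)
    hence q: "continuous_on (closure \<Omega>) (\<lambda>x. \<rho>f *\<^sub>R time_deriv {a..b} u t x)"
      by (intro continuous_intros)
    have q': "tensor_div \<Omega> (S t) x = \<rho>f *\<^sub>R time_deriv {a..b} u t x" if "x \<in> \<Omega>" for x
      using eq[OF t that] by simp
    note I = interface_work[OF continuous_on_slice_right[OF Sc t] tC[OF t] space_C1_D(5)[OF sc t]
      space_C1_D(7)[OF sc t] space_C1_D(6)[OF sc t] q q' D0[OF t] N0[OF t]]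
    show "set_integrable \<sigma> \<Gamma> (\<lambda>y. u t y \<bullet> (S t y *v outward_normal \<Omega> y))" by (rule I(1))
    show "(LINT x:\<Omega>|lborel. (\<rho>f *\<^sub>R time_deriv {a..b} u t x) \<bullet> u t x + S t x \<bullet> grad \<Omega> (u t) x) = P t"
      unfolding P_def by (rule I(2))
  qed
  show "t \<in> {a..b} \<Longrightarrow> set_integrable \<sigma> \<Gamma> (\<lambda>y. u t y \<bullet> (S t y *v outward_normal \<Omega> y))" by (rule W(1))
  have k: "continuous_on ({a..b} \<times> closure \<Omega>) (\<lambda>(t, x). k t x)"
    unfolding k_def case_prod_beta' by (intro continuous_intros space_C1_D(1)[OF sc] time_C1_D[OF tc])
  have w: "continuous_on ({a..b} \<times> closure \<Omega>) (\<lambda>(t, x). w t x)"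
    unfolding w_def case_prod_beta' by (intro continuous_intros space_C1_D(3)[OF sc])
  have e: "((\<lambda>t. e t x) has_vector_derivative k t x) (at t within {a..b})" if "t \<in> {a..b}" "x \<in> \<Omega>" for t x
  proof -
    have "((\<lambda>t. u t x) has_vector_derivative time_deriv {a..b} u t x) (at t within {a..b})"
      using time_deriv_works[OF tc that(1)] that(2) closure_subset[of \<Omega>] by auto
    from has_vector_derivative_inner_self[OF this, of "\<rho>f / 2"]
    show ?thesis unfolding e_def k_def by simp
  qed
  have e': "set_integrable lborel \<Omega> (e t)" if "t \<in> {a..b}" for t
    unfolding e_def by (intro set_integrable_continuous_closure continuous_intros space_C1_D(5)[OF sc that])
  have P: "(LINT x:\<Omega>|lborel. k t x + w t x) = P t" if t: "t \<in> {a..b}" for t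
  proof -
    have "(LINT x:\<Omega>|lborel. k t x + w t x) =
      (LINT x:\<Omega>|lborel. (\<rho>f *\<^sub>R time_deriv {a..b} u t x) \<bullet> u t x + S t x \<bullet> grad \<Omega> (u t) x)"
    proof (rule set_lebesgue_integral_cong)
      show "\<forall>x. x \<in> \<Omega> \<longrightarrow> k t x + w t x = (\<rho>f *\<^sub>R time_deriv {a..b} u t x) \<bullet> u t x + S t x \<bullet> grad \<Omega> (u t) x"
      proof (intro allI impI)
        fix x assume "x \<in> \<Omega>"
        hence "divg \<Omega> (u t) x = 0" using eq[OF t] by simp
        thus "k t x + w t x = (\<rho>f *\<^sub>R time_deriv {a..b} u t x) \<bullet> u t x + S t x \<bullet> grad \<Omega> (u t) x"
          by (simp add: k_def w_def S fluid_stress_inner)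
      qed
    qed (use open_bounded in auto)
    thus ?thesis using W(2)[OF t] by simp
  qed
  note E = open_bounded ab k w e e' P
  show "set_integrable lborel {a..b} (\<lambda>t. LINT y:\<Gamma>|\<sigma>. u t y \<bullet> (S t y *v outward_normal \<Omega> y))"
    using energy_balance_integrable[OF E] unfolding P_def .
  show "\<rho>f / 2 * (LINT x:\<Omega>|lborel. (norm (u b x))\<^sup>2)
        + 2 * \<mu>f * (LINT t:{a..b}|lborel. LINT x:\<Omega>|lborel. (norm (sym_grad \<Omega> (u t) x))\<^sup>2)
      = \<rho>f / 2 * (LINT x:\<Omega>|lborel. (norm (u a x))\<^sup>2)
        + (LINT t:{a..b}|lborel. LINT y:\<Gamma>|\<sigma>. u t y \<bullet> (S t y *v outward_normal \<Omega> y))"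
    using energy_balance[OF E] unfolding P_def e_def w_def
    by (simp add: power2_norm_eq_inner)
qed

lemma
  fixes \<eta> \<xi> :: "real \<Rightarrow> real^'d \<Rightarrow> real^'d"
  assumes reg: "structure_regular \<mu>s lam \<Omega> {a..b} \<eta> \<xi>"
    and S: "\<And>t. S t = structure_stress \<mu>s lam \<Omega> (\<eta> t)"
    and eq: "\<And>t x. t \<in> {a..b} \<Longrightarrow> x \<in> \<Omega> \<Longrightarrow>
      time_deriv {a..b} \<eta> t x = \<xi> t x \<and> \<rho>s *\<^sub>R time_deriv {a..b} \<xi> t x - tensor_div \<Omega> (S t) x = 0"
    and D0: "\<And>t x. t \<in> {a..b} \<Longrightarrow> x \<in> D \<Longrightarrow> \<xi> t x = 0"
    and N0: "\<And>t. t \<in> {a..b} \<Longrightarrow> AE x in \<sigma>. x \<in> frontier \<Omega> - \<Gamma> - D \<longrightarrow> S t x *v outward_normal \<Omega> x = 0"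
  shows structure_stress_continuous: "continuous_on ({a..b} \<times> closure \<Omega>) (\<lambda>(t, x). S t x)"
    and structure_work_integrable: "t \<in> {a..b} \<Longrightarrow> set_integrable \<sigma> \<Gamma> (\<lambda>y. \<xi> t y \<bullet> (S t y *v outward_normal \<Omega> y))"
    and structure_work_integrable_time: "set_integrable lborel {a..b} (\<lambda>t. LINT y:\<Gamma>|\<sigma>. \<xi> t y \<bullet> (S t y *v outward_normal \<Omega> y))"
    and structure_energy_balance: "(LINT x:\<Omega>|lborel. \<rho>s / 2 * (norm (\<xi> b x))\<^sup>2 +
          (\<mu>s * (norm (sym_grad \<Omega> (\<eta> b) x))\<^sup>2 + lam / 2 * (divg \<Omega> (\<eta> b) x)\<^sup>2))
      = (LINT x:\<Omega>|lborel. \<rho>s / 2 * (norm (\<xi> a x))\<^sup>2 +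
          (\<mu>s * (norm (sym_grad \<Omega> (\<eta> a) x))\<^sup>2 + lam / 2 * (divg \<Omega> (\<eta> a) x)\<^sup>2))
        + (LINT t:{a..b}|lborel. LINT y:\<Gamma>|\<sigma>. \<xi> t y \<bullet> (S t y *v outward_normal \<Omega> y))"
proof -
  have sc\<eta>: "space_C1 {a..b} \<Omega> \<eta>" and tc\<eta>: "time_C1 {a..b} \<Omega> \<eta>"
    and sc: "space_C1 {a..b} \<Omega> \<xi>" and tc: "time_C1 {a..b} \<Omega> \<xi>"
    and tC: "\<And>t. t \<in> {a..b} \<Longrightarrow> tensor_C1 \<Omega> (S t)"
    using reg S by (auto simp: structure_regular_def)
  have "continuous_on ({a..b} \<times> closure \<Omega>) (\<lambda>w. S (fst w) (snd w))"
    unfolding S structure_stress_def by (intro continuous_intros space_C1_D(3,4)[OF sc\<eta>])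
  thus Sc: "continuous_on ({a..b} \<times> closure \<Omega>) (\<lambda>(t, x). S t x)" by (simp add: case_prod_beta')
  define e where "e t x = \<rho>s / 2 * (\<xi> t x \<bullet> \<xi> t x) +
     (\<mu>s * (sym_grad \<Omega> (\<eta> t) x \<bullet> sym_grad \<Omega> (\<eta> t) x) + lam / 2 * (divg \<Omega> (\<eta> t) x \<bullet> divg \<Omega> (\<eta> t) x))" for t x
  \<comment> \<open>Nothing is dissipated in the structure: the stress power is the rate of the
    elastic energy and joins \<open>k\<close>, leaving zero in the place of the dissipation
    density.\<close>
  define k where "k t x = \<rho>s * (time_deriv {a..b} \<xi> t x \<bullet> \<xi> t x) + S t x \<bullet> grad \<Omega> (\<xi> t) x" for t x
  define P where "P t = (LINT y:\<Gamma>|\<sigma>. \<xi> t y \<bullet> (S t y *v outward_normal \<Omega> y))" for t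
  have W: "set_integrable \<sigma> \<Gamma> (\<lambda>y. \<xi> t y \<bullet> (S t y *v outward_normal \<Omega> y))"
    "(LINT x:\<Omega>|lborel. (\<rho>s *\<^sub>R time_deriv {a..b} \<xi> t x) \<bullet> \<xi> t x + S t x \<bullet> grad \<Omega> (\<xi> t) x) = P t"
    if t: "t \<in> {a..b}" for t
  proof -
    have "continuous_on (closure \<Omega>) (time_deriv {a..b} \<xi> t)"
      by (rule continuous_on_slice_right[where k = "time_deriv {a..b} \<xi>", OF _ t]) (use tc in \<open>simp add: time_C1_def\<close>)
    hence q: "continuous_on (closure \<Omega>) (\<lambda>x. \<rho>s *\<^sub>R time_deriv {a..b} \<xi> t x)"
      by (intro continuous_intros)
    have q': "tensor_div \<Omega> (S t) x = \<rho>s *\<^sub>R time_deriv {a..b} \<xi> t x" if "x \<in> \<Omega>" for x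
      using eq[OF t that] by simp
    note I = interface_work[OF continuous_on_slice_right[OF Sc t] tC[OF t] space_C1_D(5)[OF sc t]
      space_C1_D(7)[OF sc t] space_C1_D(6)[OF sc t] q q' D0[OF t] N0[OF t]]
    show "set_integrable \<sigma> \<Gamma> (\<lambda>y. \<xi> t y \<bullet> (S t y *v outward_normal \<Omega> y))" by (rule I(1))
    show "(LINT x:\<Omega>|lborel. (\<rho>s *\<^sub>R time_deriv {a..b} \<xi> t x) \<bullet> \<xi> t x + S t x \<bullet> grad \<Omega> (\<xi> t) x) = P t"
      unfolding P_def by (rule I(2))
  qed
  show "t \<in> {a..b} \<Longrightarrow> set_integrable \<sigma> \<Gamma> (\<lambda>y. \<xi> t y \<bullet> (S t y *v outward_normal \<Omega> y))" by (rule W(1))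
  have Sc': "continuous_on ({a..b} \<times> closure \<Omega>) (\<lambda>w. S (fst w) (snd w))" using Sc by (simp add: case_prod_beta')
  have k: "continuous_on ({a..b} \<times> closure \<Omega>) (\<lambda>(t, x). k t x)"
    unfolding k_def case_prod_beta' by (intro continuous_intros space_C1_D(1,2)[OF sc] time_C1_D[OF tc] Sc')
  have w: "continuous_on ({a..b} \<times> closure \<Omega>) (\<lambda>(t, x). 0 :: real)" by (simp add: case_prod_beta')
  have e: "((\<lambda>t. e t x) has_vector_derivative k t x) (at t within {a..b})" if "t \<in> {a..b}" "x \<in> \<Omega>" for t x
  proof -
    have 1: "((\<lambda>t. \<xi> t x) has_vector_derivative time_deriv {a..b} \<xi> t x) (at t within {a..b})"
      using time_deriv_works[OF tc that(1)] that(2) closure_subset[of \<Omega>] by auto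
    have g: "((\<lambda>s. grad \<Omega> (\<eta> s) x) has_vector_derivative grad \<Omega> (\<xi> t) x) (at t within {a..b})"
      using eq by (intro grad_time_derivative[OF open_bounded(1) sc\<eta> tc\<eta> sc _ that]) auto
    have 2: "((\<lambda>s. sym_grad \<Omega> (\<eta> s) x) has_vector_derivative sym_grad \<Omega> (\<xi> t) x) (at t within {a..b})"
      unfolding sym_grad_def
      using bounded_linear.has_vector_derivative[OF bounded_linear_scaleR_right[of "1/2"]
        has_vector_derivative_add[OF g bounded_linear.has_vector_derivative[OF bounded_linear_transpose g]]] .
    have 3: "((\<lambda>s. divg \<Omega> (\<eta> s) x) has_vector_derivative divg \<Omega> (\<xi> t) x) (at t within {a..b})"
      unfolding divg_def by (rule bounded_linear.has_vector_derivative[OF bounded_linear_trace g])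
    have "((\<lambda>t. e t x) has_vector_derivative 2 * (\<rho>s / 2) * (time_deriv {a..b} \<xi> t x \<bullet> \<xi> t x) +
        (2 * \<mu>s * (sym_grad \<Omega> (\<xi> t) x \<bullet> sym_grad \<Omega> (\<eta> t) x) + 2 * (lam / 2) * (divg \<Omega> (\<xi> t) x \<bullet> divg \<Omega> (\<eta> t) x)))
        (at t within {a..b})"
      unfolding e_def
      by (intro has_vector_derivative_add has_vector_derivative_inner_self 1 2 3)
    thus ?thesis unfolding k_def S structure_stress_inner by (simp add: inner_commute mult.commute)
  qed
  have e': "set_integrable lborel \<Omega> (e t)" if t: "t \<in> {a..b}" for t
  proof -
    have "continuous_on (closure \<Omega>) (sym_grad \<Omega> (\<eta> t))"
      by (rule continuous_on_slice_right[where k = "\<lambda>t. sym_grad \<Omega> (\<eta> t)", OF _ t])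
        (use space_C1_D(3)[OF sc\<eta>] in \<open>simp add: case_prod_beta'\<close>)
    moreover have "continuous_on (closure \<Omega>) (divg \<Omega> (\<eta> t))"
      by (rule continuous_on_slice_right[where k = "\<lambda>t. divg \<Omega> (\<eta> t)", OF _ t])
        (use space_C1_D(4)[OF sc\<eta>] in \<open>simp add: case_prod_beta'\<close>)
    ultimately show ?thesis unfolding e_def
      by (intro set_integrable_continuous_closure continuous_intros space_C1_D(5)[OF sc t])
  qed
  have P: "(LINT x:\<Omega>|lborel. k t x + 0) = P t" if t: "t \<in> {a..b}" for t
    using W(2)[OF t] by (simp add: k_def)
  note E = open_bounded ab k w e e' P
  show "set_integrable lborel {a..b} (\<lambda>t. LINT y:\<Gamma>|\<sigma>. \<xi> t y \<bullet> (S t y *v outward_normal \<Omega> y))"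
    using energy_balance_integrable[OF E] unfolding P_def .
  show "(LINT x:\<Omega>|lborel. \<rho>s / 2 * (norm (\<xi> b x))\<^sup>2 +
          (\<mu>s * (norm (sym_grad \<Omega> (\<eta> b) x))\<^sup>2 + lam / 2 * (divg \<Omega> (\<eta> b) x)\<^sup>2))
      = (LINT x:\<Omega>|lborel. \<rho>s / 2 * (norm (\<xi> a x))\<^sup>2 +
          (\<mu>s * (norm (sym_grad \<Omega> (\<eta> a) x))\<^sup>2 + lam / 2 * (divg \<Omega> (\<eta> a) x)\<^sup>2))
        + (LINT t:{a..b}|lborel. LINT y:\<Gamma>|\<sigma>. \<xi> t y \<bullet> (S t y *v outward_normal \<Omega> y))"
    using energy_balance[OF E] unfolding P_def e_def
    by (simp add: power2_norm_eq_inner power2_eq_square[of "divg _ _ _"] inner_real_def set_lebesgue_integral_def)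
qed

end

section \<open>The interface terms\<close>

lemma L2_norm_on_power2: "(L2_norm_on M A v)\<^sup>2 = (LINT x:A|M. (norm (v x))\<^sup>2)"
  unfolding L2_norm_on_def set_lebesgue_integral_def
  by (intro real_sqrt_pow2 Bochner_Integration.integral_nonneg) auto

lemma set_integral_lebesgue:
  fixes f :: "'a::euclidean_space \<Rightarrow> real"
  assumes "set_integrable lborel A f"
  shows "(LINT x:A|lebesgue. f x) = (LINT x:A|lborel. f x)"
  using assms unfolding set_lebesgue_integral_def set_integrable_def
  by (intro integral_completion borel_measurable_integrable)

lemma set_integrable_bounded_AE:
  fixes f :: "'a \<Rightarrow> real"
  assumes "set_borel_measurable M A f" "AE x in M. x \<in> A \<longrightarrow> \<bar>f x\<bar> \<le> B" "A \<in> sets M" "emeasure M A < \<infinity>"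
  shows "set_integrable M A f"
  unfolding set_integrable_def
proof (rule Bochner_Integration.integrable_bound)
  show "integrable M (\<lambda>x. \<bar>B\<bar> * indicator A x)"
    using assms by (intro integrable_mult_right integrable_real_indicator) auto
  show "AE x in M. norm (indicator A x *\<^sub>R f x) \<le> norm (\<bar>B\<bar> * indicator A x)"
    using assms(2) by eventually_elim (auto split: split_indicator)
qed (use assms in \<open>simp add: set_borel_measurable_def\<close>)

lemma set_integrable_continuous_Icc:
  fixes f :: "real \<Rightarrow> real"
  assumes "continuous_on {a..b} f" shows "set_integrable lborel {a..b} f"
proof -
  obtain B where "\<And>x. x \<in> {a..b} \<Longrightarrow> norm (f x) \<le> B" using continuous_on_compact_bound[OF _ assms] by blast
  thus ?thesis by (intro set_integrable_bounded_continuous[OF _ _ assms]) auto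
qed

lemma continuous_on_set_integral:
  fixes f :: "real \<Rightarrow> 'a \<Rightarrow> real"
  assumes \<Gamma>: "\<Gamma> \<in> sets M" "emeasure M \<Gamma> < \<infinity>"
    and meas: "\<And>t. t \<in> I \<Longrightarrow> set_borel_measurable M \<Gamma> (f t)"
    and cont: "\<And>y. y \<in> \<Gamma> \<Longrightarrow> continuous_on I (\<lambda>t. f t y)"
    and bd: "\<And>t. t \<in> I \<Longrightarrow> AE y in M. y \<in> \<Gamma> \<longrightarrow> \<bar>f t y\<bar> \<le> B"
  shows "continuous_on I (\<lambda>t. LINT y:\<Gamma>|M. f t y)"
  unfolding continuous_on_sequentially
proof (intro ballI allI impI)
  fix s t assume t: "t \<in> I" and s: "(\<forall>n. s n \<in> I) \<and> s \<longlonglongrightarrow> t"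
  show "((\<lambda>t. LINT y:\<Gamma>|M. f t y) \<circ> s) \<longlonglongrightarrow> (LINT y:\<Gamma>|M. f t y)"
    unfolding o_def set_lebesgue_integral_def
  proof (rule integral_dominated_convergence[where w = "\<lambda>y. \<bar>B\<bar> * indicator \<Gamma> y"])
    show "(\<lambda>y. indicator \<Gamma> y *\<^sub>R f t y) \<in> borel_measurable M"
      "\<And>n. (\<lambda>y. indicator \<Gamma> y *\<^sub>R f (s n) y) \<in> borel_measurable M"
      using meas t s by (auto simp: set_borel_measurable_def)
    show "integrable M (\<lambda>y. \<bar>B\<bar> * indicator \<Gamma> y)"
      using \<Gamma> by (intro integrable_mult_right integrable_real_indicator) auto
    show "AE y in M. (\<lambda>n. indicator \<Gamma> y *\<^sub>R f (s n) y) \<longlonglongrightarrow> indicator \<Gamma> y *\<^sub>R f t y"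
    proof (rule AE_I2)
      fix y
      show "(\<lambda>n. indicator \<Gamma> y *\<^sub>R f (s n) y) \<longlonglongrightarrow> indicator \<Gamma> y *\<^sub>R f t y"
        using continuous_on_tendsto_compose[OF cont, of y s t] s t
        by (cases "y \<in> \<Gamma>") (auto intro!: tendsto_intros)
    qed
    fix n
    have "s n \<in> I" using s by blast
    from bd[OF this] show "AE y in M. norm (indicator \<Gamma> y *\<^sub>R f (s n) y) \<le> \<bar>B\<bar> * indicator \<Gamma> y"
      by eventually_elim (auto split: split_indicator)
  qed
qed

lemma set_borel_measurable_norm_power2:
  assumes "set_borel_measurable M A v"
  shows "set_borel_measurable M A (\<lambda>y. (norm (v y))\<^sup>2)"
proof -
  have "(\<lambda>y. (norm (indicator A y *\<^sub>R v y))\<^sup>2) \<in> borel_measurable M"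
    using assms unfolding set_borel_measurable_def by measurable
  also have "(\<lambda>y. (norm (indicator A y *\<^sub>R v y))\<^sup>2) = (\<lambda>y. indicator A y *\<^sub>R (norm (v y))\<^sup>2)"
    by (rule ext) (auto split: split_indicator)
  finally show ?thesis by (simp add: set_borel_measurable_def)
qed

text \<open>Continuity in time at every point of \<open>\<Gamma>\<close> and a uniform bound make
  the squared norm continuous in time, by dominated convergence, and hence integrable over the time
  step. The bound is an almost everywhere one so that it covers tractions, whose normal is
  controlled only up to a null set.\<close>

lemma
  fixes w :: "real \<Rightarrow> 'a \<Rightarrow> 'b::euclidean_space"
  assumes \<Gamma>: "\<Gamma> \<in> sets M" "emeasure M \<Gamma> < \<infinity>"
    and meas: "\<And>t. t \<in> {a..b} \<Longrightarrow> set_borel_measurable M \<Gamma> (w t)"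
    and cont: "\<And>y. y \<in> \<Gamma> \<Longrightarrow> continuous_on {a..b} (\<lambda>t. w t y)"
    and bd: "\<And>t. t \<in> {a..b} \<Longrightarrow> AE y in M. y \<in> \<Gamma> \<longrightarrow> norm (w t y) \<le> B"
  shows bounded_trace_L2: "t \<in> {a..b} \<Longrightarrow> in_L2_on M \<Gamma> (w t)"
    and bounded_trace_integrable_time: "set_integrable lborel {a..b} (\<lambda>t. (L2_norm_on M \<Gamma> (w t))\<^sup>2)"
proof -
  have meas2: "set_borel_measurable M \<Gamma> (\<lambda>y. (norm (w t y))\<^sup>2)" if "t \<in> {a..b}" for t
    by (rule set_borel_measurable_norm_power2[OF meas[OF that]])
  have bd2: "AE y in M. y \<in> \<Gamma> \<longrightarrow> \<bar>(norm (w t y))\<^sup>2\<bar> \<le> B\<^sup>2" if "t \<in> {a..b}" for t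
    using bd[OF that] by eventually_elim (auto intro!: power_mono)
  show "t \<in> {a..b} \<Longrightarrow> in_L2_on M \<Gamma> (w t)"
    unfolding in_L2_on_def using set_integrable_bounded_AE[OF meas2 bd2 \<Gamma>] meas by blast
  show "set_integrable lborel {a..b} (\<lambda>t. (L2_norm_on M \<Gamma> (w t))\<^sup>2)"
    unfolding L2_norm_on_power2
    by (intro set_integrable_continuous_Icc continuous_on_set_integral[OF \<Gamma> meas2 _ bd2] continuous_intros cont)
qed

context
  fixes \<Omega> \<Gamma> :: "(real^'d) set" and \<sigma> :: "(real^'d) measure"
  assumes dom: "lipschitz_domain \<Omega>" and surf: "surface_measure \<Omega> \<sigma>"
    and \<Gamma>: "\<Gamma> \<in> sets borel" "\<Gamma> \<subseteq> frontier \<Omega>"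
begin

lemma interface_finite: "\<Gamma> \<in> sets \<sigma>" "emeasure \<sigma> \<Gamma> < \<infinity>"
proof -
  show 1: "\<Gamma> \<in> sets \<sigma>" by (rule surface_sets[OF dom surf \<Gamma>(1)])
  have "emeasure \<sigma> \<Gamma> \<le> emeasure \<sigma> (frontier \<Omega>)"
    using \<Gamma> by (intro emeasure_mono surface_sets[OF dom surf]) auto
  thus "emeasure \<sigma> \<Gamma> < \<infinity>" using frontier_finite[OF dom surf] by order
qed

lemma interface_closure: "\<Gamma> \<subseteq> closure \<Omega>"
  using \<Gamma>(2) by (auto simp: frontier_def)

lemma trace_measurable:
  fixes v :: "real^'d \<Rightarrow> 'b::euclidean_space"
  assumes "continuous_on (closure \<Omega>) v"
  shows "set_borel_measurable \<sigma> \<Gamma> v"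
proof -
  obtain \<beta> where \<beta>: "sets \<beta> = sets borel" "\<sigma> = completion \<beta>" by (rule surface_completion[OF dom surf])
  have "(\<lambda>y. indicator \<Gamma> y *\<^sub>R v y) \<in> borel_measurable borel"
    by (intro borel_measurable_continuous_on_indicator \<Gamma> continuous_on_subset[OF assms interface_closure])
  hence "(\<lambda>y. indicator \<Gamma> y *\<^sub>R v y) \<in> borel_measurable \<beta>"
    by (simp add: measurable_cong_sets[OF \<beta>(1) refl])
  thus ?thesis unfolding set_borel_measurable_def \<beta>(2) by (rule measurable_completion)
qed

lemma traction_measurable:
  fixes S :: "real^'d \<Rightarrow> real^'d^'d"
  assumes "continuous_on (closure \<Omega>) S"
  shows "set_borel_measurable \<sigma> \<Gamma> (\<lambda>y. S y *v outward_normal \<Omega> y)"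
proof -
  have "(\<lambda>y. (indicator \<Gamma> y *\<^sub>R S y) *v (indicator (frontier \<Omega>) y *\<^sub>R outward_normal \<Omega> y)) \<in> borel_measurable \<sigma>"
  proof (rule borel_measurable_continuous_Pair[where H = "\<lambda>A x. A *v x"])
    show "(\<lambda>y. indicator \<Gamma> y *\<^sub>R S y) \<in> borel_measurable \<sigma>"
      using trace_measurable[OF assms] by (simp add: set_borel_measurable_def)
    show "continuous_on UNIV (\<lambda>w. fst w *v snd w :: real^'d)"
      by (intro continuous_intros)
  qed (rule outward_normal_measurable[OF dom surf])
  also have "(\<lambda>y. (indicator \<Gamma> y *\<^sub>R S y) *v (indicator (frontier \<Omega>) y *\<^sub>R outward_normal \<Omega> y)) =
      (\<lambda>y. indicator \<Gamma> y *\<^sub>R (S y *v outward_normal \<Omega> y))"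
    by (rule ext) (use \<Gamma>(2) in \<open>auto split: split_indicator\<close>)
  finally show ?thesis by (simp add: set_borel_measurable_def)
qed

lemma trace_L2:
  fixes v :: "real^'d \<Rightarrow> 'b::euclidean_space"
  assumes v: "continuous_on (closure \<Omega>) v"
  shows "in_L2_on \<sigma> \<Gamma> v"
proof -
  obtain B where "\<And>x. x \<in> closure \<Omega> \<Longrightarrow> norm (v x) \<le> B"
    using continuous_on_compact_bound[OF domain_simps(3)[OF dom surf] v] by blast
  thus ?thesis using interface_closure
    \<comment> \<open>A field without time dependence is treated as constant over the degenerate
      time interval from 0 to 0.\<close>
    by (intro bounded_trace_L2[OF interface_finite trace_measurable[OF v] continuous_on_const, where a = 0 and b = 0 and t = 0 and B = B]) auto
qed

lemma
  fixes v :: "real \<Rightarrow> real^'d \<Rightarrow> real^'d"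
  assumes v: "continuous_on ({a..b} \<times> closure \<Omega>) (\<lambda>(t, x). v t x)"
  shows velocity_L2: "t \<in> {a..b} \<Longrightarrow> in_L2_on \<sigma> \<Gamma> (v t)"
    and velocity_integrable_time: "set_integrable lborel {a..b} (\<lambda>t. (L2_norm_on \<sigma> \<Gamma> (v t))\<^sup>2)"
proof -
  have "compact ({a..b} \<times> closure \<Omega>)" using domain_simps(3)[OF dom surf] by (intro compact_Times) auto
  then obtain B where B: "\<And>w. w \<in> {a..b} \<times> closure \<Omega> \<Longrightarrow> norm (case w of (t, x) \<Rightarrow> v t x) \<le> B"
    using continuous_on_compact_bound[OF _ v] by blast
  have B': "norm (v t y) \<le> B" if "t \<in> {a..b}" "y \<in> \<Gamma>" for t y
    using B[of "(t, y)"] that interface_closure by auto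
  have A: "set_borel_measurable \<sigma> \<Gamma> (v t)" "AE y in \<sigma>. y \<in> \<Gamma> \<longrightarrow> norm (v t y) \<le> B" if "t \<in> {a..b}" for t
    using trace_measurable[OF continuous_on_slice_right[OF v that]] B'[OF that] by auto
  have C: "continuous_on {a..b} (\<lambda>t. v t y)" if "y \<in> \<Gamma>" for y
    using continuous_on_slice_left[OF v] that interface_closure by blast
  show "t \<in> {a..b} \<Longrightarrow> in_L2_on \<sigma> \<Gamma> (v t)" by (rule bounded_trace_L2[OF interface_finite A(1) C A(2)])
  show "set_integrable lborel {a..b} (\<lambda>t. (L2_norm_on \<sigma> \<Gamma> (v t))\<^sup>2)"
    by (rule bounded_trace_integrable_time[OF interface_finite A(1) C A(2)])
qed

text \<open>A traction is bounded by the norm of the stress wherever the normal has unit length,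
  which holds almost everywhere on the boundary.\<close>

lemma
  fixes S :: "real \<Rightarrow> real^'d \<Rightarrow> real^'d^'d"
  assumes S: "continuous_on ({a..b} \<times> closure \<Omega>) (\<lambda>(t, x). S t x)"
  shows traction_L2: "t \<in> {a..b} \<Longrightarrow> in_L2_on \<sigma> \<Gamma> (\<lambda>y. S t y *v outward_normal \<Omega> y)"
    and traction_integrable_time: "set_integrable lborel {a..b} (\<lambda>t. (L2_norm_on \<sigma> \<Gamma> (\<lambda>y. S t y *v outward_normal \<Omega> y))\<^sup>2)"
proof -
  have "compact ({a..b} \<times> closure \<Omega>)" using domain_simps(3)[OF dom surf] by (intro compact_Times) auto
  then obtain B where B: "\<And>w. w \<in> {a..b} \<times> closure \<Omega> \<Longrightarrow> norm (case w of (t, x) \<Rightarrow> S t x) \<le> B"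
    using continuous_on_compact_bound[OF _ S] by blast
  have A1: "set_borel_measurable \<sigma> \<Gamma> (\<lambda>y. S t y *v outward_normal \<Omega> y)" if "t \<in> {a..b}" for t
    by (rule traction_measurable[OF continuous_on_slice_right[OF S that]])
  have A2: "AE y in \<sigma>. y \<in> \<Gamma> \<longrightarrow> norm (S t y *v outward_normal \<Omega> y) \<le> B" if t: "t \<in> {a..b}" for t
    using outward_normal_AE_unit[OF dom surf]
  proof eventually_elim
    fix y assume n: "y \<in> frontier \<Omega> \<longrightarrow> norm (outward_normal \<Omega> y) = 1"
    show "y \<in> \<Gamma> \<longrightarrow> norm (S t y *v outward_normal \<Omega> y) \<le> B"
    proof
      assume y: "y \<in> \<Gamma>"
      have "norm (S t y) \<le> B" using B[of "(t, y)"] y t interface_closure by auto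
      thus "norm (S t y *v outward_normal \<Omega> y) \<le> B"
        using norm_matrix_vector_le[of "S t y" "outward_normal \<Omega> y"] n y \<Gamma>(2) by auto
    qed
  qed
  have C: "continuous_on {a..b} (\<lambda>t. S t y *v outward_normal \<Omega> y)" if "y \<in> \<Gamma>" for y
    using continuous_on_slice_left[OF S] that interface_closure by (intro continuous_intros) blast
  show "t \<in> {a..b} \<Longrightarrow> in_L2_on \<sigma> \<Gamma> (\<lambda>y. S t y *v outward_normal \<Omega> y)"
    by (rule bounded_trace_L2[OF interface_finite A1 C A2])
  show "set_integrable lborel {a..b} (\<lambda>t. (L2_norm_on \<sigma> \<Gamma> (\<lambda>y. S t y *v outward_normal \<Omega> y))\<^sup>2)"
    by (rule bounded_trace_integrable_time[OF interface_finite A1 C A2])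
qed

end

text \<open>The polarisation identity turns the interface work and the interface energy into
  \<open>(\<bar>L u + f\<bar>\<^sup>2 + \<bar>L \<xi> + s\<bar>\<^sup>2) / (2 L)\<close>, which the Robin conditions express by the shifted data.\<close>

lemma robin_inequality:
  fixes u \<xi> f s u' \<xi>' f' s' :: "'a::real_inner"
  assumes L: "L > 0" and F: "L *\<^sub>R u + f = (1/2) *\<^sub>R ((L *\<^sub>R u' + L *\<^sub>R \<xi>') + (f' - s'))"
    and S: "L *\<^sub>R \<xi> + s = (1/2) *\<^sub>R ((L *\<^sub>R u' + L *\<^sub>R \<xi>') - (f' - s'))"
  shows "u \<bullet> f + \<xi> \<bullet> s + (L/2 * ((norm u)\<^sup>2 + (norm \<xi>)\<^sup>2) + 1 / (2 * L) * ((norm f)\<^sup>2 + (norm s)\<^sup>2))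
    \<le> L/2 * ((norm u')\<^sup>2 + (norm \<xi>')\<^sup>2) + 1 / (2 * L) * ((norm f')\<^sup>2 + (norm s')\<^sup>2)"
proof -
  have 1: "(norm (L *\<^sub>R x + y))\<^sup>2 = L\<^sup>2 * (norm x)\<^sup>2 + 2 * L * (x \<bullet> y) + (norm y)\<^sup>2" for x y :: 'a
    unfolding power2_norm_eq_inner
    by (simp add: inner_add_left inner_add_right inner_commute[of y x] power2_eq_square algebra_simps)
  have 2: "(norm ((1/2) *\<^sub>R (x + y)))\<^sup>2 + (norm ((1/2) *\<^sub>R (x - y)))\<^sup>2 = ((norm x)\<^sup>2 + (norm y)\<^sup>2) / 2" for x y :: 'a
    unfolding power2_norm_eq_inner
    by (simp add: inner_add_left inner_add_right inner_diff_left inner_diff_right field_simps)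
  have 3: "(norm (x + y))\<^sup>2 \<le> 2 * (norm x)\<^sup>2 + 2 * (norm y)\<^sup>2" for x y :: 'a
    using zero_le_power2[of "norm (x - y)"] unfolding power2_norm_eq_inner
    by (simp add: inner_add_left inner_add_right inner_diff_left inner_diff_right)
  \<comment> \<open>The two Robin data are half the sum and half the difference of
    \<open>L *\<^sub>R u' + L *\<^sub>R \<xi>'\<close> and \<open>f' - s'\<close>, so their squared
    norms add up without a mixed term.\<close>
  have "(norm (L *\<^sub>R u + f))\<^sup>2 + (norm (L *\<^sub>R \<xi> + s))\<^sup>2 = ((norm (L *\<^sub>R u' + L *\<^sub>R \<xi>'))\<^sup>2 + (norm (f' - s'))\<^sup>2) / 2"
    unfolding F S by (rule 2)
  \<comment> \<open>The only loss here: half the squared norms of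
    \<open>L *\<^sub>R (u' - \<xi>')\<close> and of \<open>f' + s'\<close> are dropped. They measure
    the mismatch of the velocities and of the tractions across the interface in the previous
    data.\<close>
  also have "\<dots> \<le> L\<^sup>2 * ((norm u')\<^sup>2 + (norm \<xi>')\<^sup>2) + ((norm f')\<^sup>2 + (norm s')\<^sup>2)"
    using 3[of "L *\<^sub>R u'" "L *\<^sub>R \<xi>'"] 3[of f' "- s'"] by (simp add: power_mult_distrib algebra_simps)
  finally have "L\<^sup>2 * ((norm u)\<^sup>2 + (norm \<xi>)\<^sup>2) + 2 * L * (u \<bullet> f + \<xi> \<bullet> s) + ((norm f)\<^sup>2 + (norm s)\<^sup>2)
      \<le> L\<^sup>2 * ((norm u')\<^sup>2 + (norm \<xi>')\<^sup>2) + ((norm f')\<^sup>2 + (norm s')\<^sup>2)"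
    unfolding 1 by (simp add: algebra_simps)
  hence "(L\<^sup>2 * ((norm u)\<^sup>2 + (norm \<xi>)\<^sup>2) + 2 * L * (u \<bullet> f + \<xi> \<bullet> s) + ((norm f)\<^sup>2 + (norm s)\<^sup>2)) / (2 * L)
      \<le> (L\<^sup>2 * ((norm u')\<^sup>2 + (norm \<xi>')\<^sup>2) + ((norm f')\<^sup>2 + (norm s')\<^sup>2)) / (2 * L)"
    using L by (intro divide_right_mono) auto
  moreover have "(L\<^sup>2 * x + 2 * L * y + z) / (2 * L) = y + (L/2 * x + 1 / (2 * L) * z)" for x y z
    using L by (simp add: field_simps power2_eq_square)
  moreover have "(L\<^sup>2 * x + z) / (2 * L) = L/2 * x + 1 / (2 * L) * z" for x z
    using L by (simp add: field_simps power2_eq_square)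
  ultimately show ?thesis by simp
qed

lemma
  fixes u \<xi> f s :: "'a \<Rightarrow> 'b::{banach, second_countable_topology}"
  assumes "in_L2_on \<sigma> \<Gamma> u" "in_L2_on \<sigma> \<Gamma> \<xi>" "in_L2_on \<sigma> \<Gamma> f" "in_L2_on \<sigma> \<Gamma> s"
  shows interface_density_integrable: "set_integrable \<sigma> \<Gamma> (\<lambda>y. c * ((norm (u y))\<^sup>2 + (norm (\<xi> y))\<^sup>2) + d * ((norm (f y))\<^sup>2 + (norm (s y))\<^sup>2))"
    and interface_density_integral: "(LINT y:\<Gamma>|\<sigma>. c * ((norm (u y))\<^sup>2 + (norm (\<xi> y))\<^sup>2) + d * ((norm (f y))\<^sup>2 + (norm (s y))\<^sup>2)) =
      c * ((L2_norm_on \<sigma> \<Gamma> u)\<^sup>2 + (L2_norm_on \<sigma> \<Gamma> \<xi>)\<^sup>2) + d * ((L2_norm_on \<sigma> \<Gamma> f)\<^sup>2 + (L2_norm_on \<sigma> \<Gamma> s)\<^sup>2)"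
  using assms unfolding in_L2_on_def L2_norm_on_power2
  by (auto simp: set_integral_add)

lemma robin_inequality_integrated:
  fixes u \<xi> f s u' \<xi>' f' s' :: "'a \<Rightarrow> 'b::euclidean_space"
  assumes L: "L > 0"
    and F: "AE y in \<sigma>. y \<in> \<Gamma> \<longrightarrow> L *\<^sub>R u y + f y = (1/2) *\<^sub>R ((L *\<^sub>R u' y + L *\<^sub>R \<xi>' y) + (f' y - s' y))"
    and S: "AE y in \<sigma>. y \<in> \<Gamma> \<longrightarrow> L *\<^sub>R \<xi> y + s y = (1/2) *\<^sub>R ((L *\<^sub>R u' y + L *\<^sub>R \<xi>' y) - (f' y - s' y))"
    and L2: "in_L2_on \<sigma> \<Gamma> u" "in_L2_on \<sigma> \<Gamma> \<xi>" "in_L2_on \<sigma> \<Gamma> f" "in_L2_on \<sigma> \<Gamma> s"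
    and L2': "in_L2_on \<sigma> \<Gamma> u'" "in_L2_on \<sigma> \<Gamma> \<xi>'" "in_L2_on \<sigma> \<Gamma> f'" "in_L2_on \<sigma> \<Gamma> s'"
    and W: "set_integrable \<sigma> \<Gamma> (\<lambda>y. u y \<bullet> f y)" "set_integrable \<sigma> \<Gamma> (\<lambda>y. \<xi> y \<bullet> s y)"
  shows "(LINT y:\<Gamma>|\<sigma>. u y \<bullet> f y) + (LINT y:\<Gamma>|\<sigma>. \<xi> y \<bullet> s y) +
      (L/2 * ((L2_norm_on \<sigma> \<Gamma> u)\<^sup>2 + (L2_norm_on \<sigma> \<Gamma> \<xi>)\<^sup>2) + 1 / (2 * L) * ((L2_norm_on \<sigma> \<Gamma> f)\<^sup>2 + (L2_norm_on \<sigma> \<Gamma> s)\<^sup>2))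
    \<le> L/2 * ((L2_norm_on \<sigma> \<Gamma> u')\<^sup>2 + (L2_norm_on \<sigma> \<Gamma> \<xi>')\<^sup>2) + 1 / (2 * L) * ((L2_norm_on \<sigma> \<Gamma> f')\<^sup>2 + (L2_norm_on \<sigma> \<Gamma> s')\<^sup>2)"
proof -
  let ?J = "\<lambda>u \<xi> f s y. L/2 * ((norm (u y))\<^sup>2 + (norm (\<xi> y))\<^sup>2) + 1 / (2 * L) * ((norm (f y))\<^sup>2 + (norm (s y))\<^sup>2)"
  have WW: "set_integrable \<sigma> \<Gamma> (\<lambda>y. u y \<bullet> f y + \<xi> y \<bullet> s y)" using W by (rule set_integral_add)
  have J: "set_integrable \<sigma> \<Gamma> (?J u \<xi> f s)" by (rule interface_density_integrable[OF L2])
  have J': "set_integrable \<sigma> \<Gamma> (?J u' \<xi>' f' s')" by (rule interface_density_integrable[OF L2'])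
  have "(LINT y:\<Gamma>|\<sigma>. (u y \<bullet> f y + \<xi> y \<bullet> s y) + ?J u \<xi> f s y) \<le> (LINT y:\<Gamma>|\<sigma>. ?J u' \<xi>' f' s' y)"
    unfolding set_lebesgue_integral_def
  proof (rule integral_mono_AE)
    show "integrable \<sigma> (\<lambda>y. indicator \<Gamma> y *\<^sub>R ((u y \<bullet> f y + \<xi> y \<bullet> s y) + ?J u \<xi> f s y))"
      using set_integral_add(1)[OF WW J] by (simp add: set_integrable_def)
    show "integrable \<sigma> (\<lambda>y. indicator \<Gamma> y *\<^sub>R ?J u' \<xi>' f' s' y)" using J' by (simp add: set_integrable_def)
    show "AE y in \<sigma>. indicator \<Gamma> y *\<^sub>R ((u y \<bullet> f y + \<xi> y \<bullet> s y) + ?J u \<xi> f s y) \<le> indicator \<Gamma> y *\<^sub>R ?J u' \<xi>' f' s' y"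
      using F S
    proof eventually_elim
      fix y
      assume "y \<in> \<Gamma> \<longrightarrow> L *\<^sub>R u y + f y = (1/2) *\<^sub>R ((L *\<^sub>R u' y + L *\<^sub>R \<xi>' y) + (f' y - s' y))"
        "y \<in> \<Gamma> \<longrightarrow> L *\<^sub>R \<xi> y + s y = (1/2) *\<^sub>R ((L *\<^sub>R u' y + L *\<^sub>R \<xi>' y) - (f' y - s' y))"
      thus "indicator \<Gamma> y *\<^sub>R ((u y \<bullet> f y + \<xi> y \<bullet> s y) + ?J u \<xi> f s y) \<le> indicator \<Gamma> y *\<^sub>R ?J u' \<xi>' f' s' y"
        using robin_inequality[OF L, of "u y" "f y" "u' y" "\<xi>' y" "f' y" "s' y" "\<xi> y" "s y"]
        by (cases "y \<in> \<Gamma>") auto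
    qed
  qed
  thus ?thesis
    using W by (simp only: set_integral_add(2)[OF WW J] set_integral_add(2)[OF W]
      interface_density_integral[OF L2] interface_density_integral[OF L2'])
qed

section \<open>The energy estimate\<close>

lemma set_integral_translate:
  fixes f :: "real \<Rightarrow> real"
  assumes "set_integrable lborel {a..b} f"
  shows "set_integrable lborel {a + d..b + d} (\<lambda>t. f (t - d))"
    and "(LINT t:{a + d..b + d}|lborel. f (t - d)) = (LINT t:{a..b}|lborel. f t)"
proof -
  have ind: "(\<lambda>t. indicator {a + d..b + d} t *\<^sub>R f (t - d)) = (\<lambda>t. indicator {a..b} (- d + 1 * t) *\<^sub>R f (- d + 1 * t))"
    by (rule ext) (auto split: split_indicator)
  show "set_integrable lborel {a + d..b + d} (\<lambda>t. f (t - d))"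
    using lborel_integrable_real_affine[OF assms[unfolded set_integrable_def], of 1 "- d"]
    unfolding set_integrable_def ind by simp
  show "(LINT t:{a + d..b + d}|lborel. f (t - d)) = (LINT t:{a..b}|lborel. f t)"
    using lborel_integral_real_affine[of 1 "\<lambda>t. indicator {a..b} t *\<^sub>R f t" "- d"]
    unfolding set_lebesgue_integral_def ind by simp
qed

lemma L2_norm_on_cong: "(\<And>x. x \<in> A \<Longrightarrow> v x = w x) \<Longrightarrow> L2_norm_on M A v = L2_norm_on M A w"
  unfolding L2_norm_on_def set_lebesgue_integral_def
  by (intro arg_cong[of _ _ sqrt] Bochner_Integration.integral_cong refl) (auto split: split_indicator)

lemma elastic_norm_cong:
  assumes "open \<Omega>" "\<And>x. x \<in> \<Omega> \<Longrightarrow> v x = w x"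
  shows "elastic_norm \<mu>s lam \<Omega> v = elastic_norm \<mu>s lam \<Omega> w"
proof -
  have "sym_grad \<Omega> v x = sym_grad \<Omega> w x" "divg \<Omega> v x = divg \<Omega> w x" if "x \<in> \<Omega>" for x
    using grad_cong[OF assms(1) that assms(2)] by (simp_all add: sym_grad_def divg_def)
  thus ?thesis unfolding elastic_norm_def by (simp cong: L2_norm_on_cong)
qed

lemma elastic_norm_power2:
  assumes "\<mu>s > 0" "lam > 0"
  shows "(elastic_norm \<mu>s lam \<Omega> \<eta>)\<^sup>2 = 2 * \<mu>s * (L2_norm_on lebesgue \<Omega> (sym_grad \<Omega> \<eta>))\<^sup>2 +
    lam * (L2_norm_on lebesgue \<Omega> (divg \<Omega> \<eta>))\<^sup>2"
  using assms unfolding elastic_norm_def by (intro real_sqrt_pow2) simp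

lemma L2_norm_on_lebesgue:
  fixes v :: "'a::euclidean_space \<Rightarrow> 'b::real_normed_vector"
  assumes "lipschitz_domain \<Omega>" "continuous_on (closure \<Omega>) v"
  shows "set_integrable lborel \<Omega> (\<lambda>x. (norm (v x))\<^sup>2)"
    and "(L2_norm_on lebesgue \<Omega> v)\<^sup>2 = (LINT x:\<Omega>|lborel. (norm (v x))\<^sup>2)"
proof -
  have \<Omega>: "open \<Omega>" "bounded \<Omega>" using assms(1) by (auto simp: lipschitz_domain_def)
  have c: "continuous_on (closure \<Omega>) (\<lambda>x. (norm (v x))\<^sup>2)" by (intro continuous_intros assms(2))
  obtain B where "\<And>x. x \<in> closure \<Omega> \<Longrightarrow> norm ((norm (v x))\<^sup>2) \<le> B"
    using continuous_on_compact_bound[OF _ c] \<Omega>(2) by (auto simp: compact_closure)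
  thus 1: "set_integrable lborel \<Omega> (\<lambda>x. (norm (v x))\<^sup>2)"
    using \<Omega> closure_subset[of \<Omega>]
    by (intro set_integrable_bounded_continuous[where B = B] continuous_on_subset[OF c]) auto
  show "(L2_norm_on lebesgue \<Omega> v)\<^sup>2 = (LINT x:\<Omega>|lborel. (norm (v x))\<^sup>2)"
    unfolding L2_norm_on_power2 by (rule set_integral_lebesgue[OF 1])
qed

lemma structure_energy_lborel:
  assumes \<Omega>: "lipschitz_domain \<Omega>" and pos: "\<mu>s > 0" "lam > 0"
    and \<xi>: "continuous_on (closure \<Omega>) \<xi>" and \<eta>: "continuous_on (closure \<Omega>) (grad \<Omega> \<eta>)"
  shows "\<rho>s / 2 * (L2_norm_on lebesgue \<Omega> \<xi>)\<^sup>2 + 1 / 2 * (elastic_norm \<mu>s lam \<Omega> \<eta>)\<^sup>2 =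
    (LINT x:\<Omega>|lborel. \<rho>s / 2 * (norm (\<xi> x))\<^sup>2 +
      (\<mu>s * (norm (sym_grad \<Omega> \<eta> x))\<^sup>2 + lam / 2 * (divg \<Omega> \<eta> x)\<^sup>2))"
proof -
  have c: "continuous_on (closure \<Omega>) (sym_grad \<Omega> \<eta>)" "continuous_on (closure \<Omega>) (divg \<Omega> \<eta>)"
    unfolding sym_grad_def[abs_def] divg_def[abs_def]
    by (intro continuous_intros \<eta> bounded_linear.continuous_on[OF bounded_linear_transpose]
      bounded_linear.continuous_on[OF bounded_linear_trace])+
  note i = L2_norm_on_lebesgue[OF \<Omega> \<xi>] L2_norm_on_lebesgue[OF \<Omega> c(1)] L2_norm_on_lebesgue[OF \<Omega> c(2), unfolded real_norm_def power2_abs]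
  show ?thesis unfolding elastic_norm_power2[OF pos] i(2,4,6)
    using i(1,3,5) by (simp add: set_integral_add)
qed

theorem theorem4p1:
  fixes \<Omega>f \<Omega>s \<Gamma> Df Ds :: "(real^'d) set"
    and \<sigma> :: "(real^'d) measure"
    and \<rho>f \<mu>f \<rho>s \<mu>s lam L T dt :: real
    and N M :: nat
    and u \<eta> \<xi> :: "nat \<Rightarrow> real \<Rightarrow> real^'d \<Rightarrow> real^'d"
    and p :: "nat \<Rightarrow> real \<Rightarrow> real^'d \<Rightarrow> real"
    and Sf Ss :: "nat \<Rightarrow> real \<Rightarrow> real^'d \<Rightarrow> real^'d^'d"
  assumes dim: "CARD('d) \<in> {2, 3}"
    and domains: "lipschitz_domain \<Omega>f" "lipschitz_domain \<Omega>s"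
    and surface: "surface_measure \<Omega>f \<sigma>" "surface_measure \<Omega>s \<sigma>"
    and interface: "\<Gamma> \<in> sets borel" "\<Gamma> \<subseteq> frontier \<Omega>f \<inter> frontier \<Omega>s"
    and normals: "AE x in \<sigma>. x \<in> \<Gamma> \<longrightarrow> outward_normal \<Omega>f x = - outward_normal \<Omega>s x"
    and dirichlet_parts: "Df \<subseteq> frontier \<Omega>f - \<Gamma>" "Ds \<subseteq> frontier \<Omega>s - \<Gamma>"
    and constants: "\<rho>f > 0" "\<mu>f > 0" "\<rho>s > 0" "\<mu>s > 0" "lam > 0" "L > 0"
    and time: "T > 0" "N \<ge> 1" "dt = T / real N"
    and fluid_stresses: "\<And>n t. Sf (n+1) t = fluid_stress \<mu>f \<Omega>f (u (n+1) t) (p (n+1) t)"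
    and structure_stresses: "\<And>n t. Ss (n+1) t = structure_stress \<mu>s lam \<Omega>s (\<eta> (n+1) t)"
    and initial_velocities:
      "continuous_on (closure \<Omega>f) (u 0 0)" "continuous_on (closure \<Omega>s) (\<xi> 0 0)"
    and initial_stresses:
      "in_L2_on \<sigma> \<Gamma> (\<lambda>x. Sf 0 0 x *v outward_normal \<Omega>f x)"
      "in_L2_on \<sigma> \<Gamma> (\<lambda>x. Ss 0 0 x *v outward_normal \<Omega>s x)"
    and regular:
      "\<And>n. n < N \<Longrightarrow> fluid_regular \<mu>f \<Omega>f (step_interval dt n) (u (n+1)) (p (n+1))"
      "\<And>n. n < N \<Longrightarrow> structure_regular \<mu>s lam \<Omega>s (step_interval dt n) (\<eta> (n+1)) (\<xi> (n+1))"
    and subproblems: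
      "\<And>n. n < N \<Longrightarrow> fluid_subproblem \<rho>f L \<Omega>f \<Gamma> Df \<sigma> dt u \<xi> Sf Ss n"
      "\<And>n. n < N \<Longrightarrow> structure_subproblem \<rho>s L \<Omega>s \<Gamma> Ds \<sigma> dt u \<eta> \<xi> Sf Ss n"
    and M: "1 \<le> M" "M \<le> N"
  shows "energy \<rho>f \<rho>s \<mu>s lam \<Omega>f \<Omega>s dt u \<eta> \<xi> M
           + (\<Sum>n=1..M. dissipation \<mu>f \<Omega>f dt u n)
           + interface_energy L \<Omega>f \<Omega>s \<Gamma> \<sigma> dt u \<xi> Sf Ss M
         \<le> energy \<rho>f \<rho>s \<mu>s lam \<Omega>f \<Omega>s dt u \<eta> \<xi> 0
           + interface_energy L \<Omega>f \<Omega>s \<Gamma> \<sigma> dt u \<xi> Sf Ss 0"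
proof -
  define I where "I = step_interval dt"
  define nf where "nf = outward_normal \<Omega>f"
  define ns where "ns = outward_normal \<Omega>s"
  have dt: "dt > 0" using time by simp
  have I: "I n = {real n * dt..real (n + 1) * dt}" for n by (simp add: I_def step_interval_def)
  have I_le: "real n * dt \<le> real (n + 1) * dt" for n using dt by simp
  have ends: "real n * dt \<in> I n" "real (n + 1) * dt \<in> I n" for n using I_le by (auto simp: I)
  have \<Gamma>f: "\<Gamma> \<subseteq> frontier \<Omega>f" and \<Gamma>s: "\<Gamma> \<subseteq> frontier \<Omega>s" using interface by auto
  have opens: "open \<Omega>f" "open \<Omega>s" using domains by (auto simp: lipschitz_domain_def)

  define E where "E n = energy \<rho>f \<rho>s \<mu>s lam \<Omega>f \<Omega>s dt u \<eta> \<xi> n" for n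
  define H where "H n = dissipation \<mu>f \<Omega>f dt u n" for n
  define J where "J n = interface_energy L \<Omega>f \<Omega>s \<Gamma> \<sigma> dt u \<xi> Sf Ss n" for n
  define N2 where "N2 v = (L2_norm_on \<sigma> \<Gamma> v)\<^sup>2" for v :: "real^'d \<Rightarrow> real^'d"
  define ff where "ff n t y = Sf n t y *v nf y" for n t y
  define fs where "fs n t y = Ss n t y *v ns y" for n t y
  \<comment> \<open>For positive \<open>n\<close>, \<open>K n\<close> is the density in time of
    \<open>J n\<close> and carries the superscript itself, whereas \<open>WF n\<close> and
    \<open>WS n\<close> are indexed by the interval \<open>I n\<close> and hence involve superscript
    \<open>n + 1\<close>.\<close>
  define K where "K n t = L / 2 * (N2 (u n t) + N2 (\<xi> n t)) + 1 / (2 * L) * (N2 (ff n t) + N2 (fs n t))" for n t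
  define WF where "WF n t = (LINT y:\<Gamma>|\<sigma>. u (n + 1) t y \<bullet> ff (n + 1) t y)" for n t
  define WS where "WS n t = (LINT y:\<Gamma>|\<sigma>. \<xi> (n + 1) t y \<bullet> fs (n + 1) t y)" for n t

  have scu: "space_C1 (I n) \<Omega>f (u (n + 1))" and sc\<xi>: "space_C1 (I n) \<Omega>s (\<xi> (n + 1))"
    and sc\<eta>: "space_C1 (I n) \<Omega>s (\<eta> (n + 1))" if "n < N" for n
    using regular[OF that] by (auto simp: fluid_regular_def structure_regular_def I_def)

  have fluid:
      "continuous_on (I n \<times> closure \<Omega>f) (\<lambda>(t, x). Sf (n + 1) t x)"
      "\<And>t. t \<in> I n \<Longrightarrow> set_integrable \<sigma> \<Gamma> (\<lambda>y. u (n + 1) t y \<bullet> ff (n + 1) t y)"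
      "set_integrable lborel (I n) (WF n)"
      "\<rho>f / 2 * (LINT x:\<Omega>f|lborel. (norm (u (n + 1) (real (n + 1) * dt) x))\<^sup>2)
        + 2 * \<mu>f * (LINT t:I n|lborel. LINT x:\<Omega>f|lborel. (norm (sym_grad \<Omega>f (u (n + 1) t) x))\<^sup>2)
      = \<rho>f / 2 * (LINT x:\<Omega>f|lborel. (norm (u (n + 1) (real n * dt) x))\<^sup>2) + (LINT t:I n|lborel. WF n t)"
    if n: "n < N" for n
  proof -
    note sub = subproblems(1)[OF n, unfolded fluid_subproblem_def, folded I_def]
    have 1: "\<rho>f *\<^sub>R time_deriv (I n) (u (n + 1)) t x - tensor_div \<Omega>f (Sf (n + 1) t) x = 0 \<and> divg \<Omega>f (u (n + 1) t) x = 0"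
      if "t \<in> I n" "x \<in> \<Omega>f" for t x using sub that by blast
    have 2: "u (n + 1) t x = 0" if "t \<in> I n" "x \<in> Df" for t x using sub that by blast
    have 3: "AE x in \<sigma>. x \<in> frontier \<Omega>f - \<Gamma> - Df \<longrightarrow> Sf (n + 1) t x *v outward_normal \<Omega>f x = 0"
      if "t \<in> I n" for t using sub that by blast
    note A = domains(1) surface(1) interface(1) \<Gamma>f I_le regular(1)[OF n, folded I_def, unfolded I]
      fluid_stresses 1[unfolded I] 2[unfolded I] 3[unfolded I]
    show "continuous_on (I n \<times> closure \<Omega>f) (\<lambda>(t, x). Sf (n + 1) t x)"
      unfolding I by (rule fluid_stress_continuous[OF A])
    show "\<And>t. t \<in> I n \<Longrightarrow> set_integrable \<sigma> \<Gamma> (\<lambda>y. u (n + 1) t y \<bullet> ff (n + 1) t y)"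
      unfolding I ff_def nf_def by (rule fluid_work_integrable[OF A])
    show "set_integrable lborel (I n) (WF n)"
      unfolding I ff_def nf_def WF_def[abs_def] by (rule fluid_work_integrable_time[OF A])
    show "\<rho>f / 2 * (LINT x:\<Omega>f|lborel. (norm (u (n + 1) (real (n + 1) * dt) x))\<^sup>2)
        + 2 * \<mu>f * (LINT t:I n|lborel. LINT x:\<Omega>f|lborel. (norm (sym_grad \<Omega>f (u (n + 1) t) x))\<^sup>2)
      = \<rho>f / 2 * (LINT x:\<Omega>f|lborel. (norm (u (n + 1) (real n * dt) x))\<^sup>2) + (LINT t:I n|lborel. WF n t)"
      unfolding I ff_def nf_def WF_def by (rule fluid_energy_balance[OF A])
  qed

  have solid:
      "continuous_on (I n \<times> closure \<Omega>s) (\<lambda>(t, x). Ss (n + 1) t x)"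
      "\<And>t. t \<in> I n \<Longrightarrow> set_integrable \<sigma> \<Gamma> (\<lambda>y. \<xi> (n + 1) t y \<bullet> fs (n + 1) t y)"
      "set_integrable lborel (I n) (WS n)"
      "\<rho>s / 2 * (L2_norm_on lebesgue \<Omega>s (\<xi> (n + 1) (real (n + 1) * dt)))\<^sup>2 +
         1 / 2 * (elastic_norm \<mu>s lam \<Omega>s (\<eta> (n + 1) (real (n + 1) * dt)))\<^sup>2
       = \<rho>s / 2 * (L2_norm_on lebesgue \<Omega>s (\<xi> (n + 1) (real n * dt)))\<^sup>2 +
         1 / 2 * (elastic_norm \<mu>s lam \<Omega>s (\<eta> (n + 1) (real n * dt)))\<^sup>2 + (LINT t:I n|lborel. WS n t)"
    if n: "n < N" for n
  proof -
    note sub = subproblems(2)[OF n, unfolded structure_subproblem_def, folded I_def]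
    have 1: "time_deriv (I n) (\<eta> (n + 1)) t x = \<xi> (n + 1) t x \<and>
        \<rho>s *\<^sub>R time_deriv (I n) (\<xi> (n + 1)) t x - tensor_div \<Omega>s (Ss (n + 1) t) x = 0"
      if "t \<in> I n" "x \<in> \<Omega>s" for t x using sub that by blast
    have 2: "\<xi> (n + 1) t x = 0" if "t \<in> I n" "x \<in> Ds" for t x using sub that by blast
    have 3: "AE x in \<sigma>. x \<in> frontier \<Omega>s - \<Gamma> - Ds \<longrightarrow> Ss (n + 1) t x *v outward_normal \<Omega>s x = 0"
      if "t \<in> I n" for t using sub that by blast
    note A = domains(2) surface(2) interface(1) \<Gamma>s I_le regular(2)[OF n, folded I_def, unfolded I]
      structure_stresses 1[unfolded I] 2[unfolded I] 3[unfolded I]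
    show "continuous_on (I n \<times> closure \<Omega>s) (\<lambda>(t, x). Ss (n + 1) t x)"
      unfolding I by (rule structure_stress_continuous[OF A])
    show "\<And>t. t \<in> I n \<Longrightarrow> set_integrable \<sigma> \<Gamma> (\<lambda>y. \<xi> (n + 1) t y \<bullet> fs (n + 1) t y)"
      unfolding I fs_def ns_def by (rule structure_work_integrable[OF A])
    show "set_integrable lborel (I n) (WS n)"
      unfolding I fs_def ns_def WS_def[abs_def] by (rule structure_work_integrable_time[OF A])
    note C = space_C1_D(5)[OF sc\<xi>[OF n]] space_C1_D(6)[OF sc\<eta>[OF n]]
    note L = structure_energy_lborel[OF domains(2) constants(4,5)]
    show "\<rho>s / 2 * (L2_norm_on lebesgue \<Omega>s (\<xi> (n + 1) (real (n + 1) * dt)))\<^sup>2 +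
         1 / 2 * (elastic_norm \<mu>s lam \<Omega>s (\<eta> (n + 1) (real (n + 1) * dt)))\<^sup>2
       = \<rho>s / 2 * (L2_norm_on lebesgue \<Omega>s (\<xi> (n + 1) (real n * dt)))\<^sup>2 +
         1 / 2 * (elastic_norm \<mu>s lam \<Omega>s (\<eta> (n + 1) (real n * dt)))\<^sup>2 + (LINT t:I n|lborel. WS n t)"
      unfolding L[OF C(1)[OF ends(1)] C(2)[OF ends(1)]] L[OF C(1)[OF ends(2)] C(2)[OF ends(2)]]
      unfolding I fs_def ns_def WS_def by (rule structure_energy_balance[OF A])
  qed

  have balance: "E (n + 1) + H (n + 1) = E n + (LINT t:I n|lborel. WF n t) + (LINT t:I n|lborel. WS n t)"
    if n: "n < N" for n
  proof -
    \<comment> \<open>The quantities are defined with \<open>lebesgue\<close>, the energy balances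
      are proved with \<open>lborel\<close>; for the continuous integrands here the integrals
      agree.\<close>
    have D: "(L2_norm_on lebesgue \<Omega>f (sym_grad \<Omega>f (u (n + 1) t)))\<^sup>2 =
        (LINT x:\<Omega>f|lborel. (norm (sym_grad \<Omega>f (u (n + 1) t) x))\<^sup>2)" if "t \<in> I n" for t
    proof (rule L2_norm_on_lebesgue(2)[OF domains(1)])
      show "continuous_on (closure \<Omega>f) (sym_grad \<Omega>f (u (n + 1) t))"
        by (rule continuous_on_slice_right[where k = "\<lambda>t. sym_grad \<Omega>f (u (n + 1) t)", OF _ that])
          (use space_C1_D(3)[OF scu[OF n]] in \<open>simp add: case_prod_beta'\<close>)
    qed
    have "set_integrable lborel (I n) (\<lambda>t. LINT x:\<Omega>f|lborel. (norm (sym_grad \<Omega>f (u (n + 1) t) x))\<^sup>2)"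
      unfolding I
    proof (rule cylinder_inner_integrable_time)
      show "continuous_on ({real n * dt..real (n + 1) * dt} \<times> closure \<Omega>f) (\<lambda>(t, x). (norm (sym_grad \<Omega>f (u (n + 1) t) x))\<^sup>2)"
        unfolding case_prod_beta' by (intro continuous_intros space_C1_D(3)[OF scu[OF n], unfolded I])
    qed (use domains in \<open>auto simp: lipschitz_domain_def\<close>)
    hence "(LINT t:I n|lebesgue. LINT x:\<Omega>f|lborel. (norm (sym_grad \<Omega>f (u (n + 1) t) x))\<^sup>2) =
        (LINT t:I n|lborel. LINT x:\<Omega>f|lborel. (norm (sym_grad \<Omega>f (u (n + 1) t) x))\<^sup>2)"
      by (rule set_integral_lebesgue)
    moreover have "(LINT t:I n|lebesgue. (L2_norm_on lebesgue \<Omega>f (sym_grad \<Omega>f (u (n + 1) t)))\<^sup>2) =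
        (LINT t:I n|lebesgue. LINT x:\<Omega>f|lborel. (norm (sym_grad \<Omega>f (u (n + 1) t) x))\<^sup>2)"
      using D by (intro set_lebesgue_integral_cong) (auto simp: I)
    ultimately have H: "H (n + 1) = 2 * \<mu>f * (LINT t:I n|lborel. LINT x:\<Omega>f|lborel. (norm (sym_grad \<Omega>f (u (n + 1) t) x))\<^sup>2)"
      by (simp add: H_def dissipation_def I_def)
    note C = space_C1_D(5)[OF scu[OF n]]
    have F: "(L2_norm_on lebesgue \<Omega>f (u (n + 1) t))\<^sup>2 = (LINT x:\<Omega>f|lborel. (norm (u (n + 1) t x))\<^sup>2)" if "t \<in> I n" for t
      by (rule L2_norm_on_lebesgue(2)[OF domains(1) C[OF that]])
    have init: "u (n + 1) (real n * dt) x = u n (real n * dt) x" if "x \<in> \<Omega>f" for x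
      using subproblems(1)[OF n] that unfolding fluid_subproblem_def by blast
    have init': "\<xi> (n + 1) (real n * dt) x = \<xi> n (real n * dt) x" "\<eta> (n + 1) (real n * dt) x = \<eta> n (real n * dt) x"
      if "x \<in> \<Omega>s" for x
      using subproblems(2)[OF n] that unfolding structure_subproblem_def by blast+
    \<comment> \<open>At a time node the energy is defined with superscript \<open>n\<close>, while
      the balance on the next interval starts from superscript \<open>n + 1\<close>; the initial
      conditions make the two agree.\<close>
    have En: "E n = \<rho>s / 2 * (L2_norm_on lebesgue \<Omega>s (\<xi> (n + 1) (real n * dt)))\<^sup>2 +
         1 / 2 * (elastic_norm \<mu>s lam \<Omega>s (\<eta> (n + 1) (real n * dt)))\<^sup>2 +
         \<rho>f / 2 * (L2_norm_on lebesgue \<Omega>f (u (n + 1) (real n * dt)))\<^sup>2"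
      unfolding E_def energy_def
      using L2_norm_on_cong[of \<Omega>f "u (n + 1) (real n * dt)" "u n (real n * dt)", OF init]
        L2_norm_on_cong[of \<Omega>s "\<xi> (n + 1) (real n * dt)" "\<xi> n (real n * dt)", OF init'(1)]
        elastic_norm_cong[OF opens(2), of "\<eta> (n + 1) (real n * dt)" "\<eta> n (real n * dt)", OF init'(2)]
      by simp
    show ?thesis
      using fluid(4)[OF n] solid(4)[OF n] F[OF ends(1)] F[OF ends(2)]
      unfolding H En by (simp add: E_def energy_def)
  qed

  have L2: "in_L2_on \<sigma> \<Gamma> (u (n + 1) t)" "in_L2_on \<sigma> \<Gamma> (\<xi> (n + 1) t)"
      "in_L2_on \<sigma> \<Gamma> (ff (n + 1) t)" "in_L2_on \<sigma> \<Gamma> (fs (n + 1) t)" if n: "n < N" and t: "t \<in> I n" for n t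
  proof -
    have c: "continuous_on (I n \<times> closure \<Omega>f) (\<lambda>(t, x). u (n + 1) t x)" "continuous_on (I n \<times> closure \<Omega>s) (\<lambda>(t, x). \<xi> (n + 1) t x)"
      using scu[OF n] sc\<xi>[OF n] by (auto simp: space_C1_def)
    show "in_L2_on \<sigma> \<Gamma> (u (n + 1) t)"
      by (rule velocity_L2[OF domains(1) surface(1) interface(1) \<Gamma>f c(1)[unfolded I] t[unfolded I]])
    show "in_L2_on \<sigma> \<Gamma> (\<xi> (n + 1) t)"
      by (rule velocity_L2[OF domains(2) surface(2) interface(1) \<Gamma>s c(2)[unfolded I] t[unfolded I]])
    show "in_L2_on \<sigma> \<Gamma> (ff (n + 1) t)" unfolding ff_def[abs_def] nf_def
      by (rule traction_L2[OF domains(1) surface(1) interface(1) \<Gamma>f fluid(1)[OF n, unfolded I] t[unfolded I]])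
    show "in_L2_on \<sigma> \<Gamma> (fs (n + 1) t)" unfolding fs_def[abs_def] ns_def
      by (rule traction_L2[OF domains(2) surface(2) interface(1) \<Gamma>s solid(1)[OF n, unfolded I] t[unfolded I]])
  qed

  have K: "set_integrable lborel (I n) (K (n + 1))" "(LINT t:I n|lborel. K (n + 1) t) = J (n + 1)" if n: "n < N" for n
  proof -
    have c: "continuous_on (I n \<times> closure \<Omega>f) (\<lambda>(t, x). u (n + 1) t x)" "continuous_on (I n \<times> closure \<Omega>s) (\<lambda>(t, x). \<xi> (n + 1) t x)"
      using scu[OF n] sc\<xi>[OF n] by (auto simp: space_C1_def)
    have i: "set_integrable lborel (I n) (\<lambda>t. N2 (u (n + 1) t))" "set_integrable lborel (I n) (\<lambda>t. N2 (\<xi> (n + 1) t))"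
      "set_integrable lborel (I n) (\<lambda>t. N2 (ff (n + 1) t))" "set_integrable lborel (I n) (\<lambda>t. N2 (fs (n + 1) t))"
      unfolding N2_def I ff_def[abs_def] nf_def fs_def[abs_def] ns_def
      by (rule velocity_integrable_time[OF domains(1) surface(1) interface(1) \<Gamma>f c(1)[unfolded I]]
        velocity_integrable_time[OF domains(2) surface(2) interface(1) \<Gamma>s c(2)[unfolded I]]
        traction_integrable_time[OF domains(1) surface(1) interface(1) \<Gamma>f fluid(1)[OF n, unfolded I]]
        traction_integrable_time[OF domains(2) surface(2) interface(1) \<Gamma>s solid(1)[OF n, unfolded I]])+
    note s = set_integral_add(1)[OF i(1,2)] set_integral_add(1)[OF i(3,4)]
    have m: "set_integrable lborel (I n) (\<lambda>t. L / 2 * (N2 (u (n + 1) t) + N2 (\<xi> (n + 1) t)))"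
      "set_integrable lborel (I n) (\<lambda>t. 1 / (2 * L) * (N2 (ff (n + 1) t) + N2 (fs (n + 1) t)))"
      using s by auto
    show "set_integrable lborel (I n) (K (n + 1))" unfolding K_def[abs_def] by (rule set_integral_add(1)[OF m])
    have "J (n + 1) = L / 2 * (LINT t:I n|lebesgue. N2 (u (n + 1) t) + N2 (\<xi> (n + 1) t)) +
        1 / (2 * L) * (LINT t:I n|lebesgue. N2 (ff (n + 1) t) + N2 (fs (n + 1) t))"
      by (simp add: J_def interface_energy_def I_def N2_def ff_def[abs_def] fs_def[abs_def] nf_def ns_def)
    also have "\<dots> = (LINT t:I n|lborel. K (n + 1) t)"
      unfolding K_def set_integral_add(2)[OF m] set_integral_lebesgue[OF s(1)] set_integral_lebesgue[OF s(2)] by simp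
    finally show "(LINT t:I n|lborel. K (n + 1) t) = J (n + 1)" ..
  qed

  \<comment> \<open>The case \<open>n = 0\<close> freezes the initial data, so its integral over the
    first step produces the factor \<open>dt\<close> in the initial interface energy.\<close>
  define K' where "K' n t = (if n = 0 then K 0 0 else K n (t - dt))" for n t
  have shift_mem: "t - dt \<in> I m" if "t \<in> I (Suc m)" for m t
    using that by (simp add: I algebra_simps)
  have K': "set_integrable lborel (I n) (K' n)" "(LINT t:I n|lborel. K' n t) = J n" if n: "n < N" for n
  proof -
    have "set_integrable lborel (I n) (K' n) \<and> (LINT t:I n|lborel. K' n t) = J n"
    proof (cases n)
      case 0
      have "K' 0 = (\<lambda>t. K 0 0)" by (simp add: K'_def fun_eq_iff)
      moreover have "set_integrable lborel (I 0) (\<lambda>t. K 0 0)"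
        unfolding I by (rule set_integrable_continuous_Icc) simp
      moreover have "(LINT t:I 0|lborel. K 0 0) = dt * K 0 0"
        using dt by (simp add: I set_lebesgue_integral_def)
      moreover have "dt * K 0 0 = J 0"
        using constants(6) by (simp add: J_def interface_energy_def K_def N2_def ff_def[abs_def] fs_def[abs_def] nf_def ns_def field_simps)
      ultimately show ?thesis using 0 by simp
    next
      case (Suc m)
      hence m: "m < N" using n by simp
      have In: "I n = {real m * dt + dt..real (m + 1) * dt + dt}" by (simp add: I Suc algebra_simps)
      have K'n: "K' n = (\<lambda>t. K (m + 1) (t - dt))" by (simp add: K'_def Suc fun_eq_iff)
      note T = set_integral_translate[OF K(1)[OF m, unfolded I], of dt]
      show ?thesis unfolding In K'n using T K(2)[OF m, unfolded I] by (simp add: Suc)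
    qed
    thus "set_integrable lborel (I n) (K' n)" "(LINT t:I n|lborel. K' n t) = J n" by auto
  qed

  have pointwise: "WF n t + WS n t + K (n + 1) t \<le> K' n t" if n: "n < N" and t: "t \<in> I n" for n t
  proof -
    define us where "us = time_shift dt u n t"
    define xs where "xs = time_shift dt \<xi> n t"
    define fsh where "fsh y = time_shift dt Sf n t y *v nf y" for y
    define ssh where "ssh y = time_shift dt Ss n t y *v ns y" for y
    have L2': "in_L2_on \<sigma> \<Gamma> us" "in_L2_on \<sigma> \<Gamma> xs" "in_L2_on \<sigma> \<Gamma> fsh" "in_L2_on \<sigma> \<Gamma> ssh"
      and K'eq: "K' n t = L / 2 * (N2 us + N2 xs) + 1 / (2 * L) * (N2 fsh + N2 ssh)"
    proof -
      have "in_L2_on \<sigma> \<Gamma> us \<and> in_L2_on \<sigma> \<Gamma> xs \<and> in_L2_on \<sigma> \<Gamma> fsh \<and> in_L2_on \<sigma> \<Gamma> ssh \<and>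
        K' n t = L / 2 * (N2 us + N2 xs) + 1 / (2 * L) * (N2 fsh + N2 ssh)"
      \<comment> \<open>In the first step square integrability comes from the assumptions on the
        initial data, later from the regularity of the preceding step, whose interval contains
        \<open>t - dt\<close>.\<close>
      proof (cases n)
        case 0
        have eqs: "us = u 0 0" "xs = \<xi> 0 0" "fsh = ff 0 0" "ssh = fs 0 0"
          by (auto simp: us_def xs_def fsh_def ssh_def time_shift_def 0 ff_def fs_def)
        show ?thesis unfolding eqs
          using trace_L2[OF domains(1) surface(1) interface(1) \<Gamma>f initial_velocities(1)]
            trace_L2[OF domains(2) surface(2) interface(1) \<Gamma>s initial_velocities(2)] initial_stresses
          by (simp add: K'_def K_def 0 ff_def[abs_def] fs_def[abs_def] nf_def ns_def)
      next
        case (Suc m)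
        have eqs: "us = u (m + 1) (t - dt)" "xs = \<xi> (m + 1) (t - dt)" "fsh = ff (m + 1) (t - dt)" "ssh = fs (m + 1) (t - dt)"
          by (auto simp: us_def xs_def fsh_def ssh_def time_shift_def Suc ff_def fs_def)
        show ?thesis unfolding eqs
          using L2[of m "t - dt"] shift_mem[of t m] n t by (simp add: Suc K'_def K_def)
      qed
      thus "in_L2_on \<sigma> \<Gamma> us" "in_L2_on \<sigma> \<Gamma> xs" "in_L2_on \<sigma> \<Gamma> fsh" "in_L2_on \<sigma> \<Gamma> ssh"
        "K' n t = L / 2 * (N2 us + N2 xs) + 1 / (2 * L) * (N2 fsh + N2 ssh)" by auto
    qed
    have "AE y in \<sigma>. y \<in> \<Gamma> \<longrightarrow> L *\<^sub>R u (n + 1) t y + Sf (n + 1) t y *v nf y = robin_data L dt u \<xi> Sf Ss n t y (nf y)"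
      using subproblems(1)[OF n] t unfolding fluid_subproblem_def I_def nf_def by blast
    hence RF: "AE y in \<sigma>. y \<in> \<Gamma> \<longrightarrow> L *\<^sub>R u (n + 1) t y + ff (n + 1) t y =
        (1/2) *\<^sub>R ((L *\<^sub>R us y + L *\<^sub>R xs y) + (fsh y - ssh y))"
      \<comment> \<open>\<open>fsh\<close> is formed with the fluid normal and \<open>ssh\<close>
        with the structure normal. As the normals are opposite, the sum of the two stress terms in
        the Robin data becomes \<open>fsh - ssh\<close> here and its negative in the structure
        condition.\<close>
      using normals
    proof eventually_elim
      fix y assume "y \<in> \<Gamma> \<longrightarrow> L *\<^sub>R u (n + 1) t y + Sf (n + 1) t y *v nf y = robin_data L dt u \<xi> Sf Ss n t y (nf y)"
        and "y \<in> \<Gamma> \<longrightarrow> outward_normal \<Omega>f y = - outward_normal \<Omega>s y"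
      moreover have "A *v (- ns y) = - (A *v ns y)" for A :: "real^'d^'d"
        by (simp add: vec_eq_iff matrix_vector_mul_component)
      ultimately show "y \<in> \<Gamma> \<longrightarrow> L *\<^sub>R u (n + 1) t y + ff (n + 1) t y = (1/2) *\<^sub>R ((L *\<^sub>R us y + L *\<^sub>R xs y) + (fsh y - ssh y))"
        by (auto simp: ff_def fs_def robin_data_def us_def xs_def fsh_def ssh_def nf_def ns_def
          scaleR_add_right scaleR_diff_right)
    qed
    have "AE y in \<sigma>. y \<in> \<Gamma> \<longrightarrow> L *\<^sub>R \<xi> (n + 1) t y + Ss (n + 1) t y *v ns y = robin_data L dt u \<xi> Sf Ss n t y (ns y)"
      using subproblems(2)[OF n] t unfolding structure_subproblem_def I_def ns_def by blast
    hence RS: "AE y in \<sigma>. y \<in> \<Gamma> \<longrightarrow> L *\<^sub>R \<xi> (n + 1) t y + fs (n + 1) t y =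
        (1/2) *\<^sub>R ((L *\<^sub>R us y + L *\<^sub>R xs y) - (fsh y - ssh y))"
      using normals
    proof eventually_elim
      fix y assume "y \<in> \<Gamma> \<longrightarrow> L *\<^sub>R \<xi> (n + 1) t y + Ss (n + 1) t y *v ns y = robin_data L dt u \<xi> Sf Ss n t y (ns y)"
        and "y \<in> \<Gamma> \<longrightarrow> outward_normal \<Omega>f y = - outward_normal \<Omega>s y"
      moreover have "A *v (- ns y) = - (A *v ns y)" for A :: "real^'d^'d"
        by (simp add: vec_eq_iff matrix_vector_mul_component)
      ultimately show "y \<in> \<Gamma> \<longrightarrow> L *\<^sub>R \<xi> (n + 1) t y + fs (n + 1) t y = (1/2) *\<^sub>R ((L *\<^sub>R us y + L *\<^sub>R xs y) - (fsh y - ssh y))"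
        by (auto simp: ff_def fs_def robin_data_def us_def xs_def fsh_def ssh_def nf_def ns_def
          scaleR_add_right scaleR_diff_right)
    qed
    show ?thesis unfolding K'eq unfolding K_def N2_def WF_def WS_def
      by (rule robin_inequality_integrated[OF constants(6) RF RS L2[OF n t] L2' fluid(2)[OF n t] solid(2)[OF n t]])
  qed

  have step: "E (n + 1) + H (n + 1) + J (n + 1) \<le> E n + J n" if n: "n < N" for n
  proof -
    note a = set_integral_add[OF fluid(3)[OF n] solid(3)[OF n]]
    note b = set_integral_add[OF a(1) K(1)[OF n]]
    have "(LINT t:I n|lborel. WF n t) + (LINT t:I n|lborel. WS n t) + J (n + 1) =
        (LINT t:I n|lborel. WF n t + WS n t + K (n + 1) t)"
      using a(2) b(2) K(2)[OF n] by simp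
    also have "\<dots> \<le> (LINT t:I n|lborel. K' n t)"
      by (rule set_integral_mono[OF b(1) K'(1)[OF n] pointwise[OF n]])
    also have "\<dots> = J n" by (rule K'(2)[OF n])
    finally show ?thesis using balance[OF n] by linarith
  qed

  have "E m + (\<Sum>n=1..m. H n) + J m \<le> E 0 + J 0" if "m \<le> N" for m
    using that
  proof (induction m)
    case (Suc m)
    thus ?case using step[of m] by simp
  qed simp
  from this[OF M(2)] show ?thesis by (simp add: E_def H_def J_def)
qed

end
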